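(* Let $n\geq 3$ be an integer. The space $$M_{\widetilde B_n}=\{u\in{\mathbb C}^n\mid u_i\pm u_j\notin{\mathbb Z}\ \text{for}\ i\neq j;\ u_k\notin{\mathbb Z}\ \text{for}\ k=1,2,\dots,n\}$$ is aspherical.
   Context: $M_{\widetilde B_n}$ is the complement in ${\mathbb C}^n$ of the (complexified) reflecting hyperplanes of the affine reflection group of type $\widetilde B_n$; it carries the subspace topology from ${\mathbb C}^n$. The condition $u_i\pm u_j\notin{\mathbb Z}$ means that neither $u_i+u_j$ nor $u_i-u_j$ is an integer. A connected space $X$ (here a connected manifold) is aspherical if $\pi_k(X)=0$ for all $k\ge 2$. *)

theory Defs
  imports "HOL-Analysis.Analysis"
begin

definition cube :: "nat \<Rightarrow> (nat \<Rightarrow> real) topology" where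
  "cube k = product_topology (\<lambda>_. top_of_set {0..1}) {..<k}"

definition cube_boundary :: "nat \<Rightarrow> (nat \<Rightarrow> real) set" where
  "cube_boundary k = {t \<in> topspace (cube k). \<exists>i<k. t i = 0 \<or> t i = 1}"

definition spheroids :: "nat \<Rightarrow> 'a topology \<Rightarrow> 'a \<Rightarrow> ((nat \<Rightarrow> real) \<Rightarrow> 'a) set" where
  "spheroids k X x0 =
     {f. continuous_map (cube k) X f \<and> (\<forall>t\<in>cube_boundary k. f t = x0)}"

definition spheroid_homotopy ::
  "nat \<Rightarrow> 'a topology \<Rightarrow> 'a \<Rightarrow> (((nat \<Rightarrow> real) \<Rightarrow> 'a) \<times> ((nat \<Rightarrow> real) \<Rightarrow> 'a)) set" where
  "spheroid_homotopy k X x0 =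
     {(f, g). homotopic_with (\<lambda>h. \<forall>t\<in>cube_boundary k. h t = x0) (cube k) X f g}"

text \<open>The underlying set of the homotopy group of \<open>X\<close> at \<open>x0\<close> in degree \<open>k\<close>. The group
  operation is not needed: a group is zero iff its underlying set is a singleton.\<close>

definition homotopy_group_set ::
  "nat \<Rightarrow> 'a topology \<Rightarrow> 'a \<Rightarrow> ((nat \<Rightarrow> real) \<Rightarrow> 'a) set set" where
  "homotopy_group_set k X x0 = spheroids k X x0 // spheroid_homotopy k X x0"

definition aspherical_space :: "'a topology \<Rightarrow> bool" where
  "aspherical_space X \<longleftrightarrow>
     connected_space X \<and>
     (\<forall>x0\<in>topspace X. \<forall>k\<ge>2. is_singleton (homotopy_group_set k X x0))"

definition affine_B_complement :: "(complex ^ 'n) set" where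
  "affine_B_complement =
     {u. (\<forall>i j. i \<noteq> j \<longrightarrow> u $ i + u $ j \<notin> \<int> \<and> u $ i - u $ j \<notin> \<int>) \<and> (\<forall>k. u $ k \<notin> \<int>)}"

end

theory Submission
  imports Defs
begin

text \<open>
The complement \<open>M\<close> is first compared with a complement of finitely many hyperplanes. Since
\<open>cos\<^sup>2 \<pi>b - cos\<^sup>2 \<pi>a = sin \<pi>(a + b) \<sqdot> sin \<pi>(a - b)\<close>, a point \<open>u\<close> lies in \<open>M\<close> iff the
numbers \<open>c\<^sub>i = cos \<pi>u\<^sub>i\<close> have pairwise distinct squares, all different from \<open>1\<close>. The only critical
values \<open>\<plusminus>1\<close> of \<open>cos \<pi>u\<close> are thereby avoided, so the coordinatewise cosine is a covering of \<open>M\<close> onto the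
set \<open>Y\<close> of all such \<open>c\<close>. Homotopies lift along it (\<open>lift_cos\<close>), and it suffices to contract
maps of cubes into \<open>Y\<close>, relative to the boundary.

Forgetting a coordinate of \<open>Y\<close> is no fibration: \<open>c\<^sub>n \<noteq> \<plusminus>c\<^sub>j\<close> excludes two points,
but only one if \<open>c\<^sub>j = 0\<close>. As in Brieskorn's treatment of the arrangements of type D, the remedy is to keep
the squares \<open>p\<^sub>i = c\<^sub>i\<^sup>2\<close> and \<open>p\<^sub>0 = 1\<close> in the base, and to let the branch point \<open>z = 0\<close> of the
squaring map vary instead. Up to affine maps of the plane, \<open>Y\<close> becomes the space of distinct points
\<open>p\<^sub>0, \<dots>, p\<^sub>n\<close>, a point \<open>z \<noteq> p\<^sub>0\<close> which may collide with the other \<open>p\<^sub>i\<close>, and square roots \<open>c\<^sub>i\<close> of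
\<open>(p\<^sub>i - z) / (p\<^sub>0 - z)\<close>. When the \<open>p\<^sub>i\<close> move, \<open>z\<close> can be dragged along in such a way that it stays on a
\<open>p\<^sub>i\<close> where it starts there, and never meets it otherwise (\<open>drag_point\<close>); the roots \<open>c\<^sub>i\<close>
follow. So homotopies of the \<open>p\<^sub>i\<close> lift, and the question splits into one about configurations of points in
the plane and one about a single fibre. Dragging also lets one forget the points of a configuration one at
a time, where the fibre is a plane with finitely many punctures.

All these fibres are covers of a punctured plane, with square roots adjoined that branch at points of
different heights after a rotation. Cut along the horizontal lines through punctures and branch points.
The fibre is then covered by sheets over the strips between the lines and over thin neighbourhoods of the
cut lines. Each of these pieces is an open starlike planar set up to homeomorphism, two of them meet in nothing or
in a sheet over a convex set, and no three meet: the fibre looks like a graph. For such a space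
\<open>rel_aspherical_of_pieces\<close> contracts every map \<open>f\<close> from a cube. The components of the
preimages of the pieces cover the cube; finitely many suffice, and their nerve is a tree because the cube is
unicoherent. A leaf of this tree is removed by a homotopy that pushes its image into the neighbouring piece, and
in the end \<open>f\<close> takes its values in a single piece, which is contractible. The
component containing the boundary of the cube is never pruned; it exists because that boundary is connected,
which is where dimension at least \<open>2\<close> enters.
\<close>

section \<open>Continuous maps between abstract topologies\<close>

lemma continuous_map_compose_on:
  assumes "continuous_map X euclidean g" "continuous_on S f" "\<And>x. x \<in> topspace X \<Longrightarrow> g x \<in> S"
  shows "continuous_map X euclidean (\<lambda>x. f (g x))"
proof -
  have "continuous_map X (top_of_set S) g"
    using assms(1,3) by (simp add: continuous_map_in_subtopology Pi_iff)
  moreover have "continuous_map (top_of_set S) euclidean f"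
    using assms(2) by simp
  ultimately show ?thesis
    using continuous_map_compose[of X "top_of_set S" g euclidean f] by (simp add: o_def)
qed

lemma continuous_map_compose_on2:
  assumes "continuous_map X euclidean f" "continuous_map X euclidean g"
    and "continuous_on S (\<lambda>p. h (fst p) (snd p))" "\<And>x. x \<in> topspace X \<Longrightarrow> (f x, g x) \<in> S"
  shows "continuous_map X euclidean (\<lambda>x. h (f x) (g x))"
proof -
  have "continuous_map X euclidean (\<lambda>x. (f x, g x))"
    using assms(1,2) continuous_map_pairedI[of X euclidean f euclidean g] by (simp add: euclidean_product_topology)
  from continuous_map_compose_on[OF this assms(3)] assms(4) show ?thesis by simp
qed

lemma continuous_map_mult_field:
  fixes f g :: "'a \<Rightarrow> 'b::real_normed_field"
  assumes "continuous_map X euclidean f" "continuous_map X euclidean g"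
  shows "continuous_map X euclidean (\<lambda>x. f x * g x)"
  by (rule continuous_map_compose_on2[where S=UNIV, OF assms]) (auto intro!: continuous_intros)

lemma continuous_map_divide_field:
  fixes f g :: "'a \<Rightarrow> 'b::real_normed_field"
  assumes "continuous_map X euclidean f" "continuous_map X euclidean g" "\<And>x. x \<in> topspace X \<Longrightarrow> g x \<noteq> 0"
  shows "continuous_map X euclidean (\<lambda>x. f x / g x)"
  by (rule continuous_map_compose_on2[where S="UNIV \<times> -{0}", OF assms(1,2)])
     (auto intro!: continuous_intros assms(3))

lemma continuous_map_euclidean_funI:
  fixes f :: "'a \<Rightarrow> 'i \<Rightarrow> 'b::topological_space"
  assumes "\<And>i. continuous_map X euclidean (\<lambda>x. f x i)"
  shows "continuous_map X euclidean f"
proof -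
  have "continuous_map X (product_topology (\<lambda>_. euclidean) UNIV) f"
    using assms by (simp add: continuous_map_componentwise_UNIV)
  then show ?thesis by (simp only: euclidean_product_topology)
qed

lemma continuous_map_euclidean_funD:
  fixes f :: "'a \<Rightarrow> 'i \<Rightarrow> 'b::topological_space"
  assumes "continuous_map X euclidean f"
  shows "continuous_map X euclidean (\<lambda>x. f x i)"
proof -
  have "continuous_map X (product_topology (\<lambda>_. euclidean) UNIV) f"
    using assms by (simp only: euclidean_product_topology)
  then show ?thesis by (simp add: continuous_map_componentwise_UNIV)
qed

lemma continuous_map_euclidean_PairI:
  assumes "continuous_map X euclidean f" "continuous_map X euclidean g"
  shows "continuous_map X euclidean (\<lambda>x. (f x, g x))"
  using continuous_map_pairedI[OF assms] by (simp add: euclidean_product_topology)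

lemma continuous_map_top_of_setD:
  assumes "continuous_map X (top_of_set S) f"
  shows "continuous_map X euclidean f" "x \<in> topspace X \<Longrightarrow> f x \<in> S"
  using assms by (auto simp: continuous_map_in_subtopology)

lemma continuous_map_top_of_setI:
  assumes "continuous_map X euclidean f" "\<And>x. x \<in> topspace X \<Longrightarrow> f x \<in> S"
  shows "continuous_map X (top_of_set S) f"
  using assms by (simp add: continuous_map_in_subtopology Pi_iff)

lemma continuous_map_paste_closed:
  assumes "closedin X S" "closedin X T" "S \<union> T = topspace X"
    and "continuous_map (subtopology X S) Y f" "continuous_map (subtopology X T) Y g"
    and "\<And>x. x \<in> S \<Longrightarrow> x \<in> T \<Longrightarrow> f x = g x"
  shows "continuous_map X Y (\<lambda>x. if x \<in> S then f x else g x)"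
proof (rule pasting_lemma_closed[where I="UNIV::bool set" and T="\<lambda>b. if b then S else T"
      and f="\<lambda>b. if b then f else g"])
  show "\<exists>j. j \<in> UNIV \<and> x \<in> (if j then S else T) \<and>
         (if x \<in> S then f x else g x) = (if j then f else g) x" if "x \<in> topspace X" for x
    using that assms(3) by (intro exI[where x="x \<in> S"]) auto
qed (use assms in auto)

lemma continuous_map_countable_range_constant:
  fixes f :: "'a \<Rightarrow> 'b::metric_space"
  assumes "connectedin X S" "continuous_map (subtopology X S) euclidean f" "f ` S \<subseteq> C" "countable C"
    "x \<in> S" "y \<in> S"
  shows "f x = f y"
proof (rule ccontr)
  assume "f x \<noteq> f y"
  have "connectedin (subtopology X S) S" using assms(1) by (simp add: connectedin_absolute)
  then have "connected (f ` S)"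
    using connectedin_continuous_map_image[OF assms(2)] by simp
  with \<open>f x \<noteq> f y\<close> have "uncountable (f ` S)"
    using connected_uncountable assms(5,6) by (metis image_eqI)
  then show False using assms(3,4) countable_subset by blast
qed

lemma countable_exp_eq_1: "countable {z::complex. exp z = 1}"
proof (rule countable_subset)
  show "{z. exp z = 1} \<subseteq> range (\<lambda>n::int. \<i> * of_real (of_int (2*n) * pi))"
  proof
    fix z assume "z \<in> {z::complex. exp z = 1}"
    then obtain n::int where "Re z = 0" "Im z = of_int (2*n) * pi" by (auto simp: exp_eq_1)
    then have "z = \<i> * of_real (of_int (2*n) * pi)" by (simp add: complex_eq_iff)
    then show "z \<in> range (\<lambda>n::int. \<i> * of_real (of_int (2*n) * pi))" by blast
  qed
qed simp

section \<open>Relative asphericity and absolute extensors\<close>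

text \<open>For a cube \<open>K\<close> of dimension \<open>k\<close> with boundary \<open>A\<close> this is the vanishing of the \<open>k\<close>-th homotopy of \<open>X\<close> at
all base points simultaneously. Treating \<open>K\<close> as an abstract space keeps the dimension out of the
types.\<close>
definition rel_aspherical :: "'k topology \<Rightarrow> 'k set \<Rightarrow> 'a topology \<Rightarrow> bool" where
  "rel_aspherical K A X \<longleftrightarrow>
     (\<forall>f x0. continuous_map K X f \<and> (\<forall>t\<in>A. f t = x0) \<longrightarrow>
        homotopic_with (\<lambda>h. \<forall>t\<in>A. h t = x0) K X f (\<lambda>_. x0))"

lemma rel_asphericalD:
  assumes "rel_aspherical K A X" "continuous_map K X f" "\<And>t. t \<in> A \<Longrightarrow> f t = x0"
  shows "homotopic_with (\<lambda>h. \<forall>t\<in>A. h t = x0) K X f (\<lambda>_. x0)"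
  using assms unfolding rel_aspherical_def by simp

text \<open>An absolute extensor has this property for all normal \<open>N\<close>. The test space is a parameter
because one formula cannot range over topologies on all types; the cube \<open>K\<close> and
the cylinder over \<open>K\<close> are the only ones that occur.\<close>
definition absolute_extensor_for :: "'m topology \<Rightarrow> 'a topology \<Rightarrow> bool" where
  "absolute_extensor_for N X \<longleftrightarrow>
     (\<forall>C g. closedin N C \<and> continuous_map (subtopology N C) X g \<longrightarrow>
        (\<exists>g'. continuous_map N X g' \<and> (\<forall>x\<in>C. g' x = g x)))"

lemma absolute_extensorE:
  assumes "absolute_extensor_for N X" "closedin N C" "continuous_map (subtopology N C) X g"
  obtains g' where "continuous_map N X g'" "\<forall>x\<in>C. g' x = g x"
  using assms unfolding absolute_extensor_for_def by blast

section \<open>Unicoherence and nerves of finite covers\<close>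

locale compact_parameter =
  fixes K :: "'k topology"
  assumes compact_K: "compact_space K"

text \<open>What the argument uses about a cube of dimension at least \<open>2\<close> and its boundary. The existence of logarithms
replaces simple connectivity: it says that all maps to the punctured plane are homotopically trivial.\<close>
locale logarithmic_pair = compact_parameter K for K :: "'k topology" +
  fixes A :: "'k set"
  assumes Hausdorff_K: "Hausdorff_space K"
    and connected_K: "connected_space K" and locally_connected_K: "locally_connected_space K"
    and logarithm: "\<And>g. \<lbrakk>continuous_map K euclidean g; \<And>x. x \<in> topspace K \<Longrightarrow> g x \<noteq> (0::complex)\<rbrakk>
          \<Longrightarrow> \<exists>h. continuous_map K euclidean h \<and> (\<forall>x\<in>topspace K. g x = exp (h x))"
    and closed_A: "closedin K A" and connected_A: "connectedin K A" and nonempty_A: "A \<noteq> {}"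
begin

lemma A_subset: "A \<subseteq> topspace K" using closed_A closedin_subset by blast

lemma normal_K: "normal_space K"
  by (simp add: compact_Hausdorff_or_regular_imp_normal_space compact_K Hausdorff_K)

text \<open>If the intersection split into two open parts \<open>P\<close> and \<open>R\<close>, then some map to the circle would wind once on
the way from \<open>O1 - O2\<close> through \<open>P\<close> to \<open>O2 - O1\<close> and be constant outside \<open>P\<close>. It would have no logarithm:
going through \<open>P\<close> and back through \<open>R\<close> changes the argument by \<open>2\<pi>\<close>.\<close>
lemma open_unicoherence:
  assumes O: "openin K O1" "connectedin K O1" and Q: "openin K O2" "connectedin K O2"
    and un: "O1 \<union> O2 = topspace K"
  shows "connectedin K (O1 \<inter> O2)"
proof (rule ccontr)
  assume "\<not> connectedin K (O1 \<inter> O2)"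
  moreover have "openin K (O1 \<inter> O2)" using O Q by blast
  moreover have "O1 \<inter> O2 \<subseteq> topspace K" using un by blast
  ultimately obtain E1 E2 where E: "openin K E1" "openin K E2" "O1 \<inter> O2 \<subseteq> E1 \<union> E2"
      "E1 \<inter> E2 \<inter> (O1 \<inter> O2) = {}" "E1 \<inter> (O1 \<inter> O2) \<noteq> {}" "E2 \<inter> (O1 \<inter> O2) \<noteq> {}"
    unfolding connectedin by blast
  define P where "P = E1 \<inter> (O1 \<inter> O2)"
  define R where "R = E2 \<inter> (O1 \<inter> O2)"
  have P: "openin K P" and R: "openin K R" and PR: "P \<union> R = O1 \<inter> O2" "P \<inter> R = {}" "P \<noteq> {}" "R \<noteq> {}"
    using E O Q by (auto simp: P_def R_def)
  have cl: "closedin K (topspace K - O1)" "closedin K (topspace K - O2)" using O Q by auto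
  have dj: "disjnt (topspace K - O2) (topspace K - O1)"
    using un by (auto simp: disjnt_def)
  obtain \<phi> where \<phi>: "continuous_map K euclideanreal \<phi>" "\<phi> ` (topspace K - O2) \<subseteq> {0}" "\<phi> ` (topspace K - O1) \<subseteq> {1}"
    by (rule Urysohn_lemma_alt[OF normal_K cl(2) cl(1) dj])
  have \<phi>0: "\<phi> x = 0" if "x \<in> topspace K" "x \<notin> O2" for x using that \<phi> by blast
  have \<phi>1: "\<phi> x = 1" if "x \<in> topspace K" "x \<notin> O1" for x using that \<phi> by blast
  define e where "e = (\<lambda>x. exp (2 * of_real pi * \<i> * of_real (\<phi> x)))"
  have e: "continuous_map K euclidean e"
    unfolding e_def by (rule continuous_map_compose_on[OF \<phi>(1), where S=UNIV]) (auto intro!: continuous_intros)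
  have e1: "e x = 1" if "x \<in> topspace K" "x \<notin> O1 \<inter> O2" for x
    using \<phi>0[of x] \<phi>1[of x] that by (auto simp: e_def exp_two_pi_i mult.commute)
  define g where "g = (\<lambda>x. if x \<in> topspace K - R then e x else 1)"
  have "continuous_map K euclidean g"
    unfolding g_def
  proof (rule continuous_map_paste_closed[where T="topspace K - P"])
    show "e x = 1" if "x \<in> topspace K - R" "x \<in> topspace K - P" for x
      using that PR e1 by blast
  qed (use P R PR e in \<open>auto intro: continuous_map_from_subtopology\<close>)
  moreover have "g x \<noteq> 0" for x by (simp add: g_def e_def)
  ultimately have "\<exists>h. continuous_map K euclidean h \<and> (\<forall>x\<in>topspace K. g x = exp (h x))"
    by (rule logarithm)
  then obtain h where h: "continuous_map K euclidean h" "\<And>x. x \<in> topspace K \<Longrightarrow> g x = exp (h x)"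
    by metis
  \<comment> \<open>On \<open>O1\<close> and on \<open>O2\<close> the logarithm \<open>h\<close> of \<open>g\<close> differs by a constant from an explicit one;
     the explicit ones differ by \<open>2\<pi>i\<close> on \<open>P\<close> and agree on \<open>R\<close>.\<close>
  have const: "\<exists>c. \<forall>x\<in>U. h x - 2 * of_real pi * \<i> * of_real (if x \<in> P then \<phi> x - s else 0) = c"
    if U: "connectedin K U" "openin K U" "\<And>x. x \<in> U \<Longrightarrow> x \<notin> P \<Longrightarrow> x \<notin> R \<Longrightarrow> \<phi> x = s"
      and s: "s = 0 \<or> s = 1" and "P \<subseteq> U" for U s
  proof -
    have Us: "U \<subseteq> topspace K" using U openin_subset by blast
    let ?k = "\<lambda>x. if x \<in> U - R then \<phi> x - s else 0"
    have k: "continuous_map (subtopology K U) euclideanreal ?k"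
    proof (rule continuous_map_paste_closed[where T="U - P"])
      show "closedin (subtopology K U) (U - R)" "closedin (subtopology K U) (U - P)"
        using P R Us by (auto simp: closedin_def openin_subtopology_Int2 Diff_Diff_Int topspace_subtopology Int_absorb1)
      show "U - R \<union> (U - P) = topspace (subtopology K U)"
        using Us PR by auto
      show "continuous_map (subtopology (subtopology K U) (U - R)) euclideanreal (\<lambda>x. \<phi> x - s)"
        by (intro continuous_map_from_subtopology continuous_map_diff \<phi>) auto
    qed (use that in auto)
    have eq: "?k x = (if x \<in> P then \<phi> x - s else 0)" if "x \<in> U" for x
      using that U(3)[of x] PR by auto
    let ?F = "\<lambda>x. h x - 2 * of_real pi * \<i> * of_real (?k x)"
    have "continuous_map (subtopology K U) euclidean ?F"
      by (intro continuous_map_diff continuous_map_from_subtopology h continuous_map_compose_on[OF k, where S=UNIV])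
         (auto intro!: continuous_intros)
    moreover have "?F ` U \<subseteq> {z. exp z = 1}"
    proof clarify
      fix x assume x: "x \<in> U"
      have "exp (2 * of_real pi * \<i> * of_real (?k x)) = g x"
      proof (cases "x \<in> P")
        case True
        then have "x \<notin> R" "x \<in> topspace K" using PR x Us by auto
        have "exp (2 * of_real pi * \<i> * complex_of_real (\<phi> x - s)) = e x"
          using s by (auto simp: e_def algebra_simps exp_diff exp_two_pi_i mult.commute exp_two_pi_i')
        with \<open>x \<notin> R\<close> \<open>x \<in> topspace K\<close> show ?thesis by (simp add: x g_def)
      next
        case False
        have "g x = 1" using False x Us PR e1 unfolding g_def by (metis DiffD2 UnE subsetD)
        with False show ?thesis using eq[OF x] by simp
      qed
      then show "exp (?F x) = 1" using h(2) x Us by (auto simp: exp_diff)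
    qed
    ultimately have "?F x = ?F y" if "x \<in> U" "y \<in> U" for x y
      using continuous_map_countable_range_constant[OF U(1) _ _ countable_exp_eq_1 that] by blast
    then have F: "?F x = ?F (SOME y. y \<in> U)" if "x \<in> U" for x
      using that by (metis someI)
    show ?thesis
    proof (intro exI ballI)
      fix x assume x: "x \<in> U"
      show "h x - 2 * of_real pi * \<i> * of_real (if x \<in> P then \<phi> x - s else 0) = ?F (SOME y. y \<in> U)"
        using F[OF x] unfolding eq[OF x] .
    qed
  qed
  obtain a r where ar: "a \<in> P" "r \<in> R" using PR by blast
  obtain c where c: "\<And>x. x\<in>O1 \<Longrightarrow> h x - 2 * of_real pi * \<i> * of_real (if x \<in> P then \<phi> x - 0 else 0) = c"
    using const[of O1 0] O \<phi>0 PR openin_subset[OF O(1)] by blast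
  obtain d where d: "\<And>x. x\<in>O2 \<Longrightarrow> h x - 2 * of_real pi * \<i> * of_real (if x \<in> P then \<phi> x - 1 else 0) = d"
    using const[of O2 1] Q \<phi>1 PR openin_subset[OF Q(1)] by blast
  have "a \<in> O1" "a \<in> O2" "r \<in> O1" "r \<in> O2" "r \<notin> P" using ar PR by blast+
  then have "c = d" using c[of r] d[of r] by simp
  define w where "w = 2 * complex_of_real pi * \<i>"
  have "h a - w * of_real (\<phi> a) = c" "h a - w * of_real (\<phi> a - 1) = d"
    using c[OF \<open>a \<in> O1\<close>] d[OF \<open>a \<in> O2\<close>] ar(1) by (simp_all add: w_def)
  with \<open>c = d\<close> have "w = 0" by (simp add: algebra_simps)
  then show False by (simp add: w_def)
qed

text \<open>The nerve of \<open>\<C>\<close> is a connected graph, so some vertex \<open>C \<noteq> C0\<close> does not disconnect it: the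
complement of a maximal proper subfamily that contains \<open>C0\<close> and has connected union is a single set. By unicoherence such
a \<open>C\<close> meets the union of the other sets in a connected set, and that set cannot be
distributed over two of them, as no three sets meet.\<close>
lemma leaf_exists:
  assumes fin: "finite \<C>" and cells: "\<And>C. C \<in> \<C> \<Longrightarrow> openin K C \<and> connectedin K C \<and> C \<noteq> {}"
    and cover: "\<Union>\<C> = topspace K" and C0: "C0 \<in> \<C>" and two: "\<C> \<noteq> {C0}"
    and triple: "\<And>C D E. \<lbrakk>C \<in> \<C>; D \<in> \<C>; E \<in> \<C>; C \<noteq> D; C \<noteq> E; D \<noteq> E\<rbrakk> \<Longrightarrow> C \<inter> D \<inter> E = {}"
  obtains C D where "C \<in> \<C>" "C \<noteq> C0" "D \<in> \<C>" "D \<noteq> C" "C \<inter> D \<noteq> {}"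
    "\<forall>E\<in>\<C> - {C, D}. C \<inter> E = {}"
proof -
  let ?ok = "\<lambda>\<D>. \<D> \<subset> \<C> \<and> C0 \<in> \<D> \<and> connectedin K (\<Union>\<D>)"
  have "?ok {C0}" using C0 two cells by auto
  then obtain \<D> where \<D>: "?ok \<D>" and max: "\<And>\<E>. ?ok \<E> \<Longrightarrow> card \<E> \<le> card \<D>"
    using ex_has_greatest_nat[of ?ok "{C0}" card "card \<C>"] fin
    by (metis (no_types, lifting) psubset_card_mono)
  have meets: "\<Union>\<D> \<inter> \<Union>(\<C> - \<D>) \<noteq> {}"
  proof
    assume disj: "\<Union>\<D> \<inter> \<Union>(\<C> - \<D>) = {}"
    have "openin K (\<Union>\<D>)" "openin K (\<Union>(\<C> - \<D>))" using \<D> cells by blast+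
    moreover have "topspace K \<subseteq> \<Union>\<D> \<union> \<Union>(\<C> - \<D>)" using cover \<D> by blast
    moreover have "\<Union>\<D> \<noteq> {}" "\<Union>(\<C> - \<D>) \<noteq> {}" using \<D> cells by blast+
    ultimately show False using connected_K disj unfolding connected_space_def by metis
  qed
  then obtain C where C: "C \<in> \<C>" "C \<notin> \<D>" "C \<inter> \<Union>\<D> \<noteq> {}" by blast
  have "connectedin K (\<Union>(insert C \<D>))"
    using connectedin_Un[of K C "\<Union>\<D>"] C cells \<D> by simp
  moreover have "card (insert C \<D>) > card \<D>"
    using C \<D> fin by (metis card_insert_disjoint finite_subset lessI psubset_imp_subset)
  ultimately have "\<not> insert C \<D> \<subset> \<C>" using max[of "insert C \<D>"] \<D> by (meson insertCI not_less)
  then have ins: "insert C \<D> = \<C>" using C \<D> by blast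
  have conn: "connectedin K (C \<inter> \<Union>\<D>)"
  proof (rule open_unicoherence)
    show "C \<union> \<Union>\<D> = topspace K" using cover ins by auto
    show "openin K (\<Union>\<D>)" using \<D> cells by blast
  qed (use C cells \<D> in auto)
  obtain D where D: "D \<in> \<D>" "C \<inter> D \<noteq> {}" using C by blast
  show ?thesis
  proof
    show "C \<in> \<C>" "C \<noteq> C0" "D \<in> \<C>" "D \<noteq> C" "C \<inter> D \<noteq> {}" using C D \<D> by auto
    show "\<forall>E\<in>\<C> - {C, D}. C \<inter> E = {}"
    proof (rule ballI, rule ccontr)
      fix E assume E: "E \<in> \<C> - {C, D}" and ne: "C \<inter> E \<noteq> {}"
      let ?R = "\<Union>(\<D> - {D})"
      have "openin K D" "openin K ?R" using D \<D> cells by blast+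
      moreover have "C \<inter> \<Union>\<D> \<subseteq> D \<union> ?R" by blast
      moreover have "D \<inter> ?R \<inter> (C \<inter> \<Union>\<D>) = {}"
        using triple[of C D] C D ins by blast
      moreover have "D \<inter> (C \<inter> \<Union>\<D>) \<noteq> {}" "?R \<inter> (C \<inter> \<Union>\<D>) \<noteq> {}" using D E ne ins by auto
      ultimately show False using conn unfolding connectedin by blast
    qed
  qed
qed

end

section \<open>Contracting maps into a union of extensor pieces\<close>

context compact_parameter begin

abbreviation IK :: "(real \<times> 'k) topology" where
  "IK \<equiv> prod_topology (top_of_set {0..1}) K"

lemma continuous_map_IK_snd: "continuous_map K X f \<Longrightarrow> continuous_map IK X (\<lambda>p. f (snd p))"
  using continuous_map_compose[OF continuous_map_snd, of K X f "top_of_set {0..1}"] by (simp add: o_def)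

lemma continuous_map_IK_fst: "continuous_map IK euclidean fst"
  using continuous_map_fst[of "top_of_set {0..1::real}" K] by (simp add: continuous_map_in_subtopology)

end

context logarithmic_pair begin

lemma homotopic_rel_A_I:
  assumes "continuous_map IK X H"
    and "\<And>x. x \<in> topspace K \<Longrightarrow> H (0,x) = f x" "\<And>x. x \<in> topspace K \<Longrightarrow> H (1,x) = g x"
    and "\<And>t x. \<lbrakk>t \<in> {0..1}; x \<in> A\<rbrakk> \<Longrightarrow> H (t,x) = x0"
  shows "homotopic_with (\<lambda>h. \<forall>t\<in>A. h t = x0) K X f g"
proof -
  have P: "(\<forall>t\<in>A. h t = x0) = (\<forall>t\<in>A. k t = x0)" if "\<And>x. x \<in> topspace K \<Longrightarrow> h x = k x" for h k
    using that A_subset by (metis subsetD)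
  show ?thesis
  proof (subst homotopic_with)
    show "\<exists>h. continuous_map IK X h \<and> (\<forall>x\<in>topspace K. h (0, x) = f x) \<and>
        (\<forall>x\<in>topspace K. h (1, x) = g x) \<and> (\<forall>t\<in>{0..1}. \<forall>ta\<in>A. h (t, ta) = x0)"
      by (intro exI[of _ H]) (use assms in auto)
  qed (rule P)
qed

lemma homotopic_rel_A_E:
  assumes "homotopic_with (\<lambda>h. \<forall>t\<in>A. h t = x0) K X f g"
  obtains H where "continuous_map IK X H" "\<forall>x. H (0,x) = f x" "\<forall>x. H (1,x) = g x"
    "\<forall>t\<in>{0..1}. \<forall>x\<in>A. H (t,x) = x0"
  using assms unfolding homotopic_with_def
proof (elim exE conjE)
  fix H assume "continuous_map IK X H" "\<forall>x. H (0, x) = f x" "\<forall>x. H (1, x) = g x"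
    "\<forall>t\<in>{0..1}. \<forall>ta\<in>A. H (t, ta) = x0"
  then show thesis by (rule that)
qed

text \<open>Here \<open>C\<close> is a leaf, \<open>V\<close> the union of the other cells and \<open>I\<close> the intersection of the pieces belonging to \<open>C\<close> and its
neighbour. Extending \<open>f\<close> from the rim of a core of \<open>C\<close> to a map into \<open>I\<close> gives the new values in the core, and
the extension property of \<open>U\<close> gives the homotopy. Nothing moves on \<open>A\<close>.\<close>
lemma push_off_leaf:
  assumes f: "continuous_map K X f" and fA: "\<And>t. t \<in> A \<Longrightarrow> f t = x0"
    and C: "openin K C" and V: "openin K V" "C \<union> V = topspace K" "A \<subseteq> V"
    and fC: "f ` C \<subseteq> U" and fCV: "f ` (C \<inter> V) \<subseteq> I" and IU: "I \<subseteq> U" "U \<subseteq> topspace X"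
    and AE_I: "absolute_extensor_for K (subtopology X I)"
    and AE_U: "absolute_extensor_for IK (subtopology X U)"
  obtains f' where "continuous_map K X f'" "homotopic_with (\<lambda>h. \<forall>t\<in>A. h t = x0) K X f f'"
    "f' ` C \<subseteq> I" "\<And>x. x \<in> topspace K - C \<Longrightarrow> f' x = f x"
proof -
  have closed: "closedin K ((topspace K - C) \<union> A)" "closedin K (topspace K - V)"
    using C V closed_A by auto
  have dj: "disjnt ((topspace K - C) \<union> A) (topspace K - V)" using V by (auto simp: disjnt_def)
  obtain \<phi> where \<phi>: "continuous_map K euclideanreal \<phi>" "\<phi> ` ((topspace K - C) \<union> A) \<subseteq> {0}"
      "\<phi> ` (topspace K - V) \<subseteq> {1}"
    by (rule Urysohn_lemma_alt[OF normal_K closed dj])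
  have \<phi>0: "\<phi> x = 0" if "x \<in> topspace K" "x \<notin> C \<or> x \<in> A" for x using that \<phi>(2) by blast
  have \<phi>1: "\<phi> x = 1" if "x \<in> topspace K" "x \<notin> V" for x using that \<phi>(3) by blast
  have Csub: "C \<subseteq> topspace K" using C openin_subset by blast
  \<comment> \<open>The core \<open>Z\<close> of \<open>C\<close> is where \<open>f\<close> is replaced; it contains all points outside \<open>V\<close>. Its rim \<open>Zb\<close> is mapped into \<open>I\<close> by \<open>f\<close> already.\<close>
  define Zb where "Zb = {x \<in> topspace K. \<phi> x = 1/2}"
  define Z where "Z = {x \<in> topspace K. \<phi> x \<ge> 1/2}"
  define Z' where "Z' = {x \<in> topspace K. \<phi> x \<le> 1/2}"
  have cl: "closedin K Zb" "closedin K Z" "closedin K Z'"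
    using closedin_continuous_map_preimage[OF \<phi>(1), of "{1/2}"]
      closedin_continuous_map_preimage[OF \<phi>(1), of "{1/2..}"]
      closedin_continuous_map_preimage[OF \<phi>(1), of "{..1/2}"]
    by (simp_all add: Zb_def Z_def Z'_def)
  have ZC: "Z \<subseteq> C" using \<phi>0 by (force simp: Z_def)
  have Z'V: "x \<in> V" if "x \<in> Z'" for x using \<phi>1[of x] that by (force simp: Z'_def)
  have ZbCV: "Zb \<subseteq> C \<inter> V" using ZC Z'V by (force simp: Zb_def Z_def Z'_def)
  have "continuous_map (subtopology K Zb) (subtopology X I) f"
    using f fCV ZbCV by (auto simp: continuous_map_in_subtopology continuous_map_from_subtopology)
  then obtain e where e: "continuous_map K (subtopology X I) e" "\<forall>x\<in>Zb. e x = f x"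
    by (rule absolute_extensorE[OF AE_I cl(1)])
  have eI: "e x \<in> I" if "x \<in> topspace K" for x
    using e(1) that by (auto simp: continuous_map_in_subtopology)
  define f' where "f' = (\<lambda>x. if x \<in> Z' then f x else e x)"
  have f': "continuous_map K X f'"
    unfolding f'_def
  proof (rule continuous_map_paste_closed[OF cl(3) cl(2)])
    show "continuous_map (subtopology K Z) X e"
      using e(1) by (simp add: continuous_map_in_subtopology continuous_map_from_subtopology)
    show "f x = e x" if "x \<in> Z'" "x \<in> Z" for x
      using that e(2) by (auto simp: Zb_def Z_def Z'_def)
  qed (use f in \<open>auto simp: Z_def Z'_def continuous_map_from_subtopology\<close>)
  have f'C: "f' x \<in> I" if "x \<in> C" for x
    using that eI[of x] Csub Z'V[of x] fCV by (auto simp: f'_def)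
  have f'nC: "f' x = f x" if "x \<in> topspace K - C" for x
    using that \<phi>0[of x] by (auto simp: f'_def Z'_def)
  let ?I = "top_of_set {0..1::real}"
  \<comment> \<open>On \<open>Z\<close> the homotopy from \<open>f\<close> to \<open>f\'\<close> is prescribed at both ends and, constantly in time, over \<open>Zb\<close>.\<close>
  define S0 where "S0 = {0::real} \<times> Z"
  define S1 where "S1 = {1::real} \<times> Z \<union> {0..1} \<times> Zb"
  have closed0: "closedin ?I {0}" "closedin ?I {1}" "closedin ?I {0..1}"
    by (auto intro!: closed_subset)
  have S: "closedin IK S0" "closedin IK S1"
    unfolding S0_def S1_def using cl closed0 by (auto simp: closedin_prod_Times_iff intro!: closedin_Un)
  have "continuous_map (subtopology IK (S0 \<union> S1)) (subtopology X U)
          (\<lambda>p. if p \<in> S0 then f (snd p) else f' (snd p))"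
  proof (rule continuous_map_paste_closed[where T=S1])
    show "closedin (subtopology IK (S0 \<union> S1)) S0" "closedin (subtopology IK (S0 \<union> S1)) S1"
      using S by (auto intro: closedin_subset_topspace)
    show "S0 \<union> S1 = topspace (subtopology IK (S0 \<union> S1))"
      using closedin_subset[OF S(1)] closedin_subset[OF S(2)] by auto
    have sn: "snd ` S0 \<subseteq> C" "snd ` S1 \<subseteq> C" using ZC by (auto simp: S0_def S1_def Z_def Zb_def)
    show "continuous_map (subtopology (subtopology IK (S0 \<union> S1)) S0) (subtopology X U) (\<lambda>p. f (snd p))"
      using sn(1) fC by (auto simp: continuous_map_in_subtopology
          intro!: continuous_map_from_subtopology continuous_map_IK_snd f)
    show "continuous_map (subtopology (subtopology IK (S0 \<union> S1)) S1) (subtopology X U) (\<lambda>p. f' (snd p))"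
      using sn(2) f'C IU by (auto simp: continuous_map_in_subtopology
          intro!: continuous_map_from_subtopology continuous_map_IK_snd f')
    show "f (snd x) = f' (snd x)" if "x \<in> S0" "x \<in> S1" for x
      using that by (auto simp: S0_def S1_def Zb_def f'_def Z'_def)
  qed
  note cont01 = this
  have closed01: "closedin IK (S0 \<union> S1)" using S by (rule closedin_Un)
  obtain M where M: "continuous_map IK (subtopology X U) M"
     "\<forall>p\<in>S0 \<union> S1. M p = (if p \<in> S0 then f (snd p) else f' (snd p))"
    by (rule absolute_extensorE[OF AE_U closed01 cont01])
  define T where "T = {0..1::real} \<times> Z'"
  define H where "H = (\<lambda>p. if p \<in> T then f (snd p) else M p)"
  have H: "continuous_map IK X H"
    unfolding H_def
  proof (rule continuous_map_paste_closed[where T="{0..1} \<times> Z"])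
    show "closedin IK T" "closedin IK ({0..1} \<times> Z)" unfolding T_def
      using cl closed0 by (auto simp: closedin_prod_Times_iff)
    show "T \<union> {0..1} \<times> Z = topspace IK" by (auto simp: T_def Z_def Z'_def)
    show "continuous_map (subtopology IK ({0..1} \<times> Z)) X M"
      using M(1) by (simp add: continuous_map_in_subtopology continuous_map_from_subtopology)
    show "f (snd p) = M p" if "p \<in> T" "p \<in> {0..1} \<times> Z" for p
    proof -
      have "snd p \<in> Zb" "p \<in> S1" using that by (auto simp: T_def S1_def Z_def Z'_def Zb_def)
      then show ?thesis using M(2) by (force simp: f'_def Z'_def Zb_def S0_def)
    qed
  qed (use f in \<open>auto intro: continuous_map_from_subtopology continuous_map_IK_snd\<close>)
  have hom: "homotopic_with (\<lambda>h. \<forall>t\<in>A. h t = x0) K X f f'"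
  proof (rule homotopic_rel_A_I[OF H])
    fix x assume x: "x \<in> topspace K"
    then have xz: "x \<in> Z" if "x \<notin> Z'" using that by (auto simp: Z_def Z'_def)
    show "H (0,x) = f x" using xz M(2) by (auto simp: H_def T_def S0_def)
    show "H (1,x) = f' x" using xz M(2) by (auto simp: H_def T_def S0_def S1_def f'_def)
  next
    fix t::real and x assume "t \<in> {0..1}" "x \<in> A"
    then show "H (t,x) = x0" using \<phi>0[of x] A_subset fA by (auto simp: H_def T_def Z'_def)
  qed
  have "f' ` C \<subseteq> I" using f'C by blast
  from that[OF f' hom this f'nC] show ?thesis .
qed

lemma nullhomotopic_into_extensor:
  assumes f: "continuous_map K X f" and fA: "\<And>t. t \<in> A \<Longrightarrow> f t = x0"
    and fU: "f ` topspace K \<subseteq> U" and AE_U: "absolute_extensor_for IK (subtopology X U)"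
  shows "homotopic_with (\<lambda>h. \<forall>t\<in>A. h t = x0) K X f (\<lambda>_. x0)"
proof -
  let ?I = "top_of_set {0..1::real}"
  define S0 where "S0 = {0::real} \<times> topspace K"
  define S1 where "S1 = {1::real} \<times> topspace K \<union> {0..1} \<times> A"
  have x0: "x0 \<in> U" "x0 \<in> topspace X"
    using nonempty_A fA fU A_subset continuous_map_image_subset_topspace[OF f] by blast+
  have closed0: "closedin ?I {0}" "closedin ?I {1}" "closedin ?I {0..1}"
    by (auto intro!: closed_subset)
  have S: "closedin IK S0" "closedin IK S1"
    unfolding S0_def S1_def using closed_A closed0 by (auto simp: closedin_prod_Times_iff intro!: closedin_Un)
  have "continuous_map (subtopology IK (S0 \<union> S1)) (subtopology X U)
          (\<lambda>p. if p \<in> S0 then f (snd p) else x0)"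
  proof (rule continuous_map_paste_closed[where T=S1])
    show "closedin (subtopology IK (S0 \<union> S1)) S0" "closedin (subtopology IK (S0 \<union> S1)) S1"
      using S by (auto intro: closedin_subset_topspace)
    show "S0 \<union> S1 = topspace (subtopology IK (S0 \<union> S1))"
      using closedin_subset[OF S(1)] closedin_subset[OF S(2)] by auto
    show "continuous_map (subtopology (subtopology IK (S0 \<union> S1)) S0) (subtopology X U) (\<lambda>p. f (snd p))"
      using fU by (auto simp: continuous_map_in_subtopology S0_def
          intro!: continuous_map_from_subtopology continuous_map_IK_snd f)
    show "f (snd x) = x0" if "x \<in> S0" "x \<in> S1" for x
      using that fA by (auto simp: S0_def S1_def)
  qed (use x0 in simp)
  note cont01 = this
  have closed01: "closedin IK (S0 \<union> S1)" using S by (rule closedin_Un)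
  obtain M where M: "continuous_map IK (subtopology X U) M"
     "\<forall>p\<in>S0 \<union> S1. M p = (if p \<in> S0 then f (snd p) else x0)"
    by (rule absolute_extensorE[OF AE_U closed01 cont01])
  have "continuous_map IK X M" using M(1) by (simp add: continuous_map_in_subtopology)
  then show ?thesis
  proof (rule homotopic_rel_A_I)
    show "M (0,x) = f x" "M (1,x) = x0" if "x \<in> topspace K" for x
      using that M(2) by (auto simp: S0_def S1_def)
    show "M (t,x) = x0" if "t \<in> {0..1}" "x \<in> A" for t x
      using that M(2) fA by (auto simp: S0_def S1_def)
  qed
qed

text \<open>Induction on the number of cells. After a leaf \<open>C\<close> has been pushed into the piece of its neighbour \<open>D\<close>,
the union \<open>C \<union> D\<close> is one cell. Distinct cells that meet belong to different pieces, so the absence of triple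
intersections passes from the pieces to the cells.\<close>
lemma nullhomotopic_of_cells:
  assumes sub: "\<And>U. U \<in> \<U> \<Longrightarrow> U \<subseteq> topspace X"
    and AE: "\<And>U. U \<in> \<U> \<Longrightarrow> absolute_extensor_for IK (subtopology X U)"
    and AE2: "\<And>U V. \<lbrakk>U \<in> \<U>; V \<in> \<U>; U \<noteq> V; U \<inter> V \<noteq> {}\<rbrakk> \<Longrightarrow> absolute_extensor_for K (subtopology X (U \<inter> V))"
    and triple: "\<And>U V W. \<lbrakk>U \<in> \<U>; V \<in> \<U>; W \<in> \<U>; U \<noteq> V; U \<noteq> W; V \<noteq> W\<rbrakk> \<Longrightarrow> U \<inter> V \<inter> W = {}"
    and "finite \<C>" "\<And>C. C \<in> \<C> \<Longrightarrow> openin K C \<and> connectedin K C \<and> C \<noteq> {} \<and> u C \<in> \<U> \<and> f ` C \<subseteq> u C"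
    and "\<Union>\<C> = topspace K" "C0 \<in> \<C>" "A \<subseteq> C0"
    and "\<And>C D. \<lbrakk>C \<in> \<C>; D \<in> \<C>; C \<noteq> D; C \<inter> D \<noteq> {}\<rbrakk> \<Longrightarrow> u C \<noteq> u D"
    and "continuous_map K X f" "\<And>t. t \<in> A \<Longrightarrow> f t = x0"
  shows "homotopic_with (\<lambda>h. \<forall>t\<in>A. h t = x0) K X f (\<lambda>_. x0)"
  using assms(5-)
proof (induction "card \<C>" arbitrary: \<C> u f C0 rule: less_induct)
  case less
  note fin = less.prems(1) and cells = less.prems(2) and cover = less.prems(3) and C0 = less.prems(4,5)
    and dist = less.prems(6) and f = less.prems(7,8)
  show ?case
  proof (cases "\<C> = {C0}")
    case True
    then have "f ` topspace K \<subseteq> u C0" "u C0 \<in> \<U>" using cells cover by auto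
    then show ?thesis using nullhomotopic_into_extensor[OF f _ AE] by blast
  next
    case False
    have no3: "C \<inter> D \<inter> E = {}" if "C \<in> \<C>" "D \<in> \<C>" "E \<in> \<C>" "C \<noteq> D" "C \<noteq> E" "D \<noteq> E" for C D E
    proof (rule ccontr)
      assume "C \<inter> D \<inter> E \<noteq> {}"
      then obtain x where x: "x \<in> C" "x \<in> D" "x \<in> E" by blast
      then have "u C \<noteq> u D" "u C \<noteq> u E" "u D \<noteq> u E" using dist that by blast+
      moreover have "f x \<in> u C \<inter> u D \<inter> u E" "u C \<in> \<U>" "u D \<in> \<U>" "u E \<in> \<U>" using cells that x by blast+
      ultimately show False using triple by blast
    qed
    have "openin K C \<and> connectedin K C \<and> C \<noteq> {}" if "C \<in> \<C>" for C using cells that by blast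
    then obtain C D where CD: "C \<in> \<C>" "C \<noteq> C0" "D \<in> \<C>" "D \<noteq> C" "C \<inter> D \<noteq> {}"
        and leaf': "\<forall>E\<in>\<C> - {C, D}. C \<inter> E = {}"
      by (rule leaf_exists[OF fin _ cover C0(1) False no3])
    have leaf: "C \<inter> E = {}" if "E \<in> \<C>" "E \<noteq> C" "E \<noteq> D" for E using leaf' that by blast
    define V where "V = \<Union>(\<C> - {C})"
    have V: "openin K V" "C \<union> V = topspace K" "A \<subseteq> V" "C \<inter> V \<subseteq> C \<inter> D"
    proof -
      show "openin K V" unfolding V_def using cells by (intro openin_Union) simp
      show "C \<union> V = topspace K" unfolding V_def cover[symmetric] using CD(1) by auto
      show "A \<subseteq> V" unfolding V_def using C0 CD(2) by auto
      show "C \<inter> V \<subseteq> C \<inter> D"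
      proof
        fix x assume "x \<in> C \<inter> V"
        then obtain E where "E \<in> \<C>" "E \<noteq> C" "x \<in> E" "x \<in> C" unfolding V_def by auto
        then show "x \<in> C \<inter> D" using leaf[of E] by (cases "E = D") auto
      qed
    qed
    have uu: "u C \<in> \<U>" "u D \<in> \<U>" "openin K C" "openin K D" "f ` C \<subseteq> u C" "f ` D \<subseteq> u D"
      "connectedin K C" "connectedin K D"
      using cells[OF CD(1)] cells[OF CD(3)] by simp_all
    have uCD: "u C \<noteq> u D" using dist[of C D] CD by simp
    have neI: "u C \<inter> u D \<noteq> {}"
    proof -
      obtain x where "x \<in> C" "x \<in> D" using CD(5) by auto
      then have "f x \<in> u C \<inter> u D" using uu(5,6) by auto
      then show ?thesis by auto
    qed
    obtain f' where f': "continuous_map K X f'" "homotopic_with (\<lambda>h. \<forall>t\<in>A. h t = x0) K X f f'"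
        "f' ` C \<subseteq> u C \<inter> u D" "\<And>x. x \<in> topspace K - C \<Longrightarrow> f' x = f x"
    proof (rule push_off_leaf[OF f(1) f(2) uu(3) V(1,2,3) uu(5)])
      show "f ` (C \<inter> V) \<subseteq> u C \<inter> u D"
      proof
        fix y assume "y \<in> f ` (C \<inter> V)"
        then obtain x where "y = f x" "x \<in> C" "x \<in> D" using V(4) by auto
        then show "y \<in> u C \<inter> u D" using uu(5,6) by auto
      qed
      show "u C \<subseteq> topspace X" by (rule sub[OF uu(1)])
      show "absolute_extensor_for K (subtopology X (u C \<inter> u D))" by (rule AE2[OF uu(1,2) uCD neI])
      show "absolute_extensor_for IK (subtopology X (u C))" by (rule AE[OF uu(1)])
    qed auto
    define \<C>' where "\<C>' = insert (C \<union> D) (\<C> - {C, D})"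
    define u' where "u' = u(C \<union> D := u D)"
    have new: "C \<union> D \<notin> \<C> - {C, D}" using leaf[of "C \<union> D"] CD by auto
    have u': "u' E = u E" if "E \<in> \<C> - {C,D}" for E using new that by (auto simp: u'_def)
    have f'D: "f' ` D \<subseteq> u D"
    proof clarify
      fix x assume "x \<in> D"
      then have "x \<in> topspace K" using openin_subset[OF uu(4)] by blast
      then show "f' x \<in> u D" using f'(3,4) uu(6) \<open>x \<in> D\<close> by (cases "x \<in> C") auto
    qed
    have f'E: "f' ` E \<subseteq> u E" if "E \<in> \<C> - {C,D}" for E
    proof clarify
      fix x assume "x \<in> E"
      then have "x \<in> topspace K - C" using leaf[of E] that cover by auto
      then show "f' x \<in> u E" using f'(4) cells that \<open>x \<in> E\<close> by force
    qed
    have "homotopic_with (\<lambda>h. \<forall>t\<in>A. h t = x0) K X f' (\<lambda>_. x0)"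
    proof (rule less.hyps[of \<C>' u' f' "if C0 = D then C \<union> D else C0"])
      have "card \<C>' = Suc (card (\<C> - {C,D}))" using new fin by (simp add: \<C>'_def)
      also have "card (\<C> - {C,D}) = card \<C> - 2" using CD fin by (simp add: card_Diff_subset)
      also have "card \<C> \<ge> 2" using CD fin by (metis card_2_iff card_mono empty_subsetI insert_subset)
      ultimately show "card \<C>' < card \<C>" using \<open>card \<C> \<ge> 2\<close> by linarith
      show "finite \<C>'" using fin by (simp add: \<C>'_def)
      show "\<Union>\<C>' = topspace K" using cover CD by (auto simp: \<C>'_def)
      show "(if C0 = D then C \<union> D else C0) \<in> \<C>'" using C0 CD by (auto simp: \<C>'_def)
      show "A \<subseteq> (if C0 = D then C \<union> D else C0)" using C0 by auto
      show "continuous_map K X f'" by fact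
      show "f' t = x0" if "t \<in> A" for t
        using homotopic_with_imp_property[OF f'(2)] that by blast
      show "openin K E \<and> connectedin K E \<and> E \<noteq> {} \<and> u' E \<in> \<U> \<and> f' ` E \<subseteq> u' E" if "E \<in> \<C>'" for E
      proof (cases "E = C \<union> D")
        case True
        have "f' ` (C \<union> D) \<subseteq> u D" using f'(3) f'D by blast
        with True show ?thesis using uu CD connectedin_Un[of K C D] by (auto simp: u'_def)
      next
        case False
        then have E: "E \<in> \<C> - {C,D}" using that by (auto simp: \<C>'_def)
        show ?thesis using cells[of E] E f'E[OF E] u'[OF E] by auto
      qed
      have key: "u D \<noteq> u E" if "E \<in> \<C> - {C,D}" "(C \<union> D) \<inter> E \<noteq> {}" for E
        using leaf[of E] that dist[of D E] CD by blast
      have u'CD: "u' (C \<union> D) = u D" by (simp add: u'_def)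
      show "u' E \<noteq> u' F" if "E \<in> \<C>'" "F \<in> \<C>'" "E \<noteq> F" "E \<inter> F \<noteq> {}" for E F
      proof -
        consider "E = C \<union> D" "F \<in> \<C> - {C,D}" | "F = C \<union> D" "E \<in> \<C> - {C,D}"
          | "E \<in> \<C> - {C,D}" "F \<in> \<C> - {C,D}" using \<open>E \<in> \<C>'\<close> \<open>F \<in> \<C>'\<close> \<open>E \<noteq> F\<close> by (auto simp: \<C>'_def)
        then show ?thesis
        proof cases
          case 1 then show ?thesis using key[of F] u'CD u'[of F] that(4) by auto
        next
          case 2 then show ?thesis using key[of E] u'CD u'[of E] that(4) by (metis Int_commute)
        next
          case 3 then show ?thesis using dist[of E F] u'[of E] u'[of F] that(3,4) by auto
        qed
      qed
    qed
    then show ?thesis using f'(2) homotopic_with_trans by blast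
  qed
qed

text \<open>The cells are the connected components of the preimages of the pieces: open by local connectedness, and
finitely many of them suffice by compactness. Two components that meet come from
different pieces.\<close>
theorem rel_aspherical_of_pieces:
  assumes op: "\<And>U. U \<in> \<U> \<Longrightarrow> openin X U" and cov: "\<Union>\<U> = topspace X"
    and AE: "\<And>U. U \<in> \<U> \<Longrightarrow> absolute_extensor_for IK (subtopology X U)"
    and AE2: "\<And>U V. \<lbrakk>U \<in> \<U>; V \<in> \<U>; U \<noteq> V; U \<inter> V \<noteq> {}\<rbrakk> \<Longrightarrow> absolute_extensor_for K (subtopology X (U \<inter> V))"
    and triple: "\<And>U V W. \<lbrakk>U \<in> \<U>; V \<in> \<U>; W \<in> \<U>; U \<noteq> V; U \<noteq> W; V \<noteq> W\<rbrakk> \<Longrightarrow> U \<inter> V \<inter> W = {}"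
  shows "rel_aspherical K A X"
  unfolding rel_aspherical_def
proof (intro allI impI, elim conjE)
  fix f x0 assume f: "continuous_map K X f" and fA: "\<forall>t\<in>A. f t = x0"
  define pre where "pre U = {x \<in> topspace K. f x \<in> U}" for U
  have pre: "openin K (pre U)" if "U \<in> \<U>" for U
    unfolding pre_def using openin_continuous_map_preimage[OF f op[OF that]] .
  define \<A> where "\<A> = {C. \<exists>U\<in>\<U>. C \<in> connected_components_of (subtopology K (pre U))}"
  define u where "u C = (SOME U. U \<in> \<U> \<and> C \<in> connected_components_of (subtopology K (pre U)))" for C
  have u: "u C \<in> \<U>" "C \<in> connected_components_of (subtopology K (pre (u C)))" if "C \<in> \<A>" for C
    using someI_ex[of "\<lambda>U. U \<in> \<U> \<and> C \<in> connected_components_of (subtopology K (pre U))"] that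
    by (auto simp: \<A>_def u_def)
  have sub: "C \<subseteq> pre (u C)" if "C \<in> \<A>" for C
    using connected_components_of_subset[OF u(2)[OF that]] by simp
  have cell: "openin K C" "connectedin K C" "C \<noteq> {}" "u C \<in> \<U>" "f ` C \<subseteq> u C" if "C \<in> \<A>" for C
  proof -
    show "openin K C"
      using locally_connected_K u[OF that] pre locally_connected_space_open_connected_components by blast
    show "connectedin K C"
      using connectedin_connected_components_of[OF u(2)[OF that]] by (simp add: connectedin_subtopology)
    show "C \<noteq> {}" using nonempty_connected_components_of[OF u(2)[OF that]] .
    show "u C \<in> \<U>" using u that by blast
    show "f ` C \<subseteq> u C" using sub[OF that] by (auto simp: pre_def)
  qed
  have dist: "u C \<noteq> u D" if "C \<in> \<A>" "D \<in> \<A>" "C \<noteq> D" "C \<inter> D \<noteq> {}" for C D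
    using u[OF that(1)] u[OF that(2)] that(3,4) connected_components_of_overlap by metis
  have covA: "\<Union>\<A> = topspace K"
  proof
    show "\<Union>\<A> \<subseteq> topspace K" using cell openin_subset by blast
    show "topspace K \<subseteq> \<Union>\<A>"
    proof
      fix x assume x: "x \<in> topspace K"
      then have "f x \<in> topspace X" using f continuous_map_image_subset_topspace by blast
      then obtain U where U: "U \<in> \<U>" "f x \<in> U" using cov by blast
      then have "x \<in> topspace (subtopology K (pre U))" using x by (simp add: pre_def)
      then show "x \<in> \<Union>\<A>" using U Union_connected_components_of[of "subtopology K (pre U)"]
        unfolding \<A>_def by blast
    qed
  qed
  obtain C0 where C0: "C0 \<in> \<A>" "A \<subseteq> C0"
  proof -
    obtain a where a: "a \<in> A" using nonempty_A by blast
    then have "f a \<in> topspace X" using A_subset f continuous_map_image_subset_topspace by blast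
    then have "x0 \<in> \<Union>\<U>" using cov fA a by simp
    then obtain U where U: "U \<in> \<U>" "x0 \<in> U" by (rule UnionE)
    then have "A \<subseteq> pre U" using A_subset fA by (auto simp: pre_def)
    then have "connectedin (subtopology K (pre U)) A" using connected_A by (simp add: connectedin_subtopology)
    moreover have "a \<in> topspace (subtopology K (pre U))" using a \<open>A \<subseteq> pre U\<close> A_subset by auto
    ultimately have "A \<subseteq> connected_component_of_set (subtopology K (pre U)) a"
      using a by (simp add: connected_component_of_maximal)
    moreover have "connected_component_of_set (subtopology K (pre U)) a \<in> connected_components_of (subtopology K (pre U))"
      using connected_component_in_connected_components_of \<open>a \<in> topspace _\<close> by metis
    moreover have "connected_component_of_set (subtopology K (pre U)) a \<in> \<A>"
      using calculation(2) U(1) unfolding \<A>_def by (intro CollectI bexI)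
    ultimately show ?thesis using that by metis
  qed
  obtain \<F> where \<F>: "finite \<F>" "\<F> \<subseteq> \<A>" "topspace K \<subseteq> \<Union>\<F>"
    using compact_K covA cell(1) unfolding compact_space_def compactin_def by (metis subset_refl)
  show "homotopic_with (\<lambda>h. \<forall>t\<in>A. h t = x0) K X f (\<lambda>_. x0)"
  proof (rule nullhomotopic_of_cells[where \<U>=\<U> and X=X and \<C>="insert C0 \<F>" and u=u and ?C0.0=C0])
    show "\<Union>(insert C0 \<F>) = topspace K" using \<F> C0 covA by blast
    show "openin K C \<and> connectedin K C \<and> C \<noteq> {} \<and> u C \<in> \<U> \<and> f ` C \<subseteq> u C" if "C \<in> insert C0 \<F>" for C
    proof -
      have "C \<in> \<A>" using that \<F> C0 by blast
      with cell[OF this] show ?thesis by blast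
    qed
    show "u C \<noteq> u D" if "C \<in> insert C0 \<F>" "D \<in> insert C0 \<F>" "C \<noteq> D" "C \<inter> D \<noteq> {}" for C D
      using dist that \<F> C0 by blast
    show "U \<subseteq> topspace X" if "U \<in> \<U>" for U using op openin_subset that by blast
  qed (use f fA \<F> C0 in \<open>simp_all add: AE AE2 triple\<close>)
qed

end

section \<open>Planar sets as absolute extensors\<close>

text \<open>By Tietze the two coordinates extend to some map \<open>e\<close> into the plane. A Urysohn function \<open>l\<close> that is \<open>1\<close> on the given closed set and
\<open>0\<close> where \<open>e\<close> leaves \<open>D\<close> then pulls \<open>e\<close> towards the star centre \<open>a\<close>.\<close>
lemma absolute_extensor_for_starlike:
  fixes D :: "complex set"
  assumes N: "normal_space N" and D: "open D" "a \<in> D" "\<And>z. z \<in> D \<Longrightarrow> closed_segment a z \<subseteq> D"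
  shows "absolute_extensor_for N (top_of_set D)"
  unfolding absolute_extensor_for_def
proof (intro allI impI, elim conjE)
  fix C g assume C: "closedin N C" and g: "continuous_map (subtopology N C) (top_of_set D) g"
  have gD: "g x \<in> D" if "x \<in> C" for x
    using g that closedin_subset[OF C] by (auto simp: continuous_map_in_subtopology)
  have g': "continuous_map (subtopology N C) euclidean g"
    using g by (simp add: continuous_map_in_subtopology)
  have Re: "continuous_map (subtopology N C) euclideanreal (\<lambda>x. Re (g x))"
    by (rule continuous_map_compose_on[OF g', where S=UNIV]) (auto intro!: continuous_intros)
  have Im: "continuous_map (subtopology N C) euclideanreal (\<lambda>x. Im (g x))"
    by (rule continuous_map_compose_on[OF g', where S=UNIV]) (auto intro!: continuous_intros)
  obtain r where r: "continuous_map N euclideanreal r" "r ` topspace N \<subseteq> UNIV" "\<And>x. x \<in> C \<Longrightarrow> r x = Re (g x)"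
    by (rule Tietze_extension_realinterval[OF N C _ _ Re, of UNIV]) auto
  obtain s where s: "continuous_map N euclideanreal s" "s ` topspace N \<subseteq> UNIV" "\<And>x. x \<in> C \<Longrightarrow> s x = Im (g x)"
    by (rule Tietze_extension_realinterval[OF N C _ _ Im, of UNIV]) auto
  define e where "e = (\<lambda>x. Complex (r x) (s x))"
  have e: "continuous_map N euclidean e"
    unfolding e_def by (rule continuous_map_compose_on2[OF r(1) s(1), where S=UNIV])
      (auto simp: Complex_eq intro!: continuous_intros)
  have eg: "e x = g x" if "x \<in> C" for x using r(3) s(3) that by (simp add: e_def)
  have cl: "closedin N {x \<in> topspace N. e x \<in> - D}"
    by (rule closedin_continuous_map_preimage[OF e]) (use D in auto)
  have dj: "disjnt {x \<in> topspace N. e x \<in> - D} C" using eg gD by (auto simp: disjnt_def)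
  obtain l where l: "continuous_map N (top_of_set {0..1::real}) l" "l ` {x \<in> topspace N. e x \<in> - D} \<subseteq> {0}" "l ` C \<subseteq> {1}"
    by (rule Urysohn_lemma[OF N cl C dj, of 0 1]) auto
  have l': "continuous_map N euclideanreal l" "\<And>x. x \<in> topspace N \<Longrightarrow> l x \<in> {0..1}"
    using l(1) by (auto simp: continuous_map_in_subtopology)
  define k where "k = (\<lambda>x. a + of_real (l x) * (e x - a))"
  have "continuous_map N euclidean k"
    unfolding k_def by (rule continuous_map_compose_on2[OF l'(1) e, where S=UNIV]) (auto intro!: continuous_intros)
  moreover have "k x \<in> D" if "x \<in> topspace N" for x
  proof (cases "e x \<in> D")
    case True
    have "k x \<in> closed_segment a (e x)" using l'(2)[OF that]
      by (auto simp: k_def closed_segment_def scaleR_conv_of_real algebra_simps intro!: exI[of _ "l x"])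
    then show ?thesis using D(3)[OF True] by blast
  next
    case False
    then have "l x = 0" using l(2) that by blast
    then show ?thesis using D by (simp add: k_def)
  qed
  ultimately have "continuous_map N (top_of_set D) k" by (simp add: continuous_map_in_subtopology Pi_iff)
  moreover have "\<forall>x\<in>C. k x = g x" using l(3) eg by (auto simp: k_def)
  ultimately show "\<exists>g'. continuous_map N (top_of_set D) g' \<and> (\<forall>x\<in>C. g' x = g x)" by blast
qed

lemma absolute_extensor_for_retract:
  assumes "absolute_extensor_for N Y" "continuous_map X Y p" "continuous_map Y X q"
    "\<And>x. x \<in> topspace X \<Longrightarrow> q (p x) = x"
  shows "absolute_extensor_for N X"
  unfolding absolute_extensor_for_def
proof (intro allI impI, elim conjE)
  fix C g assume C: "closedin N C" and g: "continuous_map (subtopology N C) X g"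
  have "continuous_map (subtopology N C) Y (\<lambda>x. p (g x))"
    using continuous_map_compose[OF g assms(2)] by (simp add: o_def)
  then obtain e where e: "continuous_map N Y e" "\<forall>x\<in>C. e x = p (g x)"
    by (rule absolute_extensorE[OF assms(1) C])
  have "continuous_map N X (\<lambda>x. q (e x))"
    using continuous_map_compose[OF e(1) assms(3)] by (simp add: o_def)
  moreover have "q (e x) = g x" if "x \<in> C" for x
  proof -
    have "g x \<in> topspace X"
      using continuous_map_image_subset_topspace[OF g] closedin_subset[OF C] that by auto
    then show ?thesis using e(2) that assms(4) by simp
  qed
  ultimately show "\<exists>g'. continuous_map N X g' \<and> (\<forall>x\<in>C. g' x = g x)" by blast
qed

lemma (in logarithmic_pair) rel_aspherical_retract:
  assumes Y: "rel_aspherical K A Y" and p: "continuous_map X Y p" and q: "continuous_map Y X q"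
    and qp: "\<And>x. x \<in> topspace X \<Longrightarrow> q (p x) = x"
  shows "rel_aspherical K A X"
  unfolding rel_aspherical_def
proof (intro allI impI, elim conjE)
  fix f x0 assume f: "continuous_map K X f" and fA: "\<forall>t\<in>A. f t = x0"
  have pf: "continuous_map K Y (\<lambda>x. p (f x))"
    using continuous_map_compose[OF f p] by (simp add: o_def)
  have "homotopic_with (\<lambda>h. \<forall>t\<in>A. h t = p x0) K Y (\<lambda>x. p (f x)) (\<lambda>_. p x0)"
    using Y pf fA unfolding rel_aspherical_def by simp
  then obtain H where H: "continuous_map IK Y H" "\<forall>x. H (0,x) = p (f x)" "\<forall>x. H (1,x) = p x0"
    "\<forall>t\<in>{0..1}. \<forall>x\<in>A. H (t,x) = p x0" by (rule homotopic_rel_A_E)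
  have fX: "f x \<in> topspace X" if "x \<in> topspace K" for x
    using continuous_map_image_subset_topspace[OF f] that by blast
  obtain a where "a \<in> A" using nonempty_A by auto
  then have x0: "x0 \<in> topspace X" using fX[of a] fA A_subset by auto
  have "continuous_map IK X (\<lambda>z. q (H z))"
    using continuous_map_compose[OF H(1) q] by (simp add: o_def)
  then show "homotopic_with (\<lambda>h. \<forall>t\<in>A. h t = x0) K X f (\<lambda>_. x0)"
    by (rule homotopic_rel_A_I) (use H fX x0 qp in auto)
qed

lemma (in logarithmic_pair) normal_IK: "normal_space IK"
  by (rule compact_Hausdorff_or_regular_imp_normal_space)
     (auto simp: compact_space_prod_topology Hausdorff_space_prod_topology compact_K Hausdorff_K
        intro!: compact_space_subtopology Hausdorff_space_subtopology)

section \<open>Branched covers of the punctured plane\<close>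

text \<open>The punctured plane with square roots of the functions \<open>F i\<close> adjoined. Coordinates outside \<open>I\<close> are fixed at
\<open>0\<close>, so that for empty \<open>I\<close> this is a copy of the punctured plane.\<close>
definition branched_cover :: "complex set \<Rightarrow> 'i set \<Rightarrow> ('i \<Rightarrow> complex \<Rightarrow> complex) \<Rightarrow> (complex \<times> ('i \<Rightarrow> complex)) set" where
  "branched_cover P I F = {(z, c). z \<notin> P \<and> (\<forall>i\<in>I. (c i)\<^sup>2 = F i z) \<and> (\<forall>i. i \<notin> I \<longrightarrow> c i = 0)}"

text \<open>Each \<open>F i\<close> has a simple zero at \<open>q i\<close> and no other zero off \<open>P\<close>, and all special points lie at
different heights. The behaviour of \<open>F i\<close> at the punctures is arbitrary, and the root may have
monodromy there.\<close>
locale horizontal_cuts =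
  fixes P :: "complex set" and I :: "'i set" and q :: "'i \<Rightarrow> complex" and h F :: "'i \<Rightarrow> complex \<Rightarrow> complex"
  assumes finite_P: "finite P" and finite_I: "finite I"
    and F: "\<And>i z. \<lbrakk>i \<in> I; z \<notin> P\<rbrakk> \<Longrightarrow> F i z = (z - q i) * h i z"
    and h: "\<And>i. i \<in> I \<Longrightarrow> continuous_on (- P) (h i)" "\<And>i z. \<lbrakk>i \<in> I; z \<notin> P\<rbrakk> \<Longrightarrow> h i z \<noteq> 0"
    and qP: "\<And>i. i \<in> I \<Longrightarrow> q i \<notin> P" and inj_q: "inj_on q I" and inj_Im: "inj_on Im (P \<union> q ` I)"
begin

abbreviation E where "E \<equiv> branched_cover P I F"

definition is_section :: "complex set \<Rightarrow> 'i set \<Rightarrow> ('i \<Rightarrow> complex \<Rightarrow> complex) \<Rightarrow> bool" where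
  "is_section W J g \<longleftrightarrow> (\<forall>i\<in>I - J. continuous_on W (g i) \<and> (\<forall>z\<in>W. (g i z)\<^sup>2 = F i z))"

definition piece :: "complex set \<Rightarrow> 'i set \<Rightarrow> ('i \<Rightarrow> complex \<Rightarrow> complex) \<Rightarrow> (complex \<times> ('i \<Rightarrow> complex)) set" where
  "piece W J g = {(z, c) \<in> E. z \<in> W \<and> (\<forall>i\<in>I - J. c i = g i z)}"

text \<open>Over such a set \<open>W\<close> the roots with index outside \<open>J\<close> have continuous branches. The strips and the
half-strips at the punctures have empty \<open>J\<close>, and a neighbourhood of the line through \<open>q i\<close> has
\<open>J = {i}\<close>.\<close>
definition good_base :: "complex set \<Rightarrow> 'i set \<Rightarrow> bool" where
  "good_base W J \<longleftrightarrow> convex W \<and> open W \<and> W \<inter> P = {} \<and> (\<forall>i\<in>I - J. q i \<notin> W)"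

lemma F_nonzero: "\<lbrakk>good_base W J; i \<in> I - J; z \<in> W\<rbrakk> \<Longrightarrow> F i z \<noteq> 0"
  using F[of i z] h(2)[of i z] unfolding good_base_def by fastforce

lemma F_continuous: "i \<in> I \<Longrightarrow> W \<inter> P = {} \<Longrightarrow> continuous_on W (F i)"
proof -
  assume i: "i \<in> I" and W: "W \<inter> P = {}"
  have "continuous_on W (\<lambda>z. (z - q i) * h i z)"
    by (intro continuous_intros continuous_on_subset[OF h(1)[OF i]]) (use W in auto)
  moreover have "(z - q i) * h i z = F i z" if "z \<in> W" for z
    using F[OF i, of z] W that by (auto simp: disjoint_iff)
  ultimately show ?thesis by (rule continuous_on_eq)
qed

lemma section_unique:
  assumes "connected W" "is_section W J g" "is_section W J g'" "i \<in> I - J" "good_base W J"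
    "z \<in> W" "w \<in> W" "g i z = g' i z"
  shows "g i w = g' i w"
proof -
  have c: "continuous_on W (g i)" "continuous_on W (g' i)" "\<And>z. z \<in> W \<Longrightarrow> (g i z)\<^sup>2 = F i z" "\<And>z. z \<in> W \<Longrightarrow> (g' i z)\<^sup>2 = F i z"
    using assms(2,3,4) by (auto simp: is_section_def)
  have nz: "g' i z \<noteq> 0" if "z \<in> W" for z using c(4)[OF that] F_nonzero[OF assms(5,4) that] by auto
  have "continuous_on W (\<lambda>z. g i z / g' i z)" using c nz by (intro continuous_intros) auto
  moreover have "(\<lambda>z. g i z / g' i z) ` W \<subseteq> {1, -1}"
  proof (rule image_subsetI)
    fix z assume z: "z \<in> W"
    have "(g i z)\<^sup>2 = (g' i z)\<^sup>2" using c z by simp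
    then show "g i z / g' i z \<in> {1, -1}" using nz[OF z] by (auto simp: power2_eq_iff)
  qed
  ultimately have "g i z / g' i z = g i w / g' i w"
    using continuous_map_countable_range_constant[of euclidean W "\<lambda>z. g i z / g' i z" "{1,-1}" z w] assms by auto
  then show ?thesis using assms(8) nz[OF assms(6)] nz[OF assms(7)] by simp
qed

lemma section_nonzero:
  assumes "good_base W J" "is_section W J g" "i \<in> I - J" "z \<in> W"
  shows "g i z \<noteq> 0"
proof -
  have "(g i z)\<^sup>2 = F i z" using assms by (simp add: is_section_def)
  then show ?thesis using F_nonzero[OF assms(1,3,4)] by (metis zero_power2)
qed

lemma piece_eq:
  assumes "good_base W J" "is_section W J g" "is_section W J g'" "x \<in> piece W J g" "x \<in> piece W J g'"
  shows "piece W J g = piece W J g'"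
proof -
  have "connected W" using assms(1) by (simp add: good_base_def convex_connected)
  then have "g i w = g' i w" if "i \<in> I - J" "w \<in> W" for i w
    using section_unique[OF _ assms(2,3) that(1) assms(1), of "fst x" w] assms(4,5) that
    by (auto simp: piece_def)
  then show ?thesis unfolding piece_def by auto
qed

lemma section_exists:
  assumes W: "good_base W J" and e: "(z, c) \<in> E" "z \<in> W"
  obtains g where "is_section W J g" "(z, c) \<in> piece W J g"
proof -
  have "\<exists>g. continuous_on W g \<and> (\<forall>w\<in>W. (g w)\<^sup>2 = F i w) \<and> g z = c i" if i: "i \<in> I - J" for i
  proof -
    obtain g where g: "continuous_on W g" "\<And>w. w \<in> W \<Longrightarrow> F i w = (g w)\<^sup>2"
    proof (rule continuous_sqrt_on_contractible)
      show "continuous_on W (F i)" using F_continuous i W by (auto simp: good_base_def)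
      show "contractible W" using W by (auto simp: good_base_def convex_imp_contractible)
      show "F i w \<noteq> 0" if "w \<in> W" for w using F_nonzero[OF W i that] .
    qed blast
    have "(g z)\<^sup>2 = (c i)\<^sup>2" using e i g(2)[of z] by (auto simp: branched_cover_def)
    then consider "g z = c i" | "g z = - c i" by (auto simp: power2_eq_iff)
    then show ?thesis
    proof cases
      case 1 then show ?thesis using g by (intro exI[of _ g]) auto
    next
      case 2 then show ?thesis using g by (intro exI[of _ "\<lambda>w. - g w"]) (auto intro: continuous_intros)
    qed
  qed
  then obtain g where "\<forall>i\<in>I - J. continuous_on W (g i) \<and> (\<forall>w\<in>W. (g i w)\<^sup>2 = F i w) \<and> g i z = c i"
    by metis
  then have "is_section W J g" "(z,c) \<in> piece W J g"
    using e by (auto simp: is_section_def piece_def)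
  then show ?thesis by (rule that)
qed

lemma continuous_on_coords: "continuous_on S (\<lambda>x::complex \<times> ('i \<Rightarrow> complex). snd x i)"
  by (rule continuous_on_product_then_coordinatewise[where f=snd]) (intro continuous_on_snd continuous_on_id)

text \<open>Over \<open>W\<close> the coordinate \<open>c i\<close> is \<open>g i z\<close> or \<open>- g i z\<close>, and the sign of the real part of the quotient tells which.\<close>
lemma open_piece:
  assumes W: "good_base W J" and g: "is_section W J g"
  shows "openin (top_of_set E) (piece W J g)"
proof -
  let ?f = "\<lambda>i x. Re (snd x i / g i (fst x))"
  have "openin (top_of_set (E \<inter> W \<times> UNIV)) {x \<in> E \<inter> W \<times> UNIV. \<forall>i\<in>I - J. ?f i x > 0}"
  proof -
    have "continuous_on (E \<inter> W \<times> UNIV) (?f i)" if "i \<in> I - J" for i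
    proof -
      have "continuous_on (E \<inter> W \<times> UNIV) (\<lambda>x. g i (fst x))"
        by (rule continuous_on_compose2[of W "g i"]) (use g that in \<open>auto simp: is_section_def intro!: continuous_intros\<close>)
      moreover have "g i z \<noteq> 0" if "z \<in> W" for z
        using section_nonzero[OF W g \<open>i \<in> I - J\<close> that] .
      ultimately show ?thesis
        by (intro continuous_intros continuous_on_coords) auto
    qed
    then have "openin (top_of_set (E \<inter> W \<times> UNIV)) ((E \<inter> W \<times> UNIV) \<inter> ?f i -` {0<..})" if "i \<in> I - J" for i
      by (rule continuous_openin_preimage_gen) (use that in auto)
    then have "openin (top_of_set (E \<inter> W \<times> UNIV))
        ((\<Inter>i\<in>I - J. (E \<inter> W \<times> UNIV) \<inter> ?f i -` {0<..}) \<inter> topspace (top_of_set (E \<inter> W \<times> UNIV)))"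
      using finite_I by (intro openin_INT) auto
    also have "((\<Inter>i\<in>I - J. (E \<inter> W \<times> UNIV) \<inter> ?f i -` {0<..}) \<inter> topspace (top_of_set (E \<inter> W \<times> UNIV)))
       = {x \<in> E \<inter> W \<times> UNIV. \<forall>i\<in>I - J. ?f i x > 0}" by auto
    finally show ?thesis .
  qed
  moreover have "openin (top_of_set E) (E \<inter> W \<times> UNIV)"
    using W by (auto simp: good_base_def openin_open_Int open_Times)
  ultimately have "openin (top_of_set E) {x \<in> E \<inter> W \<times> UNIV. \<forall>i\<in>I - J. ?f i x > 0}"
    by (rule openin_trans)
  moreover have "{x \<in> E \<inter> W \<times> UNIV. \<forall>i\<in>I - J. ?f i x > 0} = piece W J g"
  proof -
    have "?f i (z,c) > 0 \<longleftrightarrow> c i = g i z" if "(z,c) \<in> E" "z \<in> W" "i \<in> I - J" for z c i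
    proof -
      have "(c i)\<^sup>2 = (g i z)\<^sup>2" using that g by (auto simp: is_section_def branched_cover_def)
      then consider "c i = g i z" | "c i = - g i z" by (auto simp: power2_eq_iff)
      then show ?thesis using section_nonzero[OF W g that(3,2)] by cases simp_all
    qed
    then show ?thesis unfolding piece_def by auto
  qed
  ultimately show ?thesis by simp
qed

lemma extensor_graph_piece:
  assumes N: "normal_space N" and W: "good_base W {}" "W \<noteq> {}" and g: "is_section W {} g"
  shows "absolute_extensor_for N (top_of_set (piece W {} g))"
proof (rule absolute_extensor_for_retract)
  obtain a where "a \<in> W" using W by auto
  then show "absolute_extensor_for N (top_of_set W)"
    using W by (intro absolute_extensor_for_starlike[OF N, of W a])
      (auto simp: good_base_def dest: convex_contains_segment[THEN iffD1])
  show "continuous_map (top_of_set (piece W {} g)) (top_of_set W) fst"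
    by (auto simp: piece_def intro!: continuous_intros)
  let ?q = "\<lambda>z. (z, \<lambda>i. if i \<in> I then g i z else 0)"
  have "continuous_on W ?q"
  proof (intro continuous_on_Pair continuous_on_id continuous_on_coordinatewise_then_product)
    show "continuous_on W (\<lambda>z. if i \<in> I then g i z else 0)" for i
      using g by (cases "i \<in> I") (auto simp: is_section_def)
  qed
  then show "continuous_map (top_of_set W) (top_of_set (piece W {} g)) ?q"
    using g W by (auto simp: piece_def branched_cover_def is_section_def good_base_def)
  show "?q (fst x) = x" if "x \<in> topspace (top_of_set (piece W {} g))" for x
    using that by (auto simp: piece_def branched_cover_def fun_eq_iff)
qed

text \<open>The piece is the double cover of a strip branched at \<open>q i\<close>. The square root of \<open>z - q i\<close> is a global coordinate
on it, and it identifies the piece with the cross-shaped region between two hyperbolas, starlike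
about \<open>0\<close>.\<close>
lemma extensor_branch_piece:
  assumes N: "normal_space N" and i: "i \<in> I" and W: "good_base W {i}" "W = {z. \<bar>Im z - Im (q i)\<bar> < e}" "e > 0"
    and g: "is_section W {i} g"
  shows "absolute_extensor_for N (top_of_set (piece W {i} g))"
proof -
  have WP: "w \<notin> P" if "w \<in> W" for w using W(1) that by (auto simp: good_base_def disjoint_iff)
  obtain r where r: "continuous_on W r" "\<And>w. w \<in> W \<Longrightarrow> h i w = (r w)\<^sup>2"
  proof (rule continuous_sqrt_on_contractible)
    show "continuous_on W (h i)" by (rule continuous_on_subset[OF h(1)[OF i]]) (use WP in auto)
    show "contractible W" using W by (simp add: good_base_def convex_imp_contractible)
    show "h i w \<noteq> 0" if "w \<in> W" for w using h(2)[OF i WP[OF that]] .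
  qed blast
  have r0: "r w \<noteq> 0" if "w \<in> W" for w using h(2)[OF i WP[OF that]] unfolding r(2)[OF that] by simp
  define D where "D = {d::complex. \<bar>Im (d\<^sup>2)\<bar> < e}"
  have sqD: "q i + d\<^sup>2 \<in> W" if "d \<in> D" for d using that by (simp add: W(2) D_def)
  show ?thesis
  proof (rule absolute_extensor_for_retract)
    show "absolute_extensor_for N (top_of_set D)"
    proof (rule absolute_extensor_for_starlike[OF N, of D 0])
      have "open (Im -` {-e<..<e})" by (intro open_vimage continuous_intros open_greaterThanLessThan)
      then have "open ((\<lambda>d::complex. d\<^sup>2) -` (Im -` {-e<..<e}))" by (intro open_vimage continuous_intros)
      also have "(\<lambda>d::complex. d\<^sup>2) -` (Im -` {-e<..<e}) = D" by (auto simp: D_def abs_less_iff)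
      finally show "open D" .
      show "0 \<in> D" using \<open>e > 0\<close> by (simp add: D_def)
      show "closed_segment 0 z \<subseteq> D" if "z \<in> D" for z
      proof
        fix w assume "w \<in> closed_segment 0 z"
        then obtain u where u: "0 \<le> u" "u \<le> 1" "w = of_real u * z"
          by (auto simp: closed_segment_def scaleR_conv_of_real)
        have "w\<^sup>2 = of_real (u\<^sup>2) * z\<^sup>2" by (simp add: u power_mult_distrib)
        then have "Im (w\<^sup>2) = u\<^sup>2 * Im (z\<^sup>2)" using times_complex.simps(2)[of "complex_of_real (u\<^sup>2)" "z\<^sup>2"]
          by (simp del: of_real_power)
        then have "\<bar>Im (w\<^sup>2)\<bar> = u\<^sup>2 * \<bar>Im (z\<^sup>2)\<bar>" by (simp add: abs_mult)
        also have "\<dots> \<le> \<bar>Im (z\<^sup>2)\<bar>" using u by (simp add: mult_left_le_one_le power_le_one)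
        finally show "w \<in> D" using that by (simp add: D_def)
      qed
    qed
    let ?p = "\<lambda>x. snd x i / r (fst x)"
    let ?q = "\<lambda>d. (q i + d\<^sup>2, \<lambda>k. if k = i then d * r (q i + d\<^sup>2) else if k \<in> I then g k (q i + d\<^sup>2) else 0)"
    have dq: "(?p x)\<^sup>2 = fst x - q i" if "x \<in> piece W {i} g" for x
    proof -
      have "fst x \<in> W" "(snd x i)\<^sup>2 = F i (fst x)" using that i by (auto simp: piece_def branched_cover_def)
      moreover have "F i (fst x) = (fst x - q i) * (r (fst x))\<^sup>2"
        using F[OF i WP] r(2) \<open>fst x \<in> W\<close> by simp
      ultimately show ?thesis using r0[of "fst x"] by (simp add: power_divide)
    qed
    have "continuous_on (piece W {i} g) (\<lambda>x. r (fst x))"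
      by (rule continuous_on_compose2[OF r(1)]) (auto simp: piece_def intro!: continuous_intros)
    then have "continuous_on (piece W {i} g) ?p"
      by (intro continuous_intros continuous_on_coords) (auto simp: piece_def r0)
    moreover have "?p x \<in> D" if "x \<in> piece W {i} g" for x
    proof -
      have "fst x \<in> W" using that by (auto simp: piece_def)
      then show ?thesis unfolding D_def mem_Collect_eq dq[OF that] by (simp add: W(2))
    qed
    ultimately show "continuous_map (top_of_set (piece W {i} g)) (top_of_set D) ?p" by auto
    have cr: "continuous_on D (\<lambda>d. f (q i + d\<^sup>2))" if "continuous_on W f" for f :: "complex \<Rightarrow> complex"
      by (rule continuous_on_compose2[OF that]) (auto intro!: continuous_intros sqD)
    have "continuous_on D ?q"
    proof (intro continuous_on_Pair continuous_on_coordinatewise_then_product)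
      show "continuous_on D (\<lambda>d. if k = i then d * r (q i + d\<^sup>2) else if k \<in> I then g k (q i + d\<^sup>2) else 0)" for k
        using g cr[OF r(1)] cr[of "g k"] by (cases "k = i"; cases "k \<in> I") (auto simp: is_section_def intro!: continuous_intros)
    qed (intro continuous_intros)
    moreover have "?q d \<in> piece W {i} g" if "d \<in> D" for d
    proof -
      have w: "q i + d\<^sup>2 \<in> W" using sqD[OF that] .
      then have wP: "q i + d\<^sup>2 \<notin> P" by (rule WP)
      have "(d * r (q i + d\<^sup>2))\<^sup>2 = F i (q i + d\<^sup>2)" using F[OF i wP] r(2)[OF w] by (simp add: power_mult_distrib)
      then show ?thesis using w wP g i by (auto simp: piece_def branched_cover_def is_section_def)
    qed
    ultimately show "continuous_map (top_of_set D) (top_of_set (piece W {i} g)) ?q" by auto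
    show "?q (?p x) = x" if "x \<in> topspace (top_of_set (piece W {i} g))" for x
    proof -
      have x: "x \<in> piece W {i} g" using that by simp
      then have w: "fst x \<in> W" by (auto simp: piece_def)
      have "q i + (?p x)\<^sup>2 = fst x" using dq[OF x] by simp
      then show ?thesis using x r0[OF w] i by (auto simp: prod_eq_iff fun_eq_iff piece_def branched_cover_def)
    qed
  qed
qed

end

context horizontal_cuts begin

text \<open>The set of heights below the strip names it. This avoids sorting the heights; for most \<open>L\<close> the set is
empty.\<close>
definition strip :: "real set \<Rightarrow> complex set" where
  "strip L = {z. \<forall>t\<in>Im ` (P \<union> q ` I). Im z \<noteq> t \<and> (t < Im z \<longleftrightarrow> t \<in> L)}"

lemma strip_convex_open: "convex (strip L)" "open (strip L)"
proof -
  have eq: "strip L = (\<Inter>t\<in>Im ` (P \<union> q ` I). if t \<in> L then {z. Im z > t} else {z. Im z < t})"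
  proof -
    have "(Im z \<noteq> t \<and> (t < Im z \<longleftrightarrow> t \<in> L)) \<longleftrightarrow> z \<in> (if t \<in> L then {z. Im z > t} else {z. Im z < t})" for z t
      by auto
    then show ?thesis unfolding strip_def by blast
  qed
  show "convex (strip L)"
    unfolding eq by (intro convex_INT) (auto simp: convex_halfspace_Im_gt convex_halfspace_Im_lt)
  show "open (strip L)"
    unfolding eq using finite_P finite_I
    by (intro open_INT) (auto simp: open_halfspace_Im_gt open_halfspace_Im_lt)
qed

lemma finite_separated:
  obtains e :: real where "e > 0"
    "\<forall>a\<in>P \<union> q ` I. \<forall>b\<in>P \<union> q ` I. \<forall>z. \<bar>Im z - Im a\<bar> < e \<longrightarrow> \<bar>Im z - Im b\<bar> < e \<longrightarrow> a = b"
proof -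
  let ?Q = "P \<union> q ` I"
  let ?D = "insert 1 ((\<lambda>(a,b). \<bar>Im a - Im b\<bar>) ` {x \<in> ?Q \<times> ?Q. fst x \<noteq> snd x})"
  have "finite (?Q \<times> ?Q)" using finite_P finite_I by auto
  then have fin: "finite ?D" by auto
  have pos: "\<forall>d\<in>?D. d > 0" using inj_Im by (auto simp: inj_on_def)
  show ?thesis
  proof (rule that[of "Min ?D / 2"])
    show "Min ?D / 2 > 0" using pos fin Min_in[OF fin] by auto
    show "\<forall>a\<in>?Q. \<forall>b\<in>?Q. \<forall>z. \<bar>Im z - Im a\<bar> < Min ?D / 2 \<longrightarrow> \<bar>Im z - Im b\<bar> < Min ?D / 2 \<longrightarrow> a = b"
    proof (intro ballI allI impI, rule ccontr)
      fix a b z assume ab: "a \<in> ?Q" "b \<in> ?Q" "a \<noteq> b"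
        and *: "\<bar>Im z - Im a\<bar> < Min ?D / 2" "\<bar>Im z - Im b\<bar> < Min ?D / 2"
      have "\<bar>Im a - Im b\<bar> \<in> ?D" using ab by (intro insertI2 image_eqI[of _ _ "(a,b)"]) auto
      then have "Min ?D \<le> \<bar>Im a - Im b\<bar>" using fin by (intro Min_le)
      then show False using * by linarith
    qed
  qed
qed

text \<open>The pieces are the sheets over the strips (\<open>TB\<close>) and over the neighbourhoods of the cut lines (\<open>NB\<close>), where
the line through a puncture is split into its two half-lines. Base sets of the same kind are
disjoint and so are different sheets over one base set. Hence a piece only meets pieces of the other
kind, there are no triple intersections, and a nonempty intersection is a sheet over the
convex set \<open>W \<inter> W'\<close>.\<close>
theorem rel_aspherical_branched_cover:
  assumes "logarithmic_pair K A"
  shows "rel_aspherical K A (top_of_set E)"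
proof -
  interpret logarithmic_pair K A by fact
  let ?Q = "P \<union> q ` I"
  obtain e where e: "e > 0"
    and sep: "\<forall>a\<in>?Q. \<forall>b\<in>?Q. \<forall>z. \<bar>Im z - Im a\<bar> < e \<longrightarrow> \<bar>Im z - Im b\<bar> < e \<longrightarrow> a = b"
    by (rule finite_separated)
  define nbhd where "nbhd a = {z. \<bar>Im z - Im a\<bar> < e}" for a
  define left where "left p = nbhd p \<inter> {z. Re z < Re p}" for p
  define right where "right p = nbhd p \<inter> {z. Re z > Re p}" for p
  have nbhd: "a = b" if "a \<in> ?Q" "b \<in> ?Q" "z \<in> nbhd a" "z \<in> nbhd b" for a b z
    using sep that by (auto simp: nbhd_def)
  have self: "a \<in> nbhd a" for a using e by (simp add: nbhd_def)
  have nbhd_eq: "nbhd a = {z. Im z < Im a + e} \<inter> {z. Im z > Im a - e}" for a by (auto simp: nbhd_def)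
  have nbhd_co: "convex (nbhd a)" "open (nbhd a)" for a
    unfolding nbhd_eq by (auto intro!: convex_Int open_Int convex_halfspace_Im_lt convex_halfspace_Im_gt
        open_halfspace_Im_gt open_halfspace_Im_lt)
  have lr_co: "convex (left p)" "open (left p)" "convex (right p)" "open (right p)" for p
    unfolding left_def right_def by (auto intro!: convex_Int open_Int nbhd_co convex_halfspace_Re_lt convex_halfspace_Re_gt
        open_halfspace_Re_gt open_halfspace_Re_lt)
  define TB where "TB = {(strip L, {}::'i set) | L. L \<subseteq> Im ` ?Q}"
  define NB where "NB = (\<lambda>i. (nbhd (q i), {i})) ` I \<union> (\<lambda>p. (left p, {})) ` P \<union> (\<lambda>p. (right p, {})) ` P"
  have goodT: "good_base W J \<and> J = {}" if "(W,J) \<in> TB" for W J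
    using that by (auto simp: TB_def good_base_def strip_convex_open) (auto simp: strip_def)
  have goodN: "good_base W J" if WJ: "(W,J) \<in> NB" for W J
  proof -
    consider i where "i \<in> I" "W = nbhd (q i)" "J = {i}"
      | p where "p \<in> P" "W = left p \<or> W = right p" "J = {}" using WJ by (auto simp: NB_def)
    then show ?thesis
    proof cases
      case 1
      have "p \<notin> W" if "p \<in> P" for p using nbhd[of p "q i" p] 1 that self qP[of i] by auto
      moreover have "q k \<notin> W" if "k \<in> I - J" for k
        using nbhd[of "q k" "q i" "q k"] 1 that self inj_q by (auto simp: inj_on_def)
      ultimately show ?thesis using 1 nbhd_co by (auto simp: good_base_def)
    next
      case 2
      have "p' \<notin> W" if "p' \<in> P" for p' using nbhd[of p' p p'] 2 that self by (auto simp: left_def right_def)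
      moreover have "q k \<notin> W" if "k \<in> I" for k
        using nbhd[of "q k" p "q k"] 2 that self qP[of k] by (auto simp: left_def right_def)
      ultimately show ?thesis using 2 lr_co by (auto simp: good_base_def)
    qed
  qed
  have uniqT: "W = W' \<and> J = J'" if TT: "(W,J) \<in> TB" "(W',J') \<in> TB" "z \<in> W" "z \<in> W'" for W J W' J' z
  proof -
    obtain L L' where L: "W = strip L" "W' = strip L'" "L \<subseteq> Im ` ?Q" "L' \<subseteq> Im ` ?Q" "J = {}" "J' = {}"
      using TT(1,2) unfolding TB_def by auto
    have gen: "M = {t \<in> H. t < y}" if "\<forall>t\<in>H. y \<noteq> t \<and> (t < y \<longleftrightarrow> t \<in> M)" "M \<subseteq> H" for M H and y :: real
      using that by blast
    have z: "z \<in> strip L" "z \<in> strip L'" using L TT(3,4) by simp_all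
    have "L = {t \<in> Im ` ?Q. t < Im z}" "L' = {t \<in> Im ` ?Q. t < Im z}"
      by (rule gen[OF _ L(3)], use z(1) in \<open>simp only: strip_def mem_Collect_eq\<close>)
         (rule gen[OF _ L(4)], use z(2) in \<open>simp only: strip_def mem_Collect_eq\<close>)
    then show ?thesis using L by simp
  qed
  have uniqN: "W = W' \<and> J = J'" if NN: "(W,J) \<in> NB" "(W',J') \<in> NB" "z \<in> W" "z \<in> W'" for W J W' J' z
  proof -
    define centred where "centred a z W J \<longleftrightarrow> (\<exists>i\<in>I. a = q i \<and> W = nbhd (q i) \<and> J = {i}) \<or>
        (a \<in> P \<and> J = {} \<and> (Re z < Re a \<and> W = left a \<or> Re z > Re a \<and> W = right a))"
      for a z W and J :: "'i set"
    have center: "\<exists>a\<in>?Q. z \<in> nbhd a \<and> centred a z W J" if "(W,J) \<in> NB" "z \<in> W" for W J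
      using that unfolding NB_def centred_def by (fastforce simp: left_def right_def)
    obtain a where a: "a \<in> ?Q" "z \<in> nbhd a" "centred a z W J" using center[OF NN(1,3)] by blast
    obtain b where b: "b \<in> ?Q" "z \<in> nbhd b" "centred b z W' J'" using center[OF NN(2,4)] by blast
    have "a = b" using nbhd a b by blast
    then show ?thesis using a(3) b(3) qP inj_q unfolding centred_def by (auto simp: inj_on_def)
  qed
  have covB: "\<exists>W J. (W,J) \<in> TB \<union> NB \<and> z \<in> W" if z: "z \<notin> P" for z
  proof (cases "Im z \<in> Im ` ?Q")
    case False
    then have z: "z \<in> strip {t \<in> Im ` ?Q. t < Im z}" by (auto simp: strip_def)
    have "{t \<in> Im ` ?Q. t < Im z} \<subseteq> Im ` ?Q" by (rule Collect_restrict)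
    then have "(strip {t \<in> Im ` ?Q. t < Im z}, {}) \<in> TB"
      unfolding TB_def by (intro CollectI exI[of _ "{t \<in> Im ` ?Q. t < Im z}"] conjI refl)
    with z show ?thesis by (intro exI conjI UnI1)
  next
    case True
    then obtain a where a: "a \<in> ?Q" "Im z = Im a" by blast
    then have zn: "z \<in> nbhd a" using e by (simp add: nbhd_def)
    show ?thesis
    proof (cases "a \<in> P")
      case False
      then obtain i where i: "i \<in> I" "a = q i" using a by blast
      then have "(nbhd (q i), {i}) \<in> NB" unfolding NB_def by (intro UnI1 imageI)
      with zn i(2) show ?thesis by (intro exI conjI UnI2) simp_all
    next
      case True
      then have "Re z \<noteq> Re a" using z a(2) by (metis complex_eqI)
      then have "z \<in> left a \<or> z \<in> right a" using zn by (auto simp: left_def right_def)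
      moreover have "(left a, {}) \<in> NB" "(right a, {}) \<in> NB" using True by (simp_all add: NB_def)
      ultimately show ?thesis by (metis UnI2)
    qed
  qed
  define \<U> where "\<U> = {piece W J g | W J g. (W,J) \<in> TB \<union> NB \<and> is_section W J g \<and> piece W J g \<noteq> {}}"
  have good: "good_base W J" if "(W,J) \<in> TB \<union> NB" for W J using goodT goodN that by blast
  have \<U>E: "\<exists>W J g. U = piece W J g \<and> (W,J) \<in> TB \<union> NB \<and> is_section W J g \<and> piece W J g \<noteq> {} \<and> good_base W J"
    if "U \<in> \<U>" for U using that good unfolding \<U>_def by blast
  have inter: "\<exists>W J g W' J' g'. (W,J) \<in> TB \<and> (W',J') \<in> NB \<and> is_section W J g \<and> is_section W' J' g' \<and>
          ((U = piece W J g \<and> V = piece W' J' g') \<or> (V = piece W J g \<and> U = piece W' J' g'))"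
    if UV: "U \<in> \<U>" "V \<in> \<U>" "U \<noteq> V" and x: "x \<in> U" "x \<in> V" for U V x
  proof -
    obtain W J g where U: "U = piece W J g" "(W,J) \<in> TB \<union> NB" "is_section W J g" "good_base W J"
      using \<U>E[OF UV(1)] by blast
    obtain W' J' g' where V: "V = piece W' J' g'" "(W',J') \<in> TB \<union> NB" "is_section W' J' g'" "good_base W' J'"
      using \<U>E[OF UV(2)] by blast
    have fx: "fst x \<in> W" "fst x \<in> W'" using x U V by (auto simp: piece_def)
    have ne: "\<not> (W = W' \<and> J = J')"
    proof
      assume "W = W' \<and> J = J'"
      then show False using piece_eq[of W J g g' x] U V x UV(3) by auto
    qed
    have notTT: "\<not> ((W,J) \<in> TB \<and> (W',J') \<in> TB)" using uniqT[of W J W' J' "fst x"] fx ne by blast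
    have notNN: "\<not> ((W,J) \<in> NB \<and> (W',J') \<in> NB)" using uniqN[of W J W' J' "fst x"] fx ne by blast
    consider "(W,J) \<in> TB" "(W',J') \<in> NB" | "(W',J') \<in> TB" "(W,J) \<in> NB"
      using U(2) V(2) notTT notNN by (simp only: Un_iff) metis
    then show ?thesis
    proof cases
      case 1
      show ?thesis
        by (rule exI[of _ W], rule exI[of _ J], rule exI[of _ g], rule exI[of _ W'], rule exI[of _ J'], rule exI[of _ g'])
           (simp add: 1 U(1,3) V(1,3))
    next
      case 2
      show ?thesis
        by (rule exI[of _ W'], rule exI[of _ J'], rule exI[of _ g'], rule exI[of _ W], rule exI[of _ J], rule exI[of _ g])
           (simp add: 2 U(1,3) V(1,3))
    qed
  qed
  have sameT: "piece W J g = piece W' J' g'"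
    if "(W,J) \<in> TB" "(W',J') \<in> TB" "is_section W J g" "is_section W' J' g'" "x \<in> piece W J g" "x \<in> piece W' J' g'"
    for W J g W' J' g' x
  proof -
    have "W = W' \<and> J = J'" using uniqT[OF that(1,2), of "fst x"] that(5,6) by (auto simp: piece_def)
    then show ?thesis using piece_eq that good by blast
  qed
  have sameN: "piece W J g = piece W' J' g'"
    if "(W,J) \<in> NB" "(W',J') \<in> NB" "is_section W J g" "is_section W' J' g'" "x \<in> piece W J g" "x \<in> piece W' J' g'"
    for W J g W' J' g' x
  proof -
    have "W = W' \<and> J = J'" using uniqN[OF that(1,2), of "fst x"] that(5,6) by (auto simp: piece_def)
    then show ?thesis using piece_eq that good by blast
  qed
  show ?thesis
  proof (rule rel_aspherical_of_pieces[of \<U>])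
    show "openin (top_of_set E) U" if "U \<in> \<U>" for U using \<U>E[OF that] open_piece by blast
    show "\<Union>\<U> = topspace (top_of_set E)"
    proof
      show "\<Union>\<U> \<subseteq> topspace (top_of_set E)" unfolding \<U>_def by (auto simp: piece_def)
      show "topspace (top_of_set E) \<subseteq> \<Union>\<U>"
      proof
        fix x assume "x \<in> topspace (top_of_set E)"
        then obtain z c where x: "x = (z,c)" "(z,c) \<in> E" by (cases x) auto
        then have "z \<notin> P" by (auto simp: branched_cover_def)
        then obtain W J where W: "(W,J) \<in> TB \<union> NB" "z \<in> W" using covB by blast
        obtain g where "is_section W J g" "(z, c) \<in> piece W J g"
          by (rule section_exists[OF good[OF W(1)] x(2) W(2)])
        then show "x \<in> \<Union>\<U>" using W x unfolding \<U>_def by blast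
      qed
    qed
    show "absolute_extensor_for IK (subtopology (top_of_set E) U)" if U: "U \<in> \<U>" for U
    proof -
      obtain W J g where U: "U = piece W J g" "(W,J) \<in> TB \<union> NB" "is_section W J g" "piece W J g \<noteq> {}" "good_base W J"
        using \<U>E[OF U] by blast
      have eq: "subtopology (top_of_set E) U = top_of_set U"
        unfolding subtopology_subtopology U(1) by (rule arg_cong[where f=top_of_set]) (auto simp: piece_def)
      have "absolute_extensor_for IK (top_of_set (piece W J g))"
      proof (cases "J = {}")
        case True
        have "W \<noteq> {}" using U(4) by (auto simp: piece_def)
        then show "absolute_extensor_for IK (top_of_set (piece W J g))"
          using extensor_graph_piece[OF normal_IK _ _ ] U(3,5) True by blast
      next
        case False
        then obtain i where i: "i \<in> I" "W = nbhd (q i)" "J = {i}" using U(2) goodT by (auto simp: NB_def)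
        show "absolute_extensor_for IK (top_of_set (piece W J g))"
          using extensor_branch_piece[OF normal_IK i(1) _ _ e] U(3,5) i(2,3) by (simp add: nbhd_def)
      qed
      then show ?thesis unfolding eq unfolding U(1) .
    qed
    show "absolute_extensor_for K (subtopology (top_of_set E) (U \<inter> V))"
      if UV: "U \<in> \<U>" "V \<in> \<U>" "U \<noteq> V" "U \<inter> V \<noteq> {}" for U V
    proof -
      obtain x where x: "x \<in> U" "x \<in> V" using UV by blast
      obtain W J g W' J' g' where WJ: "(W,J) \<in> TB" "(W',J') \<in> NB" "is_section W J g" "is_section W' J' g'"
          and "(U = piece W J g \<and> V = piece W' J' g') \<or> (V = piece W J g \<and> U = piece W' J' g')"
        using inter[OF UV(1,2,3) x] by blast
      then have UVeq: "U \<inter> V = piece W J g \<inter> piece W' J' g'" by blast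
      have J: "J = {}" and gW: "good_base W J" and gW': "good_base W' J'" using goodT goodN WJ by blast+
      have gI: "good_base (W \<inter> W') {}" and gI': "good_base (W \<inter> W') J'"
        using gW gW' J by (auto simp: good_base_def convex_Int)
      have sI: "is_section (W \<inter> W') {} g" "is_section (W \<inter> W') J' g" "is_section (W \<inter> W') J' g'"
        using WJ J by (auto simp: is_section_def intro: continuous_on_subset)
      have xx: "x \<in> piece W J g" "x \<in> piece W' J' g'" using x UVeq by blast+
      then have fx: "fst x \<in> W \<inter> W'" by (auto simp: piece_def)
      have agree: "g i w = g' i w" if "i \<in> I - J'" "w \<in> W \<inter> W'" for i w
      proof (rule section_unique[OF _ sI(2,3) that(1) gI' fx that(2)])
        show "connected (W \<inter> W')" using gI by (simp add: good_base_def convex_connected)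
        show "g i (fst x) = g' i (fst x)" using xx that J by (auto simp: piece_def)
      qed
      have "U \<inter> V = piece (W \<inter> W') {} g"
        unfolding UVeq J using agree by (auto simp: piece_def)
      moreover have "subtopology (top_of_set E) (piece (W \<inter> W') {} g) = top_of_set (piece (W \<inter> W') {} g)"
        unfolding subtopology_subtopology by (rule arg_cong[where f=top_of_set]) (auto simp: piece_def)
      ultimately show ?thesis using extensor_graph_piece[OF normal_K gI _ sI(1)] fx by auto
    qed
    show "U1 \<inter> U2 \<inter> U3 = {}" if U: "U1 \<in> \<U>" "U2 \<in> \<U>" "U3 \<in> \<U>" and ne: "U1 \<noteq> U2" "U1 \<noteq> U3" "U2 \<noteq> U3" for U1 U2 U3
    proof (rule ccontr)
      assume "U1 \<inter> U2 \<inter> U3 \<noteq> {}"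
      then obtain x where x: "x \<in> U1" "x \<in> U2" "x \<in> U3" by blast
      define isT where "isT U \<longleftrightarrow> (\<exists>W J g. U = piece W J g \<and> (W,J) \<in> TB \<and> is_section W J g)" for U
      define isN where "isN U \<longleftrightarrow> (\<exists>W J g. U = piece W J g \<and> (W,J) \<in> NB \<and> is_section W J g)" for U
      have TN: "isT U \<or> isN U" if "U \<in> \<U>" for U using \<U>E[OF that] unfolding isT_def isN_def by blast
      have T: "U = V" if "isT U" "isT V" "x \<in> U" "x \<in> V" for U V using that sameT unfolding isT_def by metis
      have N: "U = V" if "isN U" "isN V" "x \<in> U" "x \<in> V" for U V using that sameN unfolding isN_def by metis
      show False using TN[OF U(1)] TN[OF U(2)] TN[OF U(3)] T[of U1 U2] T[of U1 U3] T[of U2 U3]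
          N[of U1 U2] N[of U1 U3] N[of U2 U3] x ne by blast
    qed
  qed
qed

end

section \<open>Dragging a point along moving points\<close>

text \<open>For distinct \<open>a\<close> and \<open>b\<close> there is at most one real \<open>s\<close> for which \<open>1 + s \<i>\<close> turns them to the same height.\<close>
lemma generic_rotation:
  fixes S :: "complex set"
  assumes "finite S"
  obtains u where "u \<noteq> 0" "inj_on (\<lambda>z. Im (u * z)) S"
proof -
  define bad where "bad = (\<lambda>(a,b). - Im (a - b) / Re (a - b)) ` (S \<times> S)"
  have "finite bad" using assms by (simp add: bad_def)
  then obtain s :: real where s: "s \<notin> bad" using ex_new_if_finite infinite_UNIV_char_0 by blast
  have "inj_on (\<lambda>z. Im (Complex 1 s * z)) S"
  proof (rule inj_onI, rule ccontr)
    fix a b assume ab: "a \<in> S" "b \<in> S" "a \<noteq> b" and "Im (Complex 1 s * a) = Im (Complex 1 s * b)"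
    then have eq: "Im (a - b) + s * Re (a - b) = 0" by (simp add: algebra_simps)
    show False
    proof (cases "Re (a - b) = 0")
      case True
      with eq ab show False by (simp add: complex_eq_iff)
    next
      case False
      then have "s = - Im (a - b) / Re (a - b)" using eq by (simp add: field_simps)
      then have "s \<in> bad" using ab by (auto simp: bad_def intro!: image_eqI[of _ _ "(a,b)"])
      with s show False by simp
    qed
  qed
  moreover have "Complex 1 s \<noteq> 0" by (simp add: complex_eq_iff)
  ultimately show ?thesis by (rule that[rotated])
qed

lemma compact_space_positive_lower_bound:
  fixes g :: "'a \<Rightarrow> real"
  assumes "compact_space X" "continuous_map X euclideanreal g" "\<And>x. x \<in> topspace X \<Longrightarrow> g x > 0"
  obtains m where "m > 0" "\<forall>x\<in>topspace X. g x \<ge> m"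
proof (cases "topspace X = {}")
  case True then show ?thesis using that[of 1] by simp
next
  case False
  have "compactin euclideanreal (g ` topspace X)"
    using assms(1,2) image_compactin compact_space_def by blast
  then have c: "compact (g ` topspace X)" by simp
  obtain y where y: "y \<in> g ` topspace X" "\<forall>z\<in>g ` topspace X. y \<le> z"
    using compact_attains_inf[OF c] False by auto
  show ?thesis by (rule that[of y]) (use y assms(3) in auto)
qed

lemma min_of_finite_family:
  fixes J :: "'j set"
  assumes "finite J" "\<And>j. j \<in> J \<Longrightarrow> \<exists>d>0. \<forall>d'. 0 < d' \<and> d' \<le> d \<longrightarrow> Q j (d'::real)"
  obtains d where "d > 0" "\<forall>j\<in>J. Q j d"
proof -
  have "\<exists>d>0. \<forall>j\<in>J. \<forall>d'. 0 < d' \<and> d' \<le> d \<longrightarrow> Q j d'"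
    using assms
  proof (induction rule: finite_induct)
    case empty show ?case by (intro exI[of _ 1]) simp
  next
    case (insert j J)
    obtain d1 where d1: "d1 > 0" "\<forall>j\<in>J. \<forall>d'. 0 < d' \<and> d' \<le> d1 \<longrightarrow> Q j d'" using insert by force
    obtain d2 where d2: "d2 > 0" "\<forall>d'. 0 < d' \<and> d' \<le> d2 \<longrightarrow> Q j d'" using insert(4)[of j] by auto
    show ?case by (intro exI[of _ "min d1 d2"]) (use d1 d2 in auto)
  qed
  then obtain d where "d > 0" "\<forall>j\<in>J. \<forall>d'. 0 < d' \<and> d' \<le> d \<longrightarrow> Q j d'" by blast
  then have "\<forall>j\<in>J. Q j d" by simp
  with \<open>d > 0\<close> show ?thesis by (rule that)
qed

text \<open>The displacements \<open>y' j - y j\<close> are added to \<open>w\<close> with weights that are \<open>1\<close> near \<open>y j\<close> and vanish near the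
other points. Within distance \<open>d\<close> of \<open>y j\<close> the point \<open>w\<close> is thus translated along with it, and further away
it moves by less than \<open>d\<close> relative to that point, too little to hit it. In both cases the difference of \<open>w\<close> and the moving
point is multiplied by a factor within distance \<open>1\<close> of \<open>1\<close>. The factor is recorded as a
square, with a continuous root, since square roots of these differences have to be transported too.\<close>
lemma drag_point_step:
  fixes y y' :: "'j \<Rightarrow> 'p \<Rightarrow> complex" and w :: "'p \<Rightarrow> complex"
  assumes J: "finite J" and y: "\<And>j. j \<in> J \<Longrightarrow> continuous_map T euclidean (y j)"
    and y': "\<And>j. j \<in> J \<Longrightarrow> continuous_map T euclidean (y' j)" and w: "continuous_map T euclidean w"
    and d: "d > 0" and sep: "\<And>i j p. \<lbrakk>i \<in> J; j \<in> J; i \<noteq> j; p \<in> topspace T\<rbrakk> \<Longrightarrow> norm (y i p - y j p) \<ge> 3 * d"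
    and close: "\<And>j p. \<lbrakk>j \<in> J; p \<in> topspace T\<rbrakk> \<Longrightarrow> norm (y' j p - y j p) < e" and e: "e * (real (card J) + 1) \<le> d"
  obtains w' s where "continuous_map T euclidean w'" "\<forall>j\<in>J. continuous_map T euclidean (s j)"
    "\<forall>j\<in>J. \<forall>p\<in>topspace T. s j p \<noteq> (0::complex) \<and> w' p - y' j p = (s j p)\<^sup>2 * (w p - y j p)"
    "\<forall>p. (\<forall>j\<in>J. y' j p = y j p) \<longrightarrow> w' p = w p \<and> (\<forall>j\<in>J. s j p = 1)"
proof -
  \<comment> \<open>The weight is \<open>1\<close> up to distance \<open>d\<close> and \<open>0\<close> from distance \<open>2 d\<close> on; as the points are \<open>3 d\<close> apart, only one weight is nonzero within distance \<open>d\<close> of a point.\<close>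
  define b where "b r = max 0 (min 1 (2 - r / d))" for r :: real
  have b01: "0 \<le> b r" "b r \<le> 1" for r by (auto simp: b_def)
  have b1: "b r = 1" if "r \<le> d" for r using that d by (auto simp: b_def field_simps)
  have b0: "b r = 0" if "r \<ge> 2 * d" for r using that d by (auto simp: b_def field_simps)
  have contb: "continuous_on UNIV b" unfolding b_def using d by (intro continuous_intros) auto
  define w' where "w' p = w p + (\<Sum>j\<in>J. of_real (b (norm (w p - y j p))) * (y' j p - y j p))" for p
  have w': "continuous_map T euclidean w'"
    unfolding w'_def
  proof (intro continuous_map_add continuous_map_sum w J continuous_map_mult_field continuous_map_diff y y')
    fix j assume j: "j \<in> J"
    show "continuous_map T euclidean (\<lambda>p. complex_of_real (b (norm (w p - y j p))))"
    proof (rule continuous_map_compose_on2[OF w y[OF j], where S=UNIV])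
      show "continuous_on UNIV (\<lambda>p. complex_of_real (b (cmod (fst p - snd p))))"
        by (intro continuous_intros continuous_on_compose2[OF contb]) auto
    qed auto
  qed auto
  define r where "r j p = (if norm (w p - y j p) \<le> d then 1 else (w' p - y' j p) / (w p - y j p))" for j p
  have near: "w' p - y' j p = w p - y j p" if "j \<in> J" "p \<in> topspace T" "norm (w p - y j p) \<le> d" for j p
  proof -
    have "b (norm (w p - y i p)) = 0" if "i \<in> J - {j}" for i
    proof (rule b0)
      have "3 * d \<le> norm (y i p - y j p)" using sep[of i j p] that \<open>j \<in> J\<close> \<open>p \<in> topspace T\<close> by auto
      also have "\<dots> \<le> norm (w p - y j p) + norm (w p - y i p)"
        using norm_triangle_ineq4[of "w p - y j p" "w p - y i p"] by simp
      finally show "2 * d \<le> norm (w p - y i p)" using \<open>norm (w p - y j p) \<le> d\<close> by linarith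
    qed
    then have "(\<Sum>i\<in>J - {j}. of_real (b (norm (w p - y i p))) * (y' i p - y i p)) = 0" by simp
    then show ?thesis using b1[OF that(3)] by (simp add: w'_def sum.remove[OF J that(1)])
  qed
  have small: "norm ((w' p - y' j p) - (w p - y j p)) < d" if "j \<in> J" "p \<in> topspace T" for j p
  proof -
    have "norm (\<Sum>i\<in>J. of_real (b (norm (w p - y i p))) * (y' i p - y i p)) \<le> (\<Sum>i\<in>J. e)"
    proof (rule sum_norm_le)
      fix i assume i: "i \<in> J"
      have "norm (of_real (b (norm (w p - y i p))) * (y' i p - y i p)) = b (norm (w p - y i p)) * norm (y' i p - y i p)"
        using b01 by (simp add: norm_mult)
      also have "\<dots> \<le> 1 * norm (y' i p - y i p)" using b01 by (intro mult_right_mono) auto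
      also have "\<dots> \<le> e" using close[OF i that(2)] by simp
      finally show "norm (of_real (b (norm (w p - y i p))) * (y' i p - y i p)) \<le> e" .
    qed
    then have 1: "norm (w' p - w p) \<le> real (card J) * e" by (simp add: w'_def)
    have "norm ((w' p - y' j p) - (w p - y j p)) = norm ((w' p - w p) - (y' j p - y j p))" by (simp add: algebra_simps)
    also have "\<dots> \<le> norm (w' p - w p) + norm (y' j p - y j p)" by (rule norm_triangle_ineq4)
    also have "\<dots> \<le> real (card J) * e + norm (y' j p - y j p)" using 1 by simp
    also have "\<dots> < real (card J) * e + e" using close[OF that] by simp
    also have "\<dots> \<le> d" using e by (simp add: algebra_simps)
    finally show ?thesis .
  qed
  have r1: "norm (r j p - 1) < 1" if "j \<in> J" "p \<in> topspace T" for j p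
  proof (cases "norm (w p - y j p) \<le> d")
    case False
    then have nz: "w p - y j p \<noteq> 0" "norm (w p - y j p) > 0" using d by auto
    have "r j p - 1 = ((w' p - y' j p) - (w p - y j p)) / (w p - y j p)"
      using False nz by (simp add: r_def field_simps)
    then have "norm (r j p - 1) = norm ((w' p - y' j p) - (w p - y j p)) / norm (w p - y j p)" by (simp add: norm_divide)
    also have "\<dots> < 1" using small[OF that] False nz by (simp add: divide_simps)
    finally show ?thesis .
  qed (simp add: r_def)
  have rpos: "Re (r j p) > 0" if "j \<in> J" "p \<in> topspace T" for j p
  proof -
    have "\<bar>Re (r j p - 1)\<bar> < 1" using r1[OF that] abs_Re_le_cmod[of "r j p - 1"] by linarith
    then show ?thesis by simp
  qed
  have r: "continuous_map T euclidean (r j)" if j: "j \<in> J" for j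
  proof -
    have n: "continuous_map T euclideanreal (\<lambda>p. norm (w p - y j p))"
      by (rule continuous_map_compose_on2[OF w y[OF j], where S=UNIV]) (auto intro!: continuous_intros)
    have "continuous_map T euclidean (\<lambda>p. if norm (w p - y j p) \<le> d then 1 else (w' p - y' j p) / (w p - y j p))"
    proof (rule continuous_map_cases_le[OF n])
      show "continuous_map (subtopology T {x \<in> topspace T. d \<le> norm (w x - y j x)}) euclidean
              (\<lambda>p. (w' p - y' j p) / (w p - y j p))"
        using d by (intro continuous_map_divide_field continuous_map_diff continuous_map_from_subtopology w' y'[OF j] w y[OF j]) auto
      show "1 = (w' x - y' j x) / (w x - y j x)" if "x \<in> topspace T" "norm (w x - y j x) = d" for x
        using near[OF j that(1)] that(2) d by auto
    qed auto
    then show ?thesis by (simp add: r_def[abs_def])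
  qed
  show ?thesis
  proof (rule that[of w' "\<lambda>j p. csqrt (r j p)"])
    show "continuous_map T euclidean w'" by (rule w')
    show "\<forall>j\<in>J. continuous_map T euclidean (\<lambda>p. csqrt (r j p))"
    proof
      fix j assume j: "j \<in> J"
      show "continuous_map T euclidean (\<lambda>p. csqrt (r j p))"
      proof (rule continuous_map_compose_on[OF r[OF j]])
        show "continuous_on {z. Re z > 0} csqrt"
          by (intro continuous_at_imp_continuous_on ballI continuous_at_csqrt) (auto simp: complex_nonpos_Reals_iff)
        show "r j x \<in> {z. 0 < Re z}" if "x \<in> topspace T" for x using rpos[OF j that] by simp
      qed
    qed
    show "\<forall>j\<in>J. \<forall>p\<in>topspace T. csqrt (r j p) \<noteq> 0 \<and> w' p - y' j p = (csqrt (r j p))\<^sup>2 * (w p - y j p)"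
    proof (intro ballI conjI)
      fix j p assume jp: "j \<in> J" "p \<in> topspace T"
      show "csqrt (r j p) \<noteq> 0" using rpos[OF jp] by auto
      show "w' p - y' j p = (csqrt (r j p))\<^sup>2 * (w p - y j p)"
        using near[OF jp] d by (auto simp: r_def)
    qed
    show "\<forall>p. (\<forall>j\<in>J. y' j p = y j p) \<longrightarrow> w' p = w p \<and> (\<forall>j\<in>J. csqrt (r j p) = 1)"
      using d by (auto simp: w'_def r_def)
  qed
qed

context compact_parameter begin

lemma compact_IK: "compact_space IK"
  by (auto simp: compact_space_prod_topology compact_K intro!: compact_space_subtopology)

lemma continuous_map_truncate:
  assumes "0 \<le> \<tau>" "\<tau> \<le> 1"
  shows "continuous_map IK IK (\<lambda>p. (min (fst p) \<tau>, snd p))"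
proof (rule continuous_map_pairedI)
  show "continuous_map IK (top_of_set {0..1}) (\<lambda>p. min (fst p) \<tau>)"
  proof -
    have "continuous_on UNIV (\<lambda>t. min t \<tau>)" by (intro continuous_intros)
    then have "continuous_map IK euclideanreal (\<lambda>p. min (fst p) \<tau>)"
      by (rule continuous_map_compose_on[OF continuous_map_IK_fst]) simp
    then show ?thesis using assms by (simp add: continuous_map_in_subtopology Pi_iff min_le_iff_disj)
  qed
qed (rule continuous_map_snd)

text \<open>On the compact set of all \<open>(s, t, x)\<close> where the values at \<open>(s, x)\<close> and \<open>(t, x)\<close> are at least \<open>e\<close> apart, the continuous
function \<open>\<bar>s - t\<bar>\<close> is positive and hence bounded away from \<open>0\<close>.\<close>
lemma uniform_in_time:
  fixes f :: "real \<times> 'k \<Rightarrow> complex"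
  assumes f: "continuous_map IK euclidean f" and e: "e > 0"
  obtains d where "d > 0" "\<forall>s\<in>{0..1}. \<forall>t\<in>{0..1}. \<forall>x\<in>topspace K. \<bar>s - t\<bar> < d \<longrightarrow> norm (f (s,x) - f (t,x)) < e"
proof -
  let ?Q = "prod_topology (top_of_set {0..1::real}) IK"
  have sub: "continuous_map ?Q IK (\<lambda>q. (fst q, snd (snd q)))"
  proof (rule continuous_map_pairedI)
    show "continuous_map ?Q K (\<lambda>q. snd (snd q))"
      using continuous_map_compose[OF continuous_map_snd[of "top_of_set {0..1::real}" IK] continuous_map_snd[of "top_of_set {0..1::real}" K]]
      by (simp add: o_def)
  qed (rule continuous_map_fst)
  have f1: "continuous_map ?Q euclidean (\<lambda>q. f (fst q, snd (snd q)))"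
    using continuous_map_compose[OF sub f] by (simp add: o_def)
  have f2: "continuous_map ?Q euclidean (\<lambda>q. f (snd q))"
    using continuous_map_compose[OF continuous_map_snd[of "top_of_set {0..1::real}" IK] f] by (simp add: o_def)
  have D: "continuous_map ?Q euclideanreal (\<lambda>q. norm (f (fst q, snd (snd q)) - f (snd q)))"
    by (rule continuous_map_compose_on2[OF f1 f2, where S=UNIV]) (auto intro!: continuous_intros)
  have g1: "continuous_map ?Q euclideanreal fst"
    using continuous_map_fst[of "top_of_set {0..1::real}" IK] by (simp add: continuous_map_in_subtopology)
  have g2: "continuous_map ?Q euclideanreal (\<lambda>q. fst (snd q))"
    using continuous_map_compose[OF continuous_map_snd[of "top_of_set {0..1::real}" IK] continuous_map_IK_fst] by (simp add: o_def)
  have G: "continuous_map ?Q euclideanreal (\<lambda>q. \<bar>fst q - fst (snd q)\<bar>)"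
    by (rule continuous_map_compose_on2[OF g1 g2, where S=UNIV]) (auto intro!: continuous_intros)
  define C where "C = {q \<in> topspace ?Q. norm (f (fst q, snd (snd q)) - f (snd q)) \<in> {e..}}"
  have "closedin ?Q C" unfolding C_def by (rule closedin_continuous_map_preimage[OF D]) auto
  moreover have "compact_space ?Q" using compact_IK by (auto simp: compact_space_prod_topology intro!: compact_space_subtopology)
  ultimately have cC: "compact_space (subtopology ?Q C)" by (simp add: closedin_compact_space compact_space_subtopology)
  obtain d where d: "d > 0" "\<forall>q\<in>topspace (subtopology ?Q C). \<bar>fst q - fst (snd q)\<bar> \<ge> d"
  proof (rule compact_space_positive_lower_bound[OF cC])
    show "continuous_map (subtopology ?Q C) euclideanreal (\<lambda>q. \<bar>fst q - fst (snd q)\<bar>)"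
      by (rule continuous_map_from_subtopology[OF G])
    show "\<bar>fst q - fst (snd q)\<bar> > 0" if "q \<in> topspace (subtopology ?Q C)" for q
      using that e by (auto simp: C_def)
  qed
  show ?thesis
  proof (rule that[OF d(1)], intro ballI impI, rule ccontr)
    fix s t x assume st: "s \<in> {0..1}" "t \<in> {0..1}" "x \<in> topspace K" "\<bar>s - t\<bar> < d" "\<not> norm (f (s,x) - f (t,x)) < e"
    then have "(s,(t,x)) \<in> topspace (subtopology ?Q C)" by (simp add: C_def)
    then show False using d(2) st by force
  qed
qed

end

lemma truncation_step:
  fixes t :: real
  assumes "N > 0"
  shows "\<bar>min t (real (Suc k) / real N) - min t (real k / real N)\<bar> \<le> 1 / real N"
proof -
  have min_add: "\<bar>min t (a + h) - min t a\<bar> \<le> h" if "h \<ge> 0" for a h :: real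
    using that by (auto simp: min_def)
  have eq: "real (Suc k) / real N = real k / real N + 1 / real N" by (simp add: add_divide_distrib)
  show ?thesis unfolding eq by (rule min_add) simp
qed

context compact_parameter begin

lemma continuous_map_truncated:
  assumes f: "continuous_map IK X f" and "0 \<le> \<tau>" "\<tau> \<le> 1"
  shows "continuous_map IK X (\<lambda>p. f (min (fst p) \<tau>, snd p))"
  using continuous_map_compose[OF continuous_map_truncate[OF assms(2,3)] f] by (simp add: o_def)

text \<open>Cut time into short steps. The quotient of the truncations of \<open>G\<close> at successive times stays in the right
half plane, so its principal logarithm is continuous and can be added to the logarithm built so far.
Replacing \<open>t\<close> by \<open>min t \<tau>\<close> makes each stage a map on the whole cylinder, so nothing has to
be glued.\<close>
lemma lift_logarithm:
  fixes G :: "real \<times> 'k \<Rightarrow> complex"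
  assumes G: "continuous_map IK euclidean G" and nz: "\<And>p. p \<in> topspace IK \<Longrightarrow> G p \<noteq> 0"
    and l: "continuous_map K euclidean l" and lG: "\<And>x. x \<in> topspace K \<Longrightarrow> exp (l x) = G (0,x)"
  obtains L where "continuous_map IK euclidean L" "\<forall>p\<in>topspace IK. exp (L p) = G p"
    "\<forall>x\<in>topspace K. L (0,x) = l x"
    "\<forall>x\<in>topspace K. (\<forall>t\<in>{0..1}. G (t,x) = G (0,x)) \<longrightarrow> (\<forall>t\<in>{0..1}. L (t,x) = l x)"
proof -
  have n: "continuous_map IK euclideanreal (\<lambda>p. norm (G p))"
    by (rule continuous_map_compose_on[OF G, where S=UNIV]) (auto intro!: continuous_intros)
  obtain m where m: "m > 0" "\<forall>p\<in>topspace IK. norm (G p) \<ge> m"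
    by (rule compact_space_positive_lower_bound[OF compact_IK n]) (use nz in auto)
  obtain d where d: "d > 0" "\<forall>s\<in>{0..1}. \<forall>t\<in>{0..1}. \<forall>x\<in>topspace K. \<bar>s - t\<bar> < d \<longrightarrow> norm (G (s,x) - G (t,x)) < m"
    by (rule uniform_in_time[OF G m(1)])
  obtain N where N: "N \<noteq> 0" "inverse (real N) < d" using d(1) real_arch_inverse by blast
  let ?\<tau> = "\<lambda>k. real k / real N"
  let ?G = "\<lambda>k p. G (min (fst p) (?\<tau> k), snd p)"
  have tau: "0 \<le> ?\<tau> k" "k \<le> N \<Longrightarrow> ?\<tau> k \<le> 1" for k by (auto simp: divide_le_eq_1)
  let ?P = "\<lambda>k L. continuous_map IK euclidean L \<and> (\<forall>p\<in>topspace IK. exp (L p) = ?G k p) \<and>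
      (\<forall>x\<in>topspace K. L (0,x) = l x) \<and>
      (\<forall>x\<in>topspace K. (\<forall>t\<in>{0..1}. G (t,x) = G (0,x)) \<longrightarrow> (\<forall>t\<in>{0..1}. L (t,x) = l x))"
  have "k \<le> N \<Longrightarrow> \<exists>L. ?P k L" for k
  proof (induction k)
    case 0
    show ?case
      by (intro exI[of _ "\<lambda>p. l (snd p)"] conjI continuous_map_IK_snd l) (auto simp: lG min_def)
  next
    case (Suc k)
    then have "\<exists>L. ?P k L" by simp
    then obtain L where P: "?P k L" by (elim exE)
    note L = P[THEN conjunct1] P[THEN conjunct2, THEN conjunct1] P[THEN conjunct2, THEN conjunct2, THEN conjunct1]
      P[THEN conjunct2, THEN conjunct2, THEN conjunct2]
    have G1: "continuous_map IK euclidean (?G k)" "continuous_map IK euclidean (?G (Suc k))"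
      using tau Suc.prems by (auto intro!: continuous_map_truncated G)
    have top: "(min (fst p) (?\<tau> j), snd p) \<in> topspace IK" if "p \<in> topspace IK" "j \<le> N" for p j
      using that tau[of j] by (auto simp: min_def)
    have nz1: "?G k p \<noteq> 0" if "p \<in> topspace IK" for p using nz top[OF that, of k] Suc.prems by simp
    have pos: "Re (?G (Suc k) p / ?G k p) > 0" if p: "p \<in> topspace IK" for p
    proof -
      have "\<bar>min (fst p) (?\<tau> (Suc k)) - min (fst p) (?\<tau> k)\<bar> < d"
        using truncation_step[of N "fst p" k] N by (simp add: inverse_eq_divide)
      then have "norm (?G (Suc k) p - ?G k p) < m"
        using d(2) top[OF p, of k] top[OF p, of "Suc k"] Suc.prems by simp
      also have "m \<le> norm (?G k p)" using m(2) top[OF p, of k] Suc.prems by simp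
      finally have lt: "norm (?G (Suc k) p - ?G k p) < norm (?G k p)" .
      have "?G (Suc k) p / ?G k p - 1 = (?G (Suc k) p - ?G k p) / ?G k p" using nz1[OF p] by (simp add: diff_divide_distrib)
      then have "norm (?G (Suc k) p / ?G k p - 1) = norm (?G (Suc k) p - ?G k p) / norm (?G k p)" by (simp only: norm_divide)
      also have "\<dots> < 1" using lt nz1[OF p] by (simp add: divide_simps)
      finally have "\<bar>Re (?G (Suc k) p / ?G k p - 1)\<bar> < 1" using abs_Re_le_cmod le_less_trans by blast
      then show ?thesis by simp
    qed
    let ?L = "\<lambda>p. L p + Ln (?G (Suc k) p / ?G k p)"
    have c: "continuous_map IK euclidean ?L"
    proof (rule continuous_map_add[OF L(1)])
      show "continuous_map IK euclidean (\<lambda>p. Ln (?G (Suc k) p / ?G k p))"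
      proof (rule continuous_map_compose_on[where S="{z. Re z > 0}" and f=Ln])
        show "continuous_map IK euclidean (\<lambda>p. ?G (Suc k) p / ?G k p)"
          using G1 nz1 by (intro continuous_map_divide_field) auto
        show "continuous_on {z. Re z > 0} Ln"
          by (intro continuous_at_imp_continuous_on ballI continuous_at_Ln) (auto simp: complex_nonpos_Reals_iff)
      qed (use pos in simp)
    qed
    have ex: "exp (?L p) = ?G (Suc k) p" if p: "p \<in> topspace IK" for p
    proof -
      have "?G (Suc k) p / ?G k p \<noteq> 0" using pos[OF p] by auto
      moreover have "exp (L p) = ?G k p" using L(2) p by (rule bspec)
      ultimately have "exp (?L p) = ?G k p * (?G (Suc k) p / ?G k p)" by (simp only: exp_add exp_Ln not_False_eq_True)
      then show ?thesis using nz1[OF p] by simp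
    qed
    have st: "?L (t,x) = l x" if "x \<in> topspace K" "\<forall>t\<in>{0..1}. G (t,x) = G (0,x)" "t \<in> {0..1}" for t x
    proof -
      have "min t (?\<tau> j) \<in> {0..1}" for j using that(3) tau(1)[of j] by (auto simp: min_le_iff_disj)
      then have G0: "G (min t (?\<tau> j), x) = G (0,x)" for j using that(2) by (rule bspec[rotated])
      have "L (t,x) = l x" using L(4) that by metis
      moreover have "G (0,x) \<noteq> 0" using nz[of "(0,x)"] that(1) by simp
      ultimately show ?thesis by (simp only: fst_conv snd_conv G0) simp
    qed
    show ?case
    proof (intro exI[of _ ?L] conjI ballI impI)
      show "?L (0,x) = l x" if "x \<in> topspace K" for x
        using L(3) that nz[of "(0,x)"] tau by (simp add: min_def)
      show "continuous_map IK euclidean ?L" by (rule c)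
      show "exp (?L p) = ?G (Suc k) p" if "p \<in> topspace IK" for p by (rule ex[OF that])
      show "?L (t,x) = l x" if "x \<in> topspace K" "\<forall>t\<in>{0..1}. G (t,x) = G (0,x)" "t \<in> {0..1}" for x t
        by (rule st[OF that])
    qed
  qed
  from this[OF order_refl] obtain L where P: "?P N L" by (elim exE)
  note L = P[THEN conjunct1] P[THEN conjunct2, THEN conjunct1] P[THEN conjunct2, THEN conjunct2, THEN conjunct1]
      P[THEN conjunct2, THEN conjunct2, THEN conjunct2]
  have "\<forall>p\<in>topspace IK. exp (L p) = G p" using L(2) N by (auto simp: min_def)
  from that[OF L(1) this L(3,4)] show ?thesis .
qed

text \<open>The single steps for the truncations of \<open>Y\<close> at successive times are composed, and the factors multiply. The
last clause says that \<open>w\<close> rests wherever all \<open>Y j\<close> rest; so a homotopy that is constant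
in time on some subset of \<open>K\<close> lifts to one with the same property.\<close>
lemma drag_point:
  fixes Y :: "'j \<Rightarrow> real \<times> 'k \<Rightarrow> complex"
  assumes J: "finite J" and Y: "\<And>j. j \<in> J \<Longrightarrow> continuous_map IK euclidean (Y j)"
    and dist: "\<And>i j p. \<lbrakk>i \<in> J; j \<in> J; i \<noteq> j; p \<in> topspace IK\<rbrakk> \<Longrightarrow> Y i p \<noteq> Y j p"
    and v: "continuous_map K euclidean v"
  obtains w s where "continuous_map IK euclidean w" "\<forall>j\<in>J. continuous_map IK euclidean (s j)"
    "\<forall>j\<in>J. \<forall>p\<in>topspace IK. s j p \<noteq> (0::complex) \<and> w p - Y j p = (s j p)\<^sup>2 * (v (snd p) - Y j (0, snd p))"
    "\<forall>x\<in>topspace K. w (0,x) = v x \<and> (\<forall>j\<in>J. s j (0,x) = 1)"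
    "\<forall>x\<in>topspace K. (\<forall>j\<in>J. \<forall>t\<in>{0..1}. Y j (t,x) = Y j (0,x)) \<longrightarrow> (\<forall>t\<in>{0..1}. w (t,x) = v x \<and> (\<forall>j\<in>J. s j (t,x) = 1))"
proof -
  obtain \<delta> where \<delta>: "\<delta> > 0" "\<forall>ij\<in>{ij \<in> J \<times> J. fst ij \<noteq> snd ij}. \<forall>p\<in>topspace IK. norm (Y (fst ij) p - Y (snd ij) p) \<ge> 3 * \<delta>"
  proof (rule min_of_finite_family[of "{ij \<in> J \<times> J. fst ij \<noteq> snd ij}" "\<lambda>ij d. \<forall>p\<in>topspace IK. norm (Y (fst ij) p - Y (snd ij) p) \<ge> 3 * d"])
    show "finite {ij \<in> J \<times> J. fst ij \<noteq> snd ij}" using J by auto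
    fix ij assume ij: "ij \<in> {ij \<in> J \<times> J. fst ij \<noteq> snd ij}"
    have c: "continuous_map IK euclideanreal (\<lambda>p. norm (Y (fst ij) p - Y (snd ij) p))"
      by (rule continuous_map_compose_on2[OF Y Y, where S=UNIV]) (use ij in \<open>auto intro!: continuous_intros\<close>)
    obtain m where m: "m > 0" "\<forall>p\<in>topspace IK. norm (Y (fst ij) p - Y (snd ij) p) \<ge> m"
      by (rule compact_space_positive_lower_bound[OF compact_IK c]) (use dist ij in auto)
    show "\<exists>d>0. \<forall>d'. 0 < d' \<and> d' \<le> d \<longrightarrow> (\<forall>p\<in>topspace IK. norm (Y (fst ij) p - Y (snd ij) p) \<ge> 3 * d')"
      by (intro exI[of _ "m / 3"] conjI allI impI ballI) (use m in force)+
  qed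
  define e where "e = \<delta> / (real (card J) + 1)"
  have e: "e > 0" "e * (real (card J) + 1) \<le> \<delta>" using \<delta>(1) by (auto simp: e_def add_pos_nonneg)
  obtain d where d: "d > 0" "\<forall>j\<in>J. \<forall>s\<in>{0..1}. \<forall>t\<in>{0..1}. \<forall>x\<in>topspace K. \<bar>s - t\<bar> < d \<longrightarrow> norm (Y j (s,x) - Y j (t,x)) < e"
  proof (rule min_of_finite_family[of J "\<lambda>j d. \<forall>s\<in>{0..1}. \<forall>t\<in>{0..1}. \<forall>x\<in>topspace K. \<bar>s - t\<bar> < d \<longrightarrow> norm (Y j (s,x) - Y j (t,x)) < e"])
    fix j assume j: "j \<in> J"
    obtain d where d: "d > 0" "\<forall>s\<in>{0..1}. \<forall>t\<in>{0..1}. \<forall>x\<in>topspace K. \<bar>s - t\<bar> < d \<longrightarrow> norm (Y j (s,x) - Y j (t,x)) < e"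
      by (rule uniform_in_time[OF Y[OF j] e(1)])
    show "\<exists>d>0. \<forall>d'. 0 < d' \<and> d' \<le> d \<longrightarrow> (\<forall>s\<in>{0..1}. \<forall>t\<in>{0..1}. \<forall>x\<in>topspace K. \<bar>s - t\<bar> < d' \<longrightarrow> norm (Y j (s,x) - Y j (t,x)) < e)"
      by (intro exI[of _ d]) (use d in force)
  qed (use J in auto)
  obtain N where N: "N \<noteq> 0" "inverse (real N) < d" using d(1) real_arch_inverse by blast
  let ?\<tau> = "\<lambda>k. real k / real N"
  let ?Y = "\<lambda>k j p. Y j (min (fst p) (?\<tau> k), snd p)"
  have tau: "0 \<le> ?\<tau> k" "k \<le> N \<Longrightarrow> ?\<tau> k \<le> 1" for k by (auto simp: divide_le_eq_1)
  let ?P = "\<lambda>k w s. continuous_map IK euclidean w \<and> (\<forall>j\<in>J. continuous_map IK euclidean (s j)) \<and>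
    (\<forall>j\<in>J. \<forall>p\<in>topspace IK. s j p \<noteq> (0::complex) \<and> w p - ?Y k j p = (s j p)\<^sup>2 * (v (snd p) - Y j (0, snd p))) \<and>
    (\<forall>x\<in>topspace K. w (0,x) = v x \<and> (\<forall>j\<in>J. s j (0,x) = 1)) \<and>
    (\<forall>x\<in>topspace K. (\<forall>j\<in>J. \<forall>t\<in>{0..1}. Y j (t,x) = Y j (0,x)) \<longrightarrow> (\<forall>t\<in>{0..1}. w (t,x) = v x \<and> (\<forall>j\<in>J. s j (t,x) = 1)))"
  have "k \<le> N \<Longrightarrow> \<exists>w s. ?P k w s" for k
  proof (induction k)
    case 0
    show ?case
      by (rule exI[of _ "\<lambda>p. v (snd p)"], rule exI[of _ "\<lambda>j p. 1"], intro conjI continuous_map_IK_snd v)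
         (auto simp: min_def)
  next
    case (Suc k)
    then have "\<exists>w s. ?P k w s" by simp
    then obtain w s where P: "?P k w s" by (elim exE)
    note ws = P[THEN conjunct1] P[THEN conjunct2, THEN conjunct1] P[THEN conjunct2, THEN conjunct2, THEN conjunct1]
       P[THEN conjunct2, THEN conjunct2, THEN conjunct2, THEN conjunct1]
      P[THEN conjunct2, THEN conjunct2, THEN conjunct2, THEN conjunct2]
    have top: "(min (fst p) (?\<tau> j), snd p) \<in> topspace IK" if "p \<in> topspace IK" "j \<le> N" for p j
      using that tau[of j] by (auto simp: min_def)
    have cY: "continuous_map IK euclidean (?Y i j)" if "j \<in> J" "i \<le> N" for i j
      using tau that by (intro continuous_map_truncated Y) auto
    have kN: "k \<le> N" "Suc k \<le> N" using Suc.prems by auto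
    have sep: "norm (?Y k i p - ?Y k j p) \<ge> 3 * \<delta>" if "i \<in> J" "j \<in> J" "i \<noteq> j" "p \<in> topspace IK" for i j p
      using bspec[OF \<delta>(2), of "(i,j)"] top[OF that(4) kN(1)] that by simp
    have close: "norm (?Y (Suc k) j p - ?Y k j p) < e" if "j \<in> J" "p \<in> topspace IK" for j p
    proof -
      have "\<bar>min (fst p) (?\<tau> (Suc k)) - min (fst p) (?\<tau> k)\<bar> < d"
        using truncation_step[of N "fst p" k] N by (simp add: inverse_eq_divide)
      then show ?thesis using d(2) top[OF that(2) kN(1)] top[OF that(2) kN(2)] that by simp
    qed
    obtain w' r where w': "continuous_map IK euclidean w'" "\<forall>j\<in>J. continuous_map IK euclidean (r j)"
      "\<forall>j\<in>J. \<forall>p\<in>topspace IK. r j p \<noteq> (0::complex) \<and> w' p - ?Y (Suc k) j p = (r j p)\<^sup>2 * (w p - ?Y k j p)"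
      "\<forall>p. (\<forall>j\<in>J. ?Y (Suc k) j p = ?Y k j p) \<longrightarrow> w' p = w p \<and> (\<forall>j\<in>J. r j p = 1)"
      by (rule drag_point_step[OF J cY cY ws(1) \<delta>(1) sep close e(2)]) (use kN in auto)
    show ?case
    proof (rule exI[of _ w'], rule exI[of _ "\<lambda>j p. r j p * s j p"], intro conjI)
      show "continuous_map IK euclidean w'" by fact
      show "\<forall>j\<in>J. continuous_map IK euclidean (\<lambda>p. r j p * s j p)"
        using w'(2) ws(2) by (auto intro: continuous_map_mult_field)
      show "\<forall>j\<in>J. \<forall>p\<in>topspace IK. r j p * s j p \<noteq> 0 \<and>
             w' p - ?Y (Suc k) j p = (r j p * s j p)\<^sup>2 * (v (snd p) - Y j (0, snd p))"
        using w'(3) ws(3) by (simp add: power_mult_distrib mult.assoc del: topspace_prod_topology)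
      show "\<forall>x\<in>topspace K. w' (0,x) = v x \<and> (\<forall>j\<in>J. r j (0,x) * s j (0,x) = 1)"
      proof
        fix x assume x: "x \<in> topspace K"
        have "\<forall>j\<in>J. ?Y (Suc k) j (0,x) = ?Y k j (0,x)" by (simp add: min_def)
        then show "w' (0,x) = v x \<and> (\<forall>j\<in>J. r j (0,x) * s j (0,x) = 1)" using w'(4) ws(4) x by simp
      qed
      show "\<forall>x\<in>topspace K. (\<forall>j\<in>J. \<forall>t\<in>{0..1}. Y j (t,x) = Y j (0,x)) \<longrightarrow>
          (\<forall>t\<in>{0..1}. w' (t,x) = v x \<and> (\<forall>j\<in>J. r j (t,x) * s j (t,x) = 1))"
      proof (intro ballI impI)
        fix x t assume x: "x \<in> topspace K" and st: "\<forall>j\<in>J. \<forall>t\<in>{0..1}. Y j (t,x) = Y j (0,x)" and t: "t \<in> {0..1::real}"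
        have m: "min t (?\<tau> i) \<in> {0..1}" for i using t tau(1)[of i] by (auto simp: min_le_iff_disj)
        have "Y j (min t (?\<tau> i), x) = Y j (0,x)" if "j \<in> J" for i j
          using bspec[OF bspec[OF st that] m] .
        then have "\<forall>j\<in>J. ?Y (Suc k) j (t,x) = ?Y k j (t,x)" by (simp del: of_nat_Suc)
        then have "w' (t,x) = w (t,x) \<and> (\<forall>j\<in>J. r j (t,x) = 1)" by (rule w'(4)[THEN spec, THEN mp])
        moreover have "w (t,x) = v x \<and> (\<forall>j\<in>J. s j (t,x) = 1)"
          by (rule ws(5)[THEN bspec, OF x, THEN mp, OF st, THEN bspec, OF t])
        ultimately show "w' (t,x) = v x \<and> (\<forall>j\<in>J. r j (t,x) * s j (t,x) = 1)" by simp
      qed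
    qed
  qed
  from this[OF order_refl] obtain w s where P: "?P N w s" by (elim exE)
  note ws = P[THEN conjunct1] P[THEN conjunct2, THEN conjunct1] P[THEN conjunct2, THEN conjunct2, THEN conjunct1]
       P[THEN conjunct2, THEN conjunct2, THEN conjunct2, THEN conjunct1]
      P[THEN conjunct2, THEN conjunct2, THEN conjunct2, THEN conjunct2]
  have "\<forall>j\<in>J. \<forall>p\<in>topspace IK. s j p \<noteq> 0 \<and> w p - Y j p = (s j p)\<^sup>2 * (v (snd p) - Y j (0, snd p))"
  proof (intro ballI)
    fix j p assume jp: "j \<in> J" "p \<in> topspace IK"
    have "(min (fst p) (?\<tau> N), snd p) = p" using jp(2) N by (auto simp: min_def)
    then show "s j p \<noteq> 0 \<and> w p - Y j p = (s j p)\<^sup>2 * (v (snd p) - Y j (0, snd p))"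
      using ws(3)[THEN bspec, OF jp(1), THEN bspec, OF jp(2)] by simp
  qed
  from that[OF ws(1,2) this ws(4,5)] show ?thesis .
qed

end

section \<open>Punctured planes and configuration spaces\<close>

definition configurations :: "'j set \<Rightarrow> ('j \<Rightarrow> complex) set" where
  "configurations J = {y. inj_on y J \<and> (\<forall>i. i \<notin> J \<longrightarrow> y i = 0)}"

context logarithmic_pair begin

lemma homotopic_rel_A_compose:
  assumes g: "homotopic_with (\<lambda>h. \<forall>t\<in>A. h t = z0) K Y g g'" and \<phi>: "continuous_map Y X \<phi>"
  shows "homotopic_with (\<lambda>h. \<forall>t\<in>A. h t = \<phi> z0) K X (\<lambda>x. \<phi> (g x)) (\<lambda>x. \<phi> (g' x))"
proof -
  obtain H where H: "continuous_map IK Y H" "\<forall>x. H (0,x) = g x" "\<forall>x. H (1,x) = g' x"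
    "\<forall>t\<in>{0..1}. \<forall>x\<in>A. H (t,x) = z0" by (rule homotopic_rel_A_E[OF g])
  have "continuous_map IK X (\<lambda>p. \<phi> (H p))"
    using continuous_map_compose[OF H(1) \<phi>] by (simp add: o_def)
  then show ?thesis by (rule homotopic_rel_A_I) (use H in auto)
qed

text \<open>Multiplication by a number \<open>u\<close> puts the special points at different heights and leaves the
ratios unchanged.\<close>
lemma rel_aspherical_fiber:
  fixes I :: "'i set"
  assumes P: "finite P" and I: "finite I" and q: "inj_on q I" "\<And>i. i \<in> I \<Longrightarrow> q i \<notin> P" and b: "I = {} \<or> b \<in> P"
  shows "rel_aspherical K A (top_of_set (branched_cover P I (\<lambda>i z. (q i - z) / (b - z))))"
proof -
  have "finite (P \<union> q ` I)" using P I by simp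
  then obtain u where u: "u \<noteq> 0" "inj_on (\<lambda>z. Im (u * z)) (P \<union> q ` I)" by (rule generic_rotation)
  define P' where "P' = (*) u ` P"
  let ?F' = "\<lambda>i z. (u * q i - z) / (u * b - z)"
  interpret hc: horizontal_cuts P' I "\<lambda>i. u * q i" "\<lambda>i z. 1 / (z - u * b)" ?F'
  proof
    show "finite P'" "finite I" using P I by (auto simp: P'_def)
    show "(u * q i - z) / (u * b - z) = (z - u * q i) * (1 / (z - u * b))" for i z
      using minus_divide_divide[of "z - u * q i" "z - u * b"] by simp
    have nb: "z \<noteq> u * b" if "i \<in> I" "z \<notin> P'" for i z using b that by (auto simp: P'_def)
    then show "continuous_on (- P') (\<lambda>z. 1 / (z - u * b))" if "i \<in> I" for i
      using that by (intro continuous_intros) auto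
    show "1 / (z - u * b) \<noteq> 0" if "i \<in> I" "z \<notin> P'" for i z using nb[OF that] by simp
    show "u * q i \<notin> P'" if "i \<in> I" for i using q(2)[OF that] u(1) by (auto simp: P'_def)
    show "inj_on (\<lambda>i. u * q i) I" using q(1) u(1) by (auto simp: inj_on_def)
    have "P' \<union> (\<lambda>i. u * q i) ` I = (*) u ` (P \<union> q ` I)" by (auto simp: P'_def)
    moreover have "inj_on Im ((*) u ` (P \<union> q ` I))" using u(2) by (auto simp: inj_on_def)
    ultimately show "inj_on Im (P' \<union> (\<lambda>i. u * q i) ` I)" by simp
  qed
  have ratio: "(u * q i - u * z) / (u * b - u * z) = (q i - z) / (b - z)" for i z
  proof -
    have "(u * q i - u * z) / (u * b - u * z) = (u * (q i - z)) / (u * (b - z))" by (simp add: right_diff_distrib)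
    then show ?thesis using u(1) by simp
  qed
  let ?E = "branched_cover P I (\<lambda>i z. (q i - z) / (b - z))"
  show ?thesis
  proof (rule rel_aspherical_retract[OF hc.rel_aspherical_branched_cover])
    show "logarithmic_pair K A" by (rule logarithmic_pair_axioms)
    have "continuous_on ?E (\<lambda>x. (u * fst x, snd x))" by (intro continuous_intros)
    moreover have "(u * fst x, snd x) \<in> hc.E" if "x \<in> ?E" for x
      using that u(1) by (auto simp: branched_cover_def P'_def ratio)
    ultimately show "continuous_map (top_of_set ?E) (top_of_set hc.E) (\<lambda>x. (u * fst x, snd x))" by auto
    have "continuous_on hc.E (\<lambda>x. (fst x / u, snd x))" using u(1) by (intro continuous_intros) auto
    moreover have "(fst x / u, snd x) \<in> ?E" if "x \<in> hc.E" for x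
    proof -
      have "fst x = u * (fst x / u)" using u(1) by simp
      then have "(u * q i - fst x) / (u * b - fst x) = (q i - fst x / u) / (b - fst x / u)" for i using ratio by metis
      moreover have "fst x / u \<notin> P"
        using imageI[of "fst x / u" P "(*) u"] that u(1) by (auto simp: branched_cover_def P'_def)
      ultimately show ?thesis using that by (auto simp: branched_cover_def)
    qed
    ultimately show "continuous_map (top_of_set hc.E) (top_of_set ?E) (\<lambda>x. (fst x / u, snd x))" by auto
    show "(fst (u * fst x, snd x) / u, snd (u * fst x, snd x)) = x" for x :: "complex \<times> ('i \<Rightarrow> complex)" using u(1) by simp
  qed
qed

lemma rel_aspherical_punctured_plane:
  assumes P: "finite P"
  shows "rel_aspherical K A (top_of_set (- P :: complex set))"
proof (rule rel_aspherical_retract[OF rel_aspherical_fiber[OF P, of "{}::unit set" "\<lambda>_. 0" 0]])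
  let ?E = "branched_cover P ({}::unit set) (\<lambda>i z. (0 - z) / (0 - z))"
  show "continuous_map (top_of_set (- P)) (top_of_set ?E) (\<lambda>z. (z, \<lambda>_. 0))"
    by (auto simp: branched_cover_def intro!: continuous_intros)
  show "continuous_map (top_of_set ?E) (top_of_set (- P)) fst"
    by (auto simp: branched_cover_def intro!: continuous_intros)
qed auto

text \<open>Induction on the number of points. The homotopy of the points in \<open>J\<close> to a constant configuration is lifted by dragging the
additional point. What remains is a map into the plane punctured at that constant configuration.\<close>
theorem rel_aspherical_configurations:
  assumes "finite (J :: 'j set)"
  shows "rel_aspherical K A (top_of_set (configurations J))"
  using assms
proof (induction rule: finite_induct)
  case empty
  show ?case unfolding rel_aspherical_def
  proof (intro allI impI, elim conjE)
    fix f and x0 :: "'j \<Rightarrow> complex"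
    assume f: "continuous_map K (top_of_set (configurations {})) f" and fA: "\<forall>t\<in>A. f t = x0"
    have single: "y = (\<lambda>_. 0)" if "y \<in> configurations {}" for y :: "'j \<Rightarrow> complex" using that by (auto simp: configurations_def)
    have f0: "f x = (\<lambda>_. 0)" if "x \<in> topspace K" for x
      by (rule single[OF continuous_map_top_of_setD(2)[OF f that]])
    obtain a where a: "a \<in> A" using nonempty_A by auto
    then have "x0 = f a" "a \<in> topspace K" using fA A_subset by auto
    then have "f x = x0" if "x \<in> topspace K" for x using f0 that by simp
    then show "homotopic_with (\<lambda>h. \<forall>t\<in>A. h t = x0) K (top_of_set (configurations {})) f (\<lambda>_. x0)"
      using fA f by (intro homotopic_with_equal) auto
  qed
next
  case (insert j J)
  let ?C = "configurations (insert j J)"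
  show ?case unfolding rel_aspherical_def
  proof (intro allI impI, elim conjE)
    fix f and x0 :: "'j \<Rightarrow> complex"
    assume f: "continuous_map K (top_of_set ?C) f" and fA: "\<forall>t\<in>A. f t = x0"
    note f' = continuous_map_top_of_setD[OF f]
    obtain a where a: "a \<in> A" using nonempty_A by auto
    then have "f a = x0" "a \<in> topspace K" using fA A_subset by auto
    then have x0: "x0 \<in> ?C" using f'(2)[of a] by simp
    let ?r = "\<lambda>y::'j \<Rightarrow> complex. y(j := 0)"
    have r: "continuous_map (top_of_set ?C) (top_of_set (configurations J)) ?r"
    proof (rule continuous_map_top_of_setI)
      show "continuous_map (top_of_set ?C) euclidean ?r"
      proof (rule continuous_map_euclidean_funI)
        show "continuous_map (top_of_set ?C) euclidean (\<lambda>y. (y(j := 0)) i)" for i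
          by (cases "i = j") (auto intro!: continuous_on_product_then_coordinatewise[OF continuous_on_id])
      qed
      show "?r y \<in> configurations J" if "y \<in> topspace (top_of_set ?C)" for y
        using that insert.hyps(2) by (auto simp: configurations_def inj_on_def)
    qed
    have "continuous_map K (top_of_set (configurations J)) (\<lambda>x. ?r (f x))"
      using continuous_map_compose[OF f r] by (simp add: o_def)
    then have "homotopic_with (\<lambda>h. \<forall>t\<in>A. h t = ?r x0) K (top_of_set (configurations J)) (\<lambda>x. ?r (f x)) (\<lambda>_. ?r x0)"
      using insert.IH fA unfolding rel_aspherical_def by simp
    then obtain H where H: "continuous_map IK (top_of_set (configurations J)) H" "\<forall>x. H (0,x) = ?r (f x)" "\<forall>x. H (1,x) = ?r x0"
      "\<forall>t\<in>{0..1}. \<forall>x\<in>A. H (t,x) = ?r x0" by (rule homotopic_rel_A_E)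
    note H' = continuous_map_top_of_setD[OF H(1)]
    have cf: "continuous_map K euclidean (\<lambda>x. f x j)" by (rule continuous_map_euclidean_funD[OF f'(1)])
    have HY: "continuous_map IK euclidean (\<lambda>p. H p i)" for i by (rule continuous_map_euclidean_funD[OF H'(1)])
    have Hd: "H p i \<noteq> H p k" if "i \<in> J" "k \<in> J" "i \<noteq> k" "p \<in> topspace IK" for i k p
      using H'(2)[OF that(4)] that by (auto simp: configurations_def inj_on_def)
    obtain w s where ws: "continuous_map IK euclidean w" "\<forall>i\<in>J. continuous_map IK euclidean (s i)"
      "\<forall>i\<in>J. \<forall>p\<in>topspace IK. s i p \<noteq> (0::complex) \<and> w p - H p i = (s i p)\<^sup>2 * (f (snd p) j - H (0, snd p) i)"
      "\<forall>x\<in>topspace K. w (0,x) = f x j \<and> (\<forall>i\<in>J. s i (0,x) = 1)"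
      "\<forall>x\<in>topspace K. (\<forall>i\<in>J. \<forall>t\<in>{0..1}. H (t,x) i = H (0,x) i) \<longrightarrow> (\<forall>t\<in>{0..1}. w (t,x) = f x j \<and> (\<forall>i\<in>J. s i (t,x) = 1))"
      by (rule drag_point[OF insert.hyps(1) HY Hd cf])
    have wH: "w p \<noteq> H p i" if p: "p \<in> topspace IK" and i: "i \<in> J" for p i
    proof -
      have "f (snd p) \<in> ?C" using f'(2)[of "snd p"] p by auto
      then have "f (snd p) j \<noteq> f (snd p) i" using i insert.hyps(2) by (auto simp: configurations_def inj_on_def)
      moreover have "H (0, snd p) i = f (snd p) i" using H(2) i insert.hyps(2) by auto
      ultimately have "w p - H p i \<noteq> 0" using ws(3)[THEN bspec, OF i, THEN bspec, OF p] by simp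
      then show ?thesis by simp
    qed
    have Hj: "H p j = 0" if "p \<in> topspace IK" for p using H'(2)[OF that] insert.hyps(2) by (auto simp: configurations_def)
    let ?G = "\<lambda>p. (H p)(j := w p)"
    have G: "continuous_map IK (top_of_set ?C) ?G"
    proof (rule continuous_map_top_of_setI)
      show "continuous_map IK euclidean ?G"
      proof (rule continuous_map_euclidean_funI)
        show "continuous_map IK euclidean (\<lambda>p. ((H p)(j := w p)) i)" for i
          using ws(1) HY by (cases "i = j") auto
      qed
      show "?G p \<in> ?C" if p: "p \<in> topspace IK" for p
        using H'(2)[OF p] wH[OF p] insert.hyps(2) unfolding configurations_def
        by (auto simp: inj_on_def fun_upd_def) metis+
    qed
    have wA: "w (t,x) = x0 j" if "t \<in> {0..1}" "x \<in> A" for t x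
    proof -
      have x: "x \<in> topspace K" using that A_subset by blast
      have "\<forall>i\<in>J. \<forall>t\<in>{0..1}. H (t,x) i = H (0,x) i" using H(4) that by simp
      then have "w (t,x) = f x j" using ws(5)[THEN bspec, OF x] that(1) by blast
      then show ?thesis using fA that by simp
    qed
    have h1: "homotopic_with (\<lambda>h. \<forall>t\<in>A. h t = x0) K (top_of_set ?C) f (\<lambda>x. ?G (1,x))"
    proof (rule homotopic_rel_A_I[OF G])
      show "?G (0,x) = f x" if "x \<in> topspace K" for x using H(2) ws(4) that by (auto simp: fun_eq_iff)
      show "?G (t,x) = x0" if "t \<in> {0..1}" "x \<in> A" for t x using H(4) wA[OF that] that by (auto simp: fun_eq_iff)
    qed simp
    let ?P = "x0 ` J"
    have w1: "continuous_map K (top_of_set (- ?P)) (\<lambda>x. w (1,x))"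
    proof (rule continuous_map_top_of_setI)
      show "continuous_map K euclidean (\<lambda>x. w (1,x))"
        using continuous_map_o_Pair[OF ws(1), of 1] by (simp add: o_def)
      show "w (1,x) \<in> - ?P" if "x \<in> topspace K" for x
      proof -
        have "w (1,x) \<noteq> x0 i" if i: "i \<in> J" for i
        proof -
          have "i \<noteq> j" using i insert.hyps(2) by auto
          then have "H (1,x) i = x0 i" using H(3) by simp
          then show ?thesis using wH[of "(1,x)" i] i \<open>x \<in> topspace K\<close> by simp
        qed
        then show ?thesis by auto
      qed
    qed
    have h2: "homotopic_with (\<lambda>h. \<forall>t\<in>A. h t = x0 j) K (top_of_set (- ?P)) (\<lambda>x. w (1,x)) (\<lambda>_. x0 j)"
      using rel_aspherical_punctured_plane[of ?P] insert.hyps(1) w1 wA unfolding rel_aspherical_def by simp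
    have \<phi>: "continuous_map (top_of_set (- ?P)) (top_of_set ?C) (\<lambda>z. x0(j := z))"
    proof (rule continuous_map_top_of_setI)
      show "continuous_map (top_of_set (- ?P)) euclidean (\<lambda>z. x0(j := z))"
      proof (rule continuous_map_euclidean_funI)
        show "continuous_map (top_of_set (- ?P)) euclidean (\<lambda>z. (x0(j := z)) i)" for i
          by (cases "i = j") (auto intro!: continuous_intros)
      qed
      show "x0(j := z) \<in> ?C" if "z \<in> topspace (top_of_set (- ?P))" for z
        using x0 that unfolding configurations_def by (auto simp: inj_on_def)
    qed
    have "homotopic_with (\<lambda>h. \<forall>t\<in>A. h t = x0) K (top_of_set ?C) (\<lambda>x. x0(j := w (1,x))) (\<lambda>_. x0)"
      using homotopic_rel_A_compose[OF h2 \<phi>] by simp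
    moreover have "(\<lambda>x. ?G (1,x)) = (\<lambda>x. x0(j := w (1,x)))" using H(3) by (auto simp: fun_eq_iff)
    ultimately show "homotopic_with (\<lambda>h. \<forall>t\<in>A. h t = x0) K (top_of_set ?C) f (\<lambda>_. x0)"
      using homotopic_with_trans[OF h1] by simp
  qed
qed

end

section \<open>Reduction to hyperplane complements\<close>

text \<open>The elements with \<open>z = 0\<close> and \<open>y None = 1\<close> form a copy of \<open>B_type_complement\<close>, and all of them
arise from these by affine maps of the plane. For \<open>z = y (Some i)\<close> the root \<open>c i\<close> is \<open>0\<close>.\<close>
definition quadric_family :: "(('n option \<Rightarrow> complex) \<times> complex \<times> ('n \<Rightarrow> complex)) set" where
  "quadric_family = {(y, z, c). inj y \<and> z \<noteq> y None \<and>
     (\<forall>i. (c i)\<^sup>2 = (y (Some i) - z) / (y None - z))}"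

text \<open>The complement of the hyperplanes \<open>c\<^sub>i = \<plusminus>c\<^sub>j\<close> and \<open>c\<^sub>i = \<plusminus>1\<close>.\<close>
definition B_type_complement :: "(complex ^ 'n) set" where
  "B_type_complement = {c. (\<forall>i j. i \<noteq> j \<longrightarrow> (c $ i)\<^sup>2 \<noteq> (c $ j)\<^sup>2) \<and> (\<forall>i. (c $ i)\<^sup>2 \<noteq> 1)}"

context logarithmic_pair begin

text \<open>The configuration \<open>y\<close> is contracted first while \<open>z\<close> is dragged along. The factors by which the differences
\<open>z - y j\<close> change are squares, and their roots transport the \<open>c i\<close>. Then everything happens in one fibre, which is a
branched cover of the plane punctured at \<open>y None\<close>.\<close>
theorem rel_aspherical_quadric_family:
  "rel_aspherical K A (top_of_set (quadric_family :: (('n::finite option \<Rightarrow> complex) \<times> complex \<times> ('n \<Rightarrow> complex)) set))"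
  unfolding rel_aspherical_def
proof (intro allI impI, elim conjE)
  let ?Z = "quadric_family :: (('n option \<Rightarrow> complex) \<times> complex \<times> ('n \<Rightarrow> complex)) set"
  fix f and x0 :: "('n option \<Rightarrow> complex) \<times> complex \<times> ('n \<Rightarrow> complex)"
  assume f: "continuous_map K (top_of_set ?Z) f" and fA: "\<forall>t\<in>A. f t = x0"
  note f' = continuous_map_top_of_setD[OF f]
  obtain a where a: "a \<in> A" using nonempty_A by auto
  then have "f a = x0" "a \<in> topspace K" using fA A_subset by auto
  then have x0: "x0 \<in> ?Z" using f'(2)[of a] by simp
  define b where "b = fst x0"
  have c_fst: "continuous_map K euclidean (\<lambda>x. fst (f x))"
    by (rule continuous_map_compose_on[OF f'(1), where S=UNIV])
       (intro continuous_on_fst continuous_on_snd continuous_on_id, simp)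
  have c_v: "continuous_map K euclidean (\<lambda>x. fst (snd (f x)))"
    by (rule continuous_map_compose_on[OF f'(1), where S=UNIV])
       (intro continuous_on_fst continuous_on_snd continuous_on_id, simp)
  have "continuous_map K euclidean (\<lambda>x. snd (snd (f x)))"
    by (rule continuous_map_compose_on[OF f'(1), where S=UNIV])
       (intro continuous_on_fst continuous_on_snd continuous_on_id, simp)
  then have c_c: "continuous_map K euclidean (\<lambda>x. snd (snd (f x)) i)" for i by (rule continuous_map_euclidean_funD)
  have "continuous_map K (top_of_set (configurations UNIV)) (\<lambda>x. fst (f x))"
    by (rule continuous_map_top_of_setI[OF c_fst]) (use f'(2) in \<open>force simp: configurations_def quadric_family_def\<close>)
  then have "homotopic_with (\<lambda>h. \<forall>t\<in>A. h t = b) K (top_of_set (configurations UNIV)) (\<lambda>x. fst (f x)) (\<lambda>_. b)"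
    using rel_aspherical_configurations[of "UNIV :: 'n option set"] fA unfolding rel_aspherical_def b_def by simp
  then obtain H where H: "continuous_map IK (top_of_set (configurations UNIV)) H" "\<forall>x. H (0,x) = fst (f x)" "\<forall>x. H (1,x) = b"
      "\<forall>t\<in>{0..1}. \<forall>x\<in>A. H (t,x) = b" by (rule homotopic_rel_A_E)
  note H' = continuous_map_top_of_setD[OF H(1)]
  have HY: "continuous_map IK euclidean (\<lambda>p. H p i)" for i by (rule continuous_map_euclidean_funD[OF H'(1)])
  have inj: "inj (H p)" if "p \<in> topspace IK" for p using H'(2)[OF that] by (simp add: configurations_def)
  have Hd: "H p i \<noteq> H p k" if "i \<in> UNIV" "k \<in> UNIV" "i \<noteq> k" "p \<in> topspace IK" for i k p
    using inj[OF that(4)] that(3) by (auto dest: injD)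
  obtain w s where ws: "continuous_map IK euclidean w" "\<forall>i\<in>UNIV. continuous_map IK euclidean (s i)"
      "\<forall>i\<in>UNIV. \<forall>p\<in>topspace IK. s i p \<noteq> (0::complex) \<and> w p - H p i = (s i p)\<^sup>2 * (fst (snd (f (snd p))) - H (0, snd p) i)"
      "\<forall>x\<in>topspace K. w (0,x) = fst (snd (f x)) \<and> (\<forall>i\<in>UNIV. s i (0,x) = 1)"
      "\<forall>x\<in>topspace K. (\<forall>i\<in>UNIV. \<forall>t\<in>{0..1}. H (t,x) i = H (0,x) i) \<longrightarrow> (\<forall>t\<in>{0..1}. w (t,x) = fst (snd (f x)) \<and> (\<forall>i\<in>UNIV. s i (t,x) = 1))"
    by (rule drag_point[OF finite HY Hd c_v])
  define c where "c p i = snd (snd (f (snd p))) i * s (Some i) p / s None p" for p i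
  have s0: "s i p \<noteq> 0" if "p \<in> topspace IK" for i p using ws(3) that by blast
  have c: "continuous_map IK euclidean c"
  proof (rule continuous_map_euclidean_funI)
    show "continuous_map IK euclidean (\<lambda>p. c p i)" for i
      unfolding c_def using ws(2) s0
      by (intro continuous_map_divide_field continuous_map_mult_field continuous_map_IK_snd[OF c_c]) auto
  qed
  let ?G = "\<lambda>p. (H p, w p, c p)"
  have G: "continuous_map IK (top_of_set ?Z) ?G"
  proof (rule continuous_map_top_of_setI)
    show "continuous_map IK euclidean ?G"
      by (intro continuous_map_euclidean_PairI H'(1) ws(1) c)
    fix p assume p: "p \<in> topspace IK"
    have fp: "f (snd p) \<in> ?Z" using f'(2)[of "snd p"] p by auto
    define v where "v = fst (snd (f (snd p)))"
    define y where "y = fst (f (snd p))"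
    have vy: "v \<noteq> y None" "\<And>i. (snd (snd (f (snd p))) i)\<^sup>2 = (y (Some i) - v) / (y None - v)"
      using fp by (auto simp: quadric_family_def v_def y_def)
    have wH: "w p - H p i = (s i p)\<^sup>2 * (v - y i)" for i
      using ws(3)[THEN bspec, OF UNIV_I, THEN bspec, OF p] H(2) by (simp add: v_def y_def)
    have "w p \<noteq> H p None" using wH[of None] s0[OF p] vy(1) by auto
    moreover have "(c p i)\<^sup>2 = (H p (Some i) - w p) / (H p None - w p)" for i
    proof -
      have "(H p (Some i) - w p) / (H p None - w p) = (w p - H p (Some i)) / (w p - H p None)"
        using minus_divide_divide[of "w p - H p (Some i)" "w p - H p None"] by simp
      also have "\<dots> = (s (Some i) p / s None p)\<^sup>2 * ((v - y (Some i)) / (v - y None))"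
        by (simp add: wH power_divide)
      also have "(v - y (Some i)) / (v - y None) = (y (Some i) - v) / (y None - v)"
        using minus_divide_divide[of "v - y (Some i)" "v - y None"] by simp
      finally show ?thesis using vy(2)[of i] by (simp add: c_def power_mult_distrib power_divide mult.commute)
    qed
    ultimately show "?G p \<in> ?Z" using inj[OF p] by (simp add: quadric_family_def)
  qed
  have st: "w (t,x) = fst (snd x0)" "c (t,x) = snd (snd x0)" if "t \<in> {0..1}" "x \<in> A" for t x
  proof -
    have x: "x \<in> topspace K" using that A_subset by blast
    have "\<forall>i\<in>UNIV. \<forall>t\<in>{0..1}. H (t,x) i = H (0,x) i" using H(4) that by simp
    then have *: "w (t,x) = fst (snd (f x)) \<and> (\<forall>i\<in>UNIV. s i (t,x) = 1)"
      using ws(5)[THEN bspec, OF x] that(1) by blast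
    then show "w (t,x) = fst (snd x0)" using fA that by simp
    show "c (t,x) = snd (snd x0)" using * fA that by (auto simp: c_def fun_eq_iff)
  qed
  have h1: "homotopic_with (\<lambda>h. \<forall>t\<in>A. h t = x0) K (top_of_set ?Z) f (\<lambda>x. ?G (1,x))"
  proof (rule homotopic_rel_A_I[OF G])
    show "?G (0,x) = f x" if "x \<in> topspace K" for x
      using H(2) ws(4) that by (simp add: prod_eq_iff fun_eq_iff c_def)
    show "?G (t,x) = x0" if "t \<in> {0..1}" "x \<in> A" for t x
      using H(4) st[OF that] that by (simp add: prod_eq_iff b_def)
  qed simp
  let ?E = "branched_cover {b None} UNIV (\<lambda>i z. (b (Some i) - z) / (b None - z))"
  have fib: "continuous_map K (top_of_set ?E) (\<lambda>x. (w (1,x), c (1,x)))"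
  proof (rule continuous_map_top_of_setI)
    show "continuous_map K euclidean (\<lambda>x. (w (1,x), c (1,x)))"
      using continuous_map_o_Pair[OF ws(1), of 1] continuous_map_o_Pair[OF c, of 1]
      by (intro continuous_map_euclidean_PairI) (simp_all add: o_def)
    show "(w (1,x), c (1,x)) \<in> ?E" if "x \<in> topspace K" for x
    proof -
      have "?G (1,x) \<in> ?Z" using continuous_map_top_of_setD(2)[OF G] that by simp
      then show ?thesis using H(3) by (simp add: quadric_family_def branched_cover_def)
    qed
  qed
  have "inj b" using x0 by (auto simp: b_def quadric_family_def)
  have "rel_aspherical K A (top_of_set ?E)"
    by (rule rel_aspherical_fiber) (use \<open>inj b\<close> in \<open>auto simp: inj_on_def\<close>)
  then have h2: "homotopic_with (\<lambda>h. \<forall>t\<in>A. h t = snd x0) K (top_of_set ?E) (\<lambda>x. (w (1,x), c (1,x))) (\<lambda>_. snd x0)"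
    by (rule rel_asphericalD[OF _ fib]) (use st in \<open>simp add: prod_eq_iff\<close>)
  have \<phi>: "continuous_map (top_of_set ?E) (top_of_set ?Z) (\<lambda>e. (b, e))"
  proof (rule continuous_map_top_of_setI)
    show "continuous_map (top_of_set ?E) euclidean (\<lambda>e. (b, e))" by (auto intro!: continuous_intros)
    show "(b, e) \<in> ?Z" if "e \<in> topspace (top_of_set ?E)" for e
      using that \<open>inj b\<close> by (auto simp: quadric_family_def branched_cover_def)
  qed
  have "homotopic_with (\<lambda>h. \<forall>t\<in>A. h t = x0) K (top_of_set ?Z) (\<lambda>x. (b, w (1,x), c (1,x))) (\<lambda>_. x0)"
    using homotopic_rel_A_compose[OF h2 \<phi>] by (simp add: b_def)
  moreover have "(\<lambda>x. ?G (1,x)) = (\<lambda>x. (b, w (1,x), c (1,x)))" using H(3) by simp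
  ultimately show "homotopic_with (\<lambda>h. \<forall>t\<in>A. h t = x0) K (top_of_set ?Z) f (\<lambda>_. x0)"
    using homotopic_with_trans[OF h1] by simp
qed

theorem rel_aspherical_B_type_complement:
  "rel_aspherical K A (top_of_set (B_type_complement :: (complex ^ 'n::finite) set))"
proof (rule rel_aspherical_retract[OF rel_aspherical_quadric_family])
  let ?Y = "B_type_complement :: (complex ^ 'n::finite) set"
  let ?Z = "quadric_family :: (('n option \<Rightarrow> complex) \<times> complex \<times> ('n \<Rightarrow> complex)) set"
  let ?p = "\<lambda>c::complex ^ 'n. (\<lambda>k. case k of None \<Rightarrow> 1 | Some i \<Rightarrow> (c $ i)\<^sup>2, 0::complex, \<lambda>i. c $ i)"
  let ?q = "\<lambda>x::('n option \<Rightarrow> complex) \<times> complex \<times> ('n \<Rightarrow> complex). \<chi> i. snd (snd x) i"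
  show "continuous_map (top_of_set ?Y) (top_of_set ?Z) ?p"
  proof (rule continuous_map_top_of_setI)
    have "continuous_on ?Y (\<lambda>c. case k of None \<Rightarrow> 1 | Some i \<Rightarrow> (c $ i)\<^sup>2)" for k
      by (cases k) (auto intro!: continuous_intros)
    then have "continuous_on ?Y ?p"
      by (intro continuous_on_Pair continuous_on_coordinatewise_then_product continuous_intros)
    then show "continuous_map (top_of_set ?Y) euclidean ?p" by simp
    show "?p c \<in> ?Z" if "c \<in> topspace (top_of_set ?Y)" for c
    proof -
      have d: "i = j" if "(c $ i)\<^sup>2 = (c $ j)\<^sup>2" for i j
        using that \<open>c \<in> topspace _\<close> by (auto simp: B_type_complement_def)
      have d1: "(c $ i)\<^sup>2 \<noteq> 1" "1 \<noteq> (c $ i)\<^sup>2" for i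
        using \<open>c \<in> topspace _\<close> by (auto simp: B_type_complement_def eq_commute[of 1])
      have "inj (\<lambda>k. case k of None \<Rightarrow> 1 | Some i \<Rightarrow> (c $ i)\<^sup>2)"
        by (rule injI) (auto simp: d1 dest: d split: option.splits)
      then show ?thesis by (simp add: quadric_family_def)
    qed
  qed
  show "continuous_map (top_of_set ?Z) (top_of_set ?Y) ?q"
  proof (rule continuous_map_top_of_setI)
    have "continuous_on ?Z (\<lambda>x. snd (snd x) i)" for i
      by (rule continuous_on_product_then_coordinatewise[where f="\<lambda>x. snd (snd x)"]) (intro continuous_intros)
    then show "continuous_map (top_of_set ?Z) euclidean ?q" by (simp add: continuous_on_vec_lambda)
    show "?q x \<in> ?Y" if "x \<in> topspace (top_of_set ?Z)" for x
    proof -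
      obtain y z c where x: "x = (y, z, c)" by (cases x)
      have *: "inj y" "z \<noteq> y None" "\<And>i. (c i)\<^sup>2 = (y (Some i) - z) / (y None - z)"
        using that x by (auto simp: quadric_family_def)
      have "(c i)\<^sup>2 \<noteq> (c j)\<^sup>2" if "i \<noteq> j" for i j
        using *(1,2) that unfolding *(3) by (auto dest: injD)
      moreover have "(c i)\<^sup>2 \<noteq> 1" for i
        using *(1,2) unfolding *(3) by (auto dest: injD)
      ultimately show ?thesis by (simp add: B_type_complement_def x)
    qed
  qed
  show "?q (?p c) = c" for c :: "complex ^ 'n" by (simp add: vec_eq_iff)
qed

text \<open>The inverse \<open>arccos h = - \<i> ln (h + \<i> sqrt (1 - h\<^sup>2))\<close> is continued along the homotopy. The root exists because \<open>1 - h\<^sup>2\<close>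
has no zero, and the outer logarithm because \<open>(h + \<i> s) (h - \<i> s) = 1\<close> when \<open>s\<^sup>2 = 1 - h\<^sup>2\<close>.\<close>
lemma lift_cos:
  fixes h :: "real \<times> 'k \<Rightarrow> complex"
  assumes h: "continuous_map IK euclidean h" and h1: "\<And>p. p \<in> topspace IK \<Longrightarrow> (h p)\<^sup>2 \<noteq> 1"
    and u: "continuous_map K euclidean u" and hu: "\<And>x. x \<in> topspace K \<Longrightarrow> h (0,x) = cos (of_real pi * u x)"
  obtains U where "continuous_map IK euclidean U" "\<forall>p\<in>topspace IK. cos (of_real pi * U p) = h p"
    "\<forall>x\<in>topspace K. U (0,x) = u x"
    "\<forall>x\<in>topspace K. (\<forall>t\<in>{0..1}. h (t,x) = h (0,x)) \<longrightarrow> (\<forall>t\<in>{0..1}. U (t,x) = u x)"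
proof -
  have su: "continuous_map K euclidean (\<lambda>x. sin (of_real pi * u x))"
    by (rule continuous_map_compose_on[OF u, where S=UNIV]) (auto intro!: continuous_intros)
  have snz: "sin (of_real pi * u x) \<noteq> 0" if "x \<in> topspace K" for x
  proof -
    have "(cos (of_real pi * u x))\<^sup>2 \<noteq> 1" using h1[of "(0,x)"] hu[OF that] that by simp
    then show ?thesis by (auto simp: cos_squared_eq)
  qed
  have "\<exists>l. continuous_map K euclidean l \<and> (\<forall>x\<in>topspace K. sin (of_real pi * u x) = exp (l x))"
    by (rule logarithm[OF su snz])
  then obtain l where l: "continuous_map K euclidean l" "\<forall>x\<in>topspace K. sin (of_real pi * u x) = exp (l x)"
    by (elim exE conjE)
  let ?G = "\<lambda>p. 1 - (h p)\<^sup>2"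
  have G: "continuous_map IK euclidean ?G"
    by (rule continuous_map_compose_on[OF h, where S=UNIV]) (auto intro!: continuous_intros)
  have l2: "continuous_map K euclidean (\<lambda>x. 2 * l x)"
    by (rule continuous_map_compose_on[OF l(1), where S=UNIV]) (auto intro!: continuous_intros)
  have e2: "exp (2 * l x) = ?G (0,x)" if "x \<in> topspace K" for x
  proof -
    have "exp (2 * l x) = (sin (of_real pi * u x))\<^sup>2" using l(2) that by (simp add: exp_double)
    then show ?thesis using hu[OF that] by (simp add: sin_squared_eq)
  qed
  have Gnz: "?G p \<noteq> 0" if "p \<in> topspace IK" for p using h1[OF that] by simp
  obtain L where L: "continuous_map IK euclidean L" "\<forall>p\<in>topspace IK. exp (L p) = ?G p"
    "\<forall>x\<in>topspace K. L (0,x) = 2 * l x"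
    "\<forall>x\<in>topspace K. (\<forall>t\<in>{0..1}. ?G (t,x) = ?G (0,x)) \<longrightarrow> (\<forall>t\<in>{0..1}. L (t,x) = 2 * l x)"
    by (rule lift_logarithm[OF G Gnz l2 e2])
  define S where "S p = exp (L p / 2)" for p
  define W where "W p = h p + \<i> * S p" for p
  have S: "continuous_map IK euclidean S" unfolding S_def
    by (rule continuous_map_compose_on[OF L(1), where S=UNIV]) (auto intro!: continuous_intros)
  have W: "continuous_map IK euclidean W" unfolding W_def
    by (rule continuous_map_compose_on2[OF h S, where S=UNIV]) (auto intro!: continuous_intros)
  have S2: "(S p)\<^sup>2 = 1 - (h p)\<^sup>2" if "p \<in> topspace IK" for p
  proof -
    have "(S p)\<^sup>2 = exp (L p)" by (simp add: S_def flip: exp_double)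
    then show ?thesis using L(2)[THEN bspec, OF that] by simp
  qed
  have Wi: "W p * (h p - \<i> * S p) = 1" if "p \<in> topspace IK" for p
  proof -
    have "W p * (h p - \<i> * S p) = (h p)\<^sup>2 + (S p)\<^sup>2" by (simp add: W_def algebra_simps power2_eq_square)
    then show ?thesis using S2[OF that] by simp
  qed
  have S0: "S (0,x) = sin (of_real pi * u x)" if "x \<in> topspace K" for x
    using L(3) l(2) that by (simp add: S_def)
  have iu: "continuous_map K euclidean (\<lambda>x. \<i> * of_real pi * u x)"
    by (rule continuous_map_compose_on[OF u, where S=UNIV]) (auto intro!: continuous_intros)
  have eiu: "exp (\<i> * of_real pi * u x) = W (0,x)" if "x \<in> topspace K" for x
    using exp_Euler[of "of_real pi * u x"] S0[OF that] hu[OF that] by (simp add: W_def mult.assoc)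
  have Wnz: "W p \<noteq> 0" if "p \<in> topspace IK" for p using Wi[OF that] by auto
  obtain M where M: "continuous_map IK euclidean M" "\<forall>p\<in>topspace IK. exp (M p) = W p"
    "\<forall>x\<in>topspace K. M (0,x) = \<i> * of_real pi * u x"
    "\<forall>x\<in>topspace K. (\<forall>t\<in>{0..1}. W (t,x) = W (0,x)) \<longrightarrow> (\<forall>t\<in>{0..1}. M (t,x) = \<i> * of_real pi * u x)"
    by (rule lift_logarithm[OF W Wnz iu eiu])
  define U where "U p = M p / (\<i> * of_real pi)" for p
  have piU: "\<i> * (of_real pi * U p) = M p" for p by (simp add: U_def)
  show ?thesis
  proof (rule that[of U])
    show "continuous_map IK euclidean U" unfolding U_def
      by (rule continuous_map_compose_on[OF M(1), where S=UNIV]) (auto intro!: continuous_intros)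
    show "\<forall>p\<in>topspace IK. cos (of_real pi * U p) = h p"
    proof
      fix p assume p: "p \<in> topspace IK"
      have e: "exp (M p) = W p" using M(2) p by (rule bspec)
      have "W p \<noteq> 0" using Wnz[OF p] .
      then have "inverse (W p) = h p - \<i> * S p" using Wi[OF p] by (simp add: field_simps)
      then have "exp (- M p) = h p - \<i> * S p" by (simp add: exp_minus e)
      moreover have "cos (of_real pi * U p) = (exp (M p) + exp (- M p)) / 2"
        using cos_exp_eq[of "of_real pi * U p"] by (simp add: piU)
      ultimately show "cos (of_real pi * U p) = h p" by (simp add: e W_def)
    qed
    show "\<forall>x\<in>topspace K. U (0,x) = u x" using M(3) by (simp add: U_def)
    show "\<forall>x\<in>topspace K. (\<forall>t\<in>{0..1}. h (t,x) = h (0,x)) \<longrightarrow> (\<forall>t\<in>{0..1}. U (t,x) = u x)"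
    proof (intro ballI impI)
      fix x t assume x: "x \<in> topspace K" and st: "\<forall>t\<in>{0..1}. h (t,x) = h (0,x)" and t: "t \<in> {0..1::real}"
      have "\<forall>t\<in>{0..1}. ?G (t,x) = ?G (0,x)"
      proof
        fix r :: real assume "r \<in> {0..1}"
        with st have "h (r,x) = h (0,x)" by (rule bspec)
        then show "?G (r,x) = ?G (0,x)" by (rule arg_cong)
      qed
      then have Lx: "\<forall>t\<in>{0..1}. L (t,x) = 2 * l x" by (rule L(4)[THEN bspec, OF x, THEN mp])
      have "\<forall>t\<in>{0..1}. W (t,x) = W (0,x)"
      proof
        fix r :: real assume r: "r \<in> {0..1}"
        have "h (r,x) = h (0,x)" using st r by (rule bspec)
        moreover have "L (r,x) = L (0,x)" using bspec[OF Lx r] L(3) x by simp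
        ultimately show "W (r,x) = W (0,x)" by (simp only: W_def S_def)
      qed
      then have "\<forall>t\<in>{0..1}. M (t,x) = \<i> * of_real pi * u x" by (rule M(4)[THEN bspec, OF x, THEN mp])
      then show "U (t,x) = u x" using t by (simp add: U_def)
    qed
  qed
qed

end

section \<open>The affine complement of type B\<close>

lemma sin_pi_eq_0_iff: "sin (of_real pi * w) = 0 \<longleftrightarrow> (w::complex) \<in> \<int>"
proof -
  have "sin (of_real pi * w) = 0 \<longleftrightarrow> (\<exists>n::int. of_real pi * w = of_real (of_int n * pi))"
    by (rule sin_eq_0)
  also have "\<dots> \<longleftrightarrow> (\<exists>n::int. w = of_int n)" by (simp add: mult.commute)
  finally show ?thesis by (auto elim: Ints_cases)
qed

lemma cos_squared_pi_eq_iff: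
  fixes a b :: complex
  shows "(cos (of_real pi * a))\<^sup>2 = (cos (of_real pi * b))\<^sup>2 \<longleftrightarrow> a + b \<in> \<int> \<or> a - b \<in> \<int>"
proof -
  let ?a = "of_real pi * a" and ?b = "of_real pi * b"
  have "sin (?a + ?b) * sin (?a - ?b) = (sin ?a * cos ?b)\<^sup>2 - (cos ?a * sin ?b)\<^sup>2"
    by (simp add: sin_add sin_diff algebra_simps power2_eq_square)
  also have "\<dots> = (cos ?b)\<^sup>2 - (cos ?a)\<^sup>2"
    by (simp add: power_mult_distrib sin_squared_eq algebra_simps)
  finally have "(cos ?a)\<^sup>2 = (cos ?b)\<^sup>2 \<longleftrightarrow> sin (?a + ?b) = 0 \<or> sin (?a - ?b) = 0"
    by (metis eq_iff_diff_eq_0 mult_eq_0_iff)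
  then show ?thesis
    using sin_pi_eq_0_iff[of "a + b"] sin_pi_eq_0_iff[of "a - b"] by (simp add: distrib_left right_diff_distrib)
qed

lemma affine_B_complement_iff:
  "u \<in> affine_B_complement \<longleftrightarrow> (\<chi> i. cos (of_real pi * u $ i)) \<in> B_type_complement"
proof -
  have "(cos (of_real pi * w))\<^sup>2 = 1 \<longleftrightarrow> w \<in> \<int>" for w :: complex
    using sin_pi_eq_0_iff[of w] by (simp add: cos_squared_eq)
  then show ?thesis
    unfolding affine_B_complement_def B_type_complement_def by (simp add: cos_squared_pi_eq_iff)
qed

lemma countable_cos_pi_eq: "countable {z::complex. cos (of_real pi * z) = w}"
proof (cases "\<exists>z0. cos (of_real pi * z0) = w")
  case True
  then obtain z0 where z0: "cos (of_real pi * z0) = w" by auto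
  show ?thesis
  proof (rule countable_subset)
    show "{z. cos (of_real pi * z) = w} \<subseteq> (\<lambda>(n::int, s). s * z0 + of_int (2 * n)) ` (UNIV \<times> {1, -1})"
    proof
      fix z assume "z \<in> {z. cos (of_real pi * z) = w}"
      then have "cos (of_real pi * z) = cos (of_real pi * z0)" using z0 by simp
      then obtain n where nZ: "n \<in> \<int>" and n: "of_real pi * z = of_real pi * z0 + of_real (2 * n * pi) \<or> of_real pi * z = - (of_real pi * z0) + of_real (2 * n * pi)"
        unfolding complex_cos_eq by auto
      from nZ obtain m :: int where "n = of_int m" by (rule Ints_cases)
      with n have "of_real pi * z = of_real pi * (z0 + of_int (2 * m)) \<or> of_real pi * z = of_real pi * (- z0 + of_int (2 * m))"
        by (simp add: algebra_simps)
      then have "z = z0 + of_int (2 * m) \<or> z = - z0 + of_int (2 * m)" by simp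
      then show "z \<in> (\<lambda>(n::int, s). s * z0 + of_int (2 * n)) ` (UNIV \<times> {1, -1})"
        by (auto intro: image_eqI[of _ _ "(m, 1)"] image_eqI[of _ _ "(m, -1)"])
    qed
  qed (intro countable_image countable_SIGMA; simp)
qed simp

context logarithmic_pair begin

text \<open>A contraction of the cosines is lifted to \<open>M\<close>. Its final map has constant cosines, so it
takes countably many values and is constant by connectedness, and its value is known on \<open>A\<close>.\<close>
theorem rel_aspherical_affine_B_complement:
  "rel_aspherical K A (top_of_set (affine_B_complement :: (complex ^ 'n::finite) set))"
  unfolding rel_aspherical_def
proof (intro allI impI, elim conjE)
  let ?M = "affine_B_complement :: (complex ^ 'n) set"
  let ?Y = "B_type_complement :: (complex ^ 'n) set"
  fix f and x0 :: "complex ^ 'n"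
  assume f: "continuous_map K (top_of_set ?M) f" and fA: "\<forall>t\<in>A. f t = x0"
  note f' = continuous_map_top_of_setD[OF f]
  let ?c = "\<lambda>u::complex ^ 'n. \<chi> i. cos (of_real pi * u $ i)"
  have cf: "continuous_map K (top_of_set ?Y) (\<lambda>x. ?c (f x))"
  proof (rule continuous_map_top_of_setI)
    show "continuous_map K euclidean (\<lambda>x. ?c (f x))"
      by (rule continuous_map_compose_on[OF f'(1), where S=UNIV]) (auto intro!: continuous_intros)
    show "?c (f x) \<in> ?Y" if "x \<in> topspace K" for x using f'(2)[OF that] by (simp add: affine_B_complement_iff)
  qed
  have fi: "continuous_map K euclidean (\<lambda>x. f x $ i)" for i
    by (rule continuous_map_compose_on[OF f'(1), where S=UNIV]) (auto intro!: continuous_intros)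
  have "homotopic_with (\<lambda>h. \<forall>t\<in>A. h t = ?c x0) K (top_of_set ?Y) (\<lambda>x. ?c (f x)) (\<lambda>_. ?c x0)"
    by (rule rel_asphericalD[OF rel_aspherical_B_type_complement cf]) (use fA in simp)
  then obtain H where H: "continuous_map IK (top_of_set ?Y) H" "\<forall>x. H (0,x) = ?c (f x)" "\<forall>x. H (1,x) = ?c x0"
      "\<forall>t\<in>{0..1}. \<forall>x\<in>A. H (t,x) = ?c x0" by (rule homotopic_rel_A_E)
  note H' = continuous_map_top_of_setD[OF H(1)]
  have Hi: "continuous_map IK euclidean (\<lambda>p. H p $ i)" for i
    by (rule continuous_map_compose_on[OF H'(1), where S=UNIV]) (auto intro!: continuous_intros)
  let ?Q = "\<lambda>i U. continuous_map IK euclidean U \<and> (\<forall>p\<in>topspace IK. cos (of_real pi * U p) = H p $ i) \<and>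
       (\<forall>x\<in>topspace K. U (0,x) = f x $ i) \<and> (\<forall>t\<in>{0..1}. \<forall>x\<in>A. U (t,x) = x0 $ i)"
  have "\<exists>U. ?Q i U" for i
  proof -
    have 1: "(H p $ i)\<^sup>2 \<noteq> 1" if "p \<in> topspace IK" for p using H'(2)[OF that] by (simp add: B_type_complement_def)
    have 2: "H (0,x) $ i = cos (of_real pi * f x $ i)" if "x \<in> topspace K" for x using H(2) by simp
    obtain U where U: "continuous_map IK euclidean U" "\<forall>p\<in>topspace IK. cos (of_real pi * U p) = H p $ i"
       "\<forall>x\<in>topspace K. U (0,x) = f x $ i"
       "\<forall>x\<in>topspace K. (\<forall>t\<in>{0..1}. H (t,x) $ i = H (0,x) $ i) \<longrightarrow> (\<forall>t\<in>{0..1}. U (t,x) = f x $ i)"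
      by (rule lift_cos[OF Hi 1 fi 2])
    have "\<forall>t\<in>{0..1}. \<forall>x\<in>A. U (t,x) = x0 $ i"
    proof (intro ballI)
      fix t :: real and x assume t: "t \<in> {0..1}" and x: "x \<in> A"
      have xK: "x \<in> topspace K" using x A_subset by blast
      have "H (r,x) = ?c x0" if "r \<in> {0..1}" for r using H(4) that x by simp
      then have "\<forall>t\<in>{0..1}. H (t,x) $ i = H (0,x) $ i" by simp
      then have "\<forall>t\<in>{0..1}. U (t,x) = f x $ i" by (rule U(4)[THEN bspec, OF xK, THEN mp])
      then show "U (t,x) = x0 $ i" using t fA x by simp
    qed
    with U(1,2,3) show ?thesis by (intro exI conjI)
  qed
  then have "\<forall>i. \<exists>U. ?Q i U" by (rule allI)
  then obtain U where "\<forall>i. ?Q i (U i)" by (rule choice[THEN exE])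
  then have U: "continuous_map IK euclidean (U i)" "\<forall>p\<in>topspace IK. cos (of_real pi * U i p) = H p $ i"
       "\<forall>x\<in>topspace K. U i (0,x) = f x $ i" "\<forall>t\<in>{0..1}. \<forall>x\<in>A. U i (t,x) = x0 $ i" for i by simp_all
  have UM: "continuous_map IK (top_of_set ?M) (\<lambda>p. \<chi> i. U i p)"
  proof (rule continuous_map_top_of_setI)
    have "continuous_map IK euclidean (\<lambda>p i. U i p)" by (rule continuous_map_euclidean_funI[OF U(1)])
    moreover have "continuous_on UNIV (\<lambda>y::'n \<Rightarrow> complex. \<chi> i. y i)"
      by (intro continuous_on_vec_lambda continuous_on_product_then_coordinatewise[where f="\<lambda>y. y"] continuous_on_id)
    ultimately show "continuous_map IK euclidean (\<lambda>p. \<chi> i. U i p)"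
      by (rule continuous_map_compose_on) simp
    show "(\<chi> i. U i p) \<in> ?M" if p: "p \<in> topspace IK" for p
    proof -
      have "cos (of_real pi * U i p) = H p $ i" for i using U(2) p by (rule bspec)
      then have "?c (\<chi> i. U i p) = H p" by (simp add: vec_eq_iff)
      then show ?thesis using H'(2)[OF p] by (simp add: affine_B_complement_iff)
    qed
  qed
  show "homotopic_with (\<lambda>h. \<forall>t\<in>A. h t = x0) K (top_of_set ?M) f (\<lambda>_. x0)"
  proof (rule homotopic_rel_A_I[OF UM])
    show "(\<chi> i. U i (0,x)) = f x" if "x \<in> topspace K" for x using U(3) that by (simp add: vec_eq_iff)
    show "(\<chi> i. U i (t,x)) = x0" if "t \<in> {0..1}" "x \<in> A" for t x using U(4) that by (simp add: vec_eq_iff)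
    show "(\<chi> i. U i (1,x)) = x0" if x: "x \<in> topspace K" for x
    proof -
      obtain a where a: "a \<in> A" using nonempty_A by auto
      then have aK: "a \<in> topspace K" using A_subset by blast
      have "U i (1,x) = U i (1,a)" for i
      proof (rule continuous_map_countable_range_constant[of K "topspace K" "\<lambda>x. U i (1,x)"])
        show "connectedin K (topspace K)" using connected_K by (simp add: connectedin_topspace)
        show "continuous_map (subtopology K (topspace K)) euclidean (\<lambda>x. U i (1,x))"
          using continuous_map_o_Pair[OF U(1), of 1 i] by (simp add: o_def)
        show "(\<lambda>x. U i (1,x)) ` topspace K \<subseteq> {z. cos (of_real pi * z) = ?c x0 $ i}"
          using U(2)[of i] H(3) by auto
      qed (use x aK countable_cos_pi_eq in auto)
      then show ?thesis using U(4) a by (simp add: vec_eq_iff)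
    qed
  qed
qed

end

lemma countable_affine_integer:
  fixes a b :: complex
  assumes "a \<notin> \<int>"
  shows "countable {z. a + z * b \<in> \<int>}"
proof (cases "b = 0")
  case True then show ?thesis using assms by simp
next
  case False
  have "{z. a + z * b \<in> \<int>} \<subseteq> (\<lambda>n. (of_int n - a) / b) ` (UNIV :: int set)"
  proof
    fix z assume "z \<in> {z. a + z * b \<in> \<int>}"
    then obtain n :: int where "a + z * b = of_int n" by (auto elim: Ints_cases)
    then have "z = (of_int n - a) / b" using False by (simp add: field_simps)
    then show "z \<in> (\<lambda>n. (of_int n - a) / b) ` (UNIV :: int set)" by blast
  qed
  then show ?thesis by (rule countable_subset) simp
qed

text \<open>The complex line through two points of the complement meets the hyperplanes in countably many
points.\<close>
lemma connected_affine_B_complement: "connected (affine_B_complement :: (complex ^ 'n::finite) set)"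
  unfolding connected_iff_connected_component
proof (intro ballI)
  fix u v :: "complex ^ 'n" assume u: "u \<in> affine_B_complement" and v: "v \<in> affine_B_complement"
  let ?l = "\<lambda>z::complex. \<chi> i. u $ i + z * (v $ i - u $ i)"
  define bad where "bad = (\<Union>i. {z. u $ i + z * (v $ i - u $ i) \<in> \<int>}) \<union>
    (\<Union>ij\<in>{(i,j). i \<noteq> j}. {z. (u $ fst ij + u $ snd ij) + z * ((v $ fst ij - u $ fst ij) + (v $ snd ij - u $ snd ij)) \<in> \<int>}
      \<union> {z. (u $ fst ij - u $ snd ij) + z * ((v $ fst ij - u $ fst ij) - (v $ snd ij - u $ snd ij)) \<in> \<int>})"
  have "countable bad"
    unfolding bad_def
    by (intro countable_Un countable_UN countable_finite finite countable_affine_integer)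
       (use u in \<open>auto simp: affine_B_complement_def\<close>)
  then have "connected (- bad)"
    using path_connected_complement_countable[of bad] by (simp add: path_connected_imp_connected)
  moreover have "continuous_on (- bad) ?l" by (intro continuous_intros)
  ultimately have conn: "connected (?l ` (- bad))" by (rule connected_continuous_image[rotated])
  have mem: "?l z \<in> affine_B_complement \<longleftrightarrow> z \<notin> bad" for z
    unfolding affine_B_complement_def bad_def by (auto simp: algebra_simps)
  then have sub: "?l ` (- bad) \<subseteq> affine_B_complement" by auto
  have l01: "?l 0 = u" "?l 1 = v" by (simp_all add: vec_eq_iff)
  have "0 \<in> - bad" using mem[of 0] u unfolding l01 by simp
  then have "u \<in> ?l ` (- bad)" by (rule rev_image_eqI) (rule l01(1)[symmetric])
  moreover have "1 \<in> - bad" using mem[of 1] v unfolding l01 by simp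
  then have "v \<in> ?l ` (- bad)" by (rule rev_image_eqI) (rule l01(2)[symmetric])
  ultimately show "connected_component affine_B_complement u v"
    unfolding connected_component_def using conn sub by (intro exI conjI)
qed

section \<open>Cubes and homotopy groups\<close>

lemma topspace_cube: "topspace (cube k) = PiE {..<k} (\<lambda>_. {0..1})"
  by (simp add: cube_def)

lemma compact_space_cube: "compact_space (cube k)"
proof -
  have "compact_space (top_of_set {0..1::real})" by (simp add: compact_space_subtopology)
  then show ?thesis unfolding cube_def by (simp add: compact_space_product_topology)
qed

lemma Hausdorff_space_cube: "Hausdorff_space (cube k)"
proof -
  have "Hausdorff_space (top_of_set {0..1::real})" by (simp add: Hausdorff_space_subtopology)
  then show ?thesis unfolding cube_def by (simp add: Hausdorff_space_product_topology)
qed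

lemma connected_space_cube: "connected_space (cube k)"
proof -
  have "connected_space (top_of_set {0..1::real})" by (simp add: connected_space_subtopology)
  then show ?thesis unfolding cube_def by (simp add: connected_space_product_topology)
qed

lemma locally_connected_space_cube: "locally_connected_space (cube k)"
proof -
  have "locally_connected_space (top_of_set {0..1::real})" by (simp add: locally_connected_real_interval)
  then show ?thesis unfolding cube_def by (simp add: locally_connected_space_product_topology)
qed

lemma continuous_map_cube_coordinate:
  assumes "i < k"
  shows "continuous_map (cube k) euclideanreal (\<lambda>t. t i)"
proof -
  have "continuous_map (cube k) (top_of_set {0..1}) (\<lambda>t. t i)"
    unfolding cube_def using assms by (intro continuous_map_product_projection) simp
  then show ?thesis by (simp add: continuous_map_in_subtopology)
qed

lemma continuous_map_into_cube:
  assumes "\<And>i. i < k \<Longrightarrow> continuous_map X euclideanreal (\<lambda>x. f x i)"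
    and "\<And>x i. \<lbrakk>x \<in> topspace X; i < k\<rbrakk> \<Longrightarrow> f x i \<in> {0..1}" and "\<And>x. x \<in> topspace X \<Longrightarrow> f x \<in> extensional {..<k}"
  shows "continuous_map X (cube k) f"
  unfolding cube_def continuous_map_componentwise
proof (intro conjI ballI)
  show "f ` topspace X \<subseteq> extensional {..<k}" using assms(3) by blast
  show "continuous_map X (top_of_set {0..1}) (\<lambda>x. f x i)" if "i \<in> {..<k}" for i
    using assms(1,2) that by (intro continuous_map_top_of_setI) auto
qed

text \<open>Shrinking the cube to a corner deforms \<open>g\<close> to a constant, and logarithms can be continued along this homotopy.\<close>
lemma logarithm_on_cube:
  assumes g: "continuous_map (cube k) euclidean g" and nz: "\<And>x. x \<in> topspace (cube k) \<Longrightarrow> g x \<noteq> (0::complex)"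
  shows "\<exists>h. continuous_map (cube k) euclidean h \<and> (\<forall>x\<in>topspace (cube k). g x = exp (h x))"
proof -
  interpret compact_parameter "cube k" by standard (rule compact_space_cube)
  let ?s = "\<lambda>p. \<lambda>i\<in>{..<k}. fst p * snd p i :: real"
  have s: "continuous_map IK (cube k) ?s"
  proof (rule continuous_map_into_cube)
    show "continuous_map IK euclideanreal (\<lambda>p. ?s p i)" if "i < k" for i
      using that by (simp add: continuous_map_mult_field continuous_map_IK_fst continuous_map_IK_snd[OF continuous_map_cube_coordinate])
    show "?s p i \<in> {0..1}" if p: "p \<in> topspace IK" "i < k" for p i
    proof -
      have 1: "fst p \<in> {0..1}" "snd p \<in> topspace (cube k)" using p(1) by (simp_all add: mem_Times_iff)
      have 2: "snd p i \<in> {0..1}" using PiE_mem[OF 1(2)[unfolded topspace_cube], of i] p(2) by simp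
      have "?s p i = fst p * snd p i" using p(2) by simp
      moreover have "0 \<le> fst p * snd p i" "fst p * snd p i \<le> 1"
        using 1(1) 2 by (auto intro: mult_nonneg_nonneg mult_le_one)
      ultimately show ?thesis by (simp only: atLeastAtMost_iff)
    qed
  qed auto
  let ?G = "\<lambda>p. g (?s p)"
  have G: "continuous_map IK euclidean ?G" using continuous_map_compose[OF s g] by (simp add: o_def)
  have Gnz: "?G p \<noteq> 0" if "p \<in> topspace IK" for p
    using nz continuous_map_image_subset_topspace[OF s] that by blast
  define o0 where "o0 = (\<lambda>i\<in>{..<k}. 0 :: real)"
  have "o0 \<in> topspace (cube k)" by (simp add: o0_def topspace_cube PiE_iff)
  then have l: "exp (Ln (g o0)) = ?G (0,x)" for x using nz by (simp add: o0_def)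
  obtain L where L: "continuous_map IK euclidean L" "\<forall>p\<in>topspace IK. exp (L p) = ?G p"
    "\<forall>x\<in>topspace (cube k). L (0,x) = Ln (g o0)"
    "\<forall>x\<in>topspace (cube k). (\<forall>t\<in>{0..1}. ?G (t,x) = ?G (0,x)) \<longrightarrow> (\<forall>t\<in>{0..1}. L (t,x) = Ln (g o0))"
    by (rule lift_logarithm[OF G Gnz, of "\<lambda>_. Ln (g o0)"]) (use l in auto)
  show ?thesis
  proof (intro exI conjI ballI)
    show "continuous_map (cube k) euclidean (\<lambda>x. L (1,x))"
      using continuous_map_o_Pair[OF L(1), of 1] by (simp add: o_def)
    fix x assume x: "x \<in> topspace (cube k)"
    have "?s (1,x) = x" using x by (auto simp: topspace_cube PiE_iff extensional_def fun_eq_iff)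
    moreover have "exp (L (1,x)) = ?G (1,x)" using L(2)[THEN bspec, of "(1,x)"] x by simp
    ultimately show "g x = exp (L (1,x))" by simp
  qed
qed

definition face :: "nat \<Rightarrow> nat \<Rightarrow> real \<Rightarrow> (nat \<Rightarrow> real) set" where
  "face k i e = {t \<in> topspace (cube k). t i = e}"

lemma cube_boundary_faces: "cube_boundary k = (\<Union>i<k. face k i 0 \<union> face k i 1)"
  by (auto simp: cube_boundary_def face_def)

lemma closedin_cube_boundary: "closedin (cube k) (cube_boundary k)"
  unfolding cube_boundary_faces
proof (intro closedin_Union)
  have "closedin (cube k) (face k i e)" if "i < k" for i e
    unfolding face_def
    using closedin_continuous_map_preimage[OF continuous_map_cube_coordinate[OF that], of "{e}"] by simp
  then show "closedin (cube k) S" if "S \<in> (\<lambda>i. face k i 0 \<union> face k i 1) ` {..<k}" for S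
    using that by auto
qed simp

lemma connectedin_face:
  assumes "i < k" "e \<in> {0..1}"
  shows "connectedin (cube k) (face k i e)"
proof -
  have upd: "continuous_map (cube k) (cube k) (\<lambda>t. t(i := e))"
  proof (rule continuous_map_into_cube)
    show "continuous_map (cube k) euclideanreal (\<lambda>t. (t(i := e)) j)" if "j < k" for j
      using continuous_map_cube_coordinate[OF that] by (cases "j = i") auto
  qed (use assms in \<open>auto simp: topspace_cube PiE_iff extensional_def\<close>)
  then have "connectedin (cube k) ((\<lambda>t. t(i := e)) ` topspace (cube k))"
    by (rule connectedin_continuous_map_image) (simp add: connectedin_topspace connected_space_cube)
  moreover have "(\<lambda>t. t(i := e)) ` topspace (cube k) = face k i e"
  proof
    show "(\<lambda>t. t(i := e)) ` topspace (cube k) \<subseteq> face k i e"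
      using continuous_map_image_subset_topspace[OF upd] unfolding face_def by auto
    show "face k i e \<subseteq> (\<lambda>t. t(i := e)) ` topspace (cube k)"
    proof
      fix t assume "t \<in> face k i e"
      then have t: "t \<in> topspace (cube k)" "t = t(i := e)" by (auto simp: face_def)
      show "t \<in> (\<lambda>t. t(i := e)) ` topspace (cube k)" by (rule image_eqI[where x=t]) (rule t)+
    qed
  qed
  ultimately show ?thesis by simp
qed

lemma faces_meet:
  assumes "i < k" "j < k" "i \<noteq> j" "a \<in> {0..1}" "b \<in> {0..1}"
  shows "face k i a \<inter> face k j b \<noteq> {}"
proof -
  have "(\<lambda>l\<in>{..<k}. if l = i then a else if l = j then b else 0) \<in> face k i a \<inter> face k j b"
    using assms by (auto simp: face_def topspace_cube PiE_iff)
  then show ?thesis by blast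
qed

text \<open>Faces with different indices \<open>i \<noteq> j\<close> meet. So every face except \<open>face k 0 1\<close> is \<open>face k 0 0\<close> or meets it, and \<open>face k 0 1\<close> meets
\<open>face k 1 0\<close>, which exists for \<open>k \<ge> 2\<close>.\<close>
lemma connectedin_cube_boundary:
  assumes k: "k \<ge> 2"
  shows "connectedin (cube k) (cube_boundary k)"
proof -
  let ?F = "face k 0 0"
  let ?others = "(\<lambda>(i,e). ?F \<union> face k i e) ` ({1..<k} \<times> {0,1})"
  have others: "?F \<union> face k i e \<subseteq> \<Union>?others" if "(i, e) \<in> {1..<k} \<times> {0,1}" for i e
    using imageI[OF that, of "\<lambda>(i,e). ?F \<union> face k i e"] by (intro Union_upper) simp
  have one: "(1, 0::real) \<in> {1..<k} \<times> {0,1}" using k by simp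
  have "connectedin (cube k) (\<Union>?others)"
  proof (rule connectedin_Union)
    show "connectedin (cube k) S" if "S \<in> ?others" for S
      using that k faces_meet[of 0 k] by (auto intro!: connectedin_Un connectedin_face)
    have "face k 0 0 \<noteq> {}" using faces_meet[of 0 k 1 0 0] k by auto
    moreover have "face k 0 0 \<subseteq> \<Inter>?others" by auto
    ultimately show "\<Inter>?others \<noteq> {}" by blast
  qed
  moreover have "connectedin (cube k) (face k 0 1)" using k by (intro connectedin_face) auto
  moreover have "\<Union>?others \<inter> face k 0 1 \<noteq> {}"
  proof -
    have "face k 1 0 \<subseteq> \<Union>?others" using others[OF one] by blast
    moreover have "face k 1 0 \<inter> face k 0 1 \<noteq> {}" using k by (intro faces_meet) auto
    ultimately show ?thesis by blast
  qed
  ultimately have "connectedin (cube k) (\<Union>?others \<union> face k 0 1)" by (rule connectedin_Un)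
  moreover have "\<Union>?others \<union> face k 0 1 = cube_boundary k"
  proof
    have sub: "face k i e \<subseteq> cube_boundary k" if "i < k" "e \<in> {0,1}" for i e
      using that unfolding cube_boundary_faces by blast
    have "0 < k" using k by simp
    have "S \<subseteq> cube_boundary k" if S: "S \<in> ?others" for S
    proof -
      obtain i e where "S = ?F \<union> face k i e" "i < k" "e \<in> {0,1}" using S by auto
      then show ?thesis using sub[of 0 0] sub[of i e] \<open>0 < k\<close> by simp
    qed
    then show "\<Union>?others \<union> face k 0 1 \<subseteq> cube_boundary k"
      using sub[of 0 1] \<open>0 < k\<close> by (intro Un_least Union_least) simp_all
    show "cube_boundary k \<subseteq> \<Union>?others \<union> face k 0 1"
    proof
      fix t assume "t \<in> cube_boundary k"
      then obtain i e where ie: "i < k" "e \<in> {0,1}" "t \<in> face k i e" unfolding cube_boundary_faces by auto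
      show "t \<in> \<Union>?others \<union> face k 0 1"
      proof (cases "i = 0")
        case True
        then show ?thesis using ie others[OF one] by blast
      next
        case False
        then have "(i,e) \<in> {1..<k} \<times> {0,1}" using ie by auto
        from others[OF this] show ?thesis using ie(3) by blast
      qed
    qed
  qed
  ultimately show ?thesis by simp
qed

lemma logarithmic_pair_cube:
  assumes "k \<ge> 2"
  shows "logarithmic_pair (cube k) (cube_boundary k)"
proof
  show "cube_boundary k \<noteq> {}"
    using faces_meet[of 0 k 1 0 0] assms unfolding cube_boundary_faces by auto
qed (use assms in \<open>simp_all add: compact_space_cube Hausdorff_space_cube connected_space_cube locally_connected_space_cube
      logarithm_on_cube closedin_cube_boundary connectedin_cube_boundary\<close>)

lemma is_singleton_homotopy_group_set:
  assumes "rel_aspherical (cube k) (cube_boundary k) X" and x0: "x0 \<in> topspace X"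
  shows "is_singleton (homotopy_group_set k X x0)"
proof -
  let ?c = "\<lambda>_. x0" and ?R = "spheroid_homotopy k X x0"
  have c: "?c \<in> spheroids k X x0" using x0 by (simp add: spheroids_def)
  have eq: "?R `` {f} = ?R `` {?c}" if f: "f \<in> spheroids k X x0" for f
  proof -
    have h: "homotopic_with (\<lambda>h. \<forall>t\<in>cube_boundary k. h t = x0) (cube k) X f ?c"
      using f by (intro rel_asphericalD[OF assms(1)]) (auto simp: spheroids_def)
    show ?thesis
      using homotopic_with_trans[OF h] homotopic_with_trans[OF homotopic_with_sym[THEN iffD1, OF h]]
      by (auto simp: spheroid_homotopy_def)
  qed
  have "homotopy_group_set k X x0 = (\<Union>f\<in>spheroids k X x0. {?R `` {f}})"
    unfolding homotopy_group_set_def quotient_def ..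
  also have "\<dots> = (\<Union>f\<in>spheroids k X x0. {?R `` {?c}})" by (rule SUP_cong[OF refl]) (simp only: eq)
  also have "\<dots> = {?R `` {?c}}" by (rule UN_constant[THEN trans]) (use c in force)
  finally show ?thesis by (simp add: is_singleton_def)
qed

theorem corollary2p1:
  assumes "CARD('n::finite) \<ge> 3"
  shows "aspherical_space (top_of_set (affine_B_complement :: (complex ^ 'n) set))"
  unfolding aspherical_space_def
proof (intro conjI ballI allI impI)
  show "connected_space (top_of_set (affine_B_complement :: (complex ^ 'n) set))"
    using connected_affine_B_complement[where 'n='n]
    by (simp add: connectedin_def flip: connectedin_iff_connected)
next
  fix x0 :: "complex ^ 'n" and k :: nat
  assume x0: "x0 \<in> topspace (top_of_set affine_B_complement)" and k: "2 \<le> k"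
  interpret logarithmic_pair "cube k" "cube_boundary k" by (rule logarithmic_pair_cube[OF k])
  show "is_singleton (homotopy_group_set k (top_of_set affine_B_complement) x0)"
    by (rule is_singleton_homotopy_group_set[OF rel_aspherical_affine_B_complement x0])
qed

end
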